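(* Let $\nu<1$, $1<p\le2$, $q=p/(p-1)$. Let $sf^*(s)\in L_p(\nu-i\infty,\nu+i\infty)$, where $f^*(s)$ is the Mellin transform of a function $f\in L_1((1,\infty);dt)$. Suppose in addition that the index transform $$F_0(\tau)=\int_0^\infty K_{i\tau/2}^2(x)f(x)\,dx,\qquad\tau\in\mathbb{R},$$ satisfies $\tau e^{\pi|\tau|}F_0(\tau)\in L_1(\mathbb{R})$, and that the Mellin transform $f^*(s)$ vanishes at the point $s=1$. Then for all $x>0$ $$f(x)=\frac{i}{2\pi}\int_{-\infty}^\infty\frac{d}{dx}\left[I_{i\tau/2}^2(x)\right]F_0(\tau)\,\tau\,d\tau,$$ where the integral is absolutely convergent.
   Context: $K_\mu(z)$ is the Macdonald function (modified Bessel function of the second kind) and $I_\mu(z)$ is the modified Bessel function of the first kind. The Mellin transform of $f$ is $f^*(s)=\int_0^\infty f(x)x^{s-1}dx$, and the inverse is $f(x)=\frac{1}{2\pi i}\int_{\nu-i\infty}^{\nu+i\infty}f^*(s)x^{-s}ds$; on the line $\mathrm{Re}\,s=\nu$ these are understood in the mean-convergence sense of Mellin transform theory for $L_p$, so that $f^*\in L_p(\nu-i\infty,\nu+i\infty)$ corresponds to $f$ with $\int_0^\infty x^{\nu q-1}|f(x)|^q dx<\infty$, and $f$ is identified with the function given by the inversion formula. *)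

theory Defs
  imports "HOL-Analysis.Analysis"
begin

text \<open>Principal branch of the power; meaningful for \<open>z \<noteq> 0\<close>
  (\<open>0 powr \<mu> = 0\<close> gives the wrong value for \<open>\<mu> = z = 0\<close>).\<close>

definition bessel_I :: "complex \<Rightarrow> complex \<Rightarrow> complex" where
  "bessel_I \<mu> z = (z / 2) powr \<mu> *
     (\<Sum>k. (z ^ 2 / 4) ^ k * rGamma (\<mu> + of_nat k + 1) / fact k)"

definition bessel_K :: "complex \<Rightarrow> complex \<Rightarrow> complex" where
  "bessel_K \<mu> z =
     (let Q = (\<lambda>w. of_real (pi / 2) * (bessel_I (- w) z - bessel_I w z) / sin (of_real pi * w))
      in if \<mu> \<in> \<int> then Lim (at \<mu>) Q else Q \<mu>)"

text \<open>Membership of \<open>F\<close> in \<open>L\<^sub>p(\<nu> - i\<infinity>, \<nu> + i\<infinity>)\<close>. Only the values of \<open>F\<close> on the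
  line matter.\<close>

definition Lp_line :: "real \<Rightarrow> real \<Rightarrow> (complex \<Rightarrow> complex) \<Rightarrow> bool" where
  "Lp_line \<nu> p F \<longleftrightarrow>
     (\<lambda>t. F (Complex \<nu> t)) \<in> borel_measurable lebesgue \<and>
     integrable lebesgue (\<lambda>t. norm (F (Complex \<nu> t)) powr p)"

text \<open>Membership of \<open>f\<close> in \<open>L\<^sub>q((0, \<infinity>); x\<^bsup>\<nu>q-1\<^esup> dx)\<close>.\<close>

definition Lq_weighted :: "real \<Rightarrow> real \<Rightarrow> (real \<Rightarrow> complex) \<Rightarrow> bool" where
  "Lq_weighted \<nu> q f \<longleftrightarrow>
     set_borel_measurable lebesgue {0<..} f \<and>
     set_integrable lebesgue {0<..} (\<lambda>x. x powr (\<nu> * q - 1) * norm (f x) powr q)"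

definition mellin :: "(real \<Rightarrow> complex) \<Rightarrow> complex \<Rightarrow> complex" where
  "mellin f s = (LINT x:{0<..}|lebesgue. f x * of_real x powr (s - 1))"

text \<open>\<open>F\<close> is the Mellin transform of \<open>f\<close> on the line \<open>Re s = \<nu>\<close> in the sense of
  convergence in mean: the integrals over \<open>[1/N, N]\<close> converge to \<open>F\<close> in \<open>L\<^sub>p\<close> of the line.
  The \<open>p\<close>-th power of the distance is taken in \<open>[0, \<infinity>]\<close>, so that a divergent one
  does not count as zero.\<close>

definition mellin_in_mean ::
    "real \<Rightarrow> real \<Rightarrow> (real \<Rightarrow> complex) \<Rightarrow> (complex \<Rightarrow> complex) \<Rightarrow> bool" where
  "mellin_in_mean \<nu> p f F \<longleftrightarrow> Lp_line \<nu> p F \<and>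
     ((\<lambda>N::real. \<integral>\<^sup>+ t. ennreal (norm (F (Complex \<nu> t) -
          (LINT x:{1/N..N}|lebesgue. f x * of_real x powr (Complex \<nu> t - 1))) powr p) \<partial>lebesgue)
        \<longlongrightarrow> 0) at_top"

text \<open>The inversion integral along \<open>s = \<nu> + i t\<close>, where \<open>ds = i dt\<close> cancels the \<open>i\<close>
  of the prefactor.\<close>

definition inverse_mellin :: "real \<Rightarrow> (complex \<Rightarrow> complex) \<Rightarrow> real \<Rightarrow> complex" where
  "inverse_mellin \<nu> F x =
     1 / (2 * of_real pi) * (LINT t|lebesgue. F (Complex \<nu> t) * of_real x powr (- Complex \<nu> t))"

definition index_transform :: "(real \<Rightarrow> complex) \<Rightarrow> real \<Rightarrow> complex" where
  "index_transform f \<tau> =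
     (LINT x:{0<..}|lebesgue. bessel_K (\<i> * of_real \<tau> / 2) (of_real x) ^ 2 * f x)"

end

theory Submission
  imports Defs "HOL-Probability.Probability"
begin

text \<open>The Macdonald function enters through a Fourier integral: if
\<open>g(t) = \<integral>\<^sub>0\<^sup>\<infinity> K\<^sub>0(2x cosh t) f(x) dx\<close>, then, since
\<open>K\<^bsub>i\<tau>/2\<^esub>(x)\<^sup>2 = \<integral>\<^sub>\<real> e\<^bsup>i\<tau>t\<^esup> K\<^sub>0(2x cosh t) dt\<close>, the index transform
\<open>F\<^sub>0\<close> is the Fourier transform of \<open>g\<close>
(\<open>bessel_K_square_integral\<close>, \<open>index_transform_eq_fourier\<close>). Fourier inversion therefore
gives \<open>\<integral> \<tau> F\<^sub>0(\<tau>) e\<^bsup>-i\<tau>w\<^esup> d\<tau> = 2\<pi>i g'(w)\<close>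
(\<open>tau_fourier_eq\<close>).

The other Bessel function has the dual property
\<open>\<integral>\<^sub>0\<^sup>\<infinity> x K\<^sub>0(2x cosh w) I\<^bsub>i\<tau>/2\<^esub>(x)\<^sup>2 dx = e\<^bsup>-i\<tau>w\<^esup> / (2 sinh 2w)\<close>
(\<open>K0_transform_bessel_I_square\<close>). Hence the function
\<open>T(x) = \<integral> \<tau> F\<^sub>0(\<tau>) I\<^bsub>i\<tau>/2\<^esub>(x)\<^sup>2 d\<tau>\<close> satisfies
\<open>\<integral>\<^sub>0\<^sup>\<infinity> x K\<^sub>0(2x cosh w) T(x) dx = \<pi>i g'(w) / sinh 2w\<close>.
Differentiating \<open>g\<close> under the integral and integrating by parts in \<open>x\<close>, one sees that
\<open>-2\<pi>i \<integral>\<^sub>0\<^sup>x f\<close> has the same transform. Because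
\<open>2 K\<^sub>0(2ux) = \<integral>\<^sub>\<real> exp(-u\<^sup>2 e\<^sup>r - x\<^sup>2 e\<^bsup>-r\<^esup>) dr\<close>, this transform
is a composition of two Laplace transforms, one in \<open>x\<^sup>2\<close> and one in \<open>e\<^sup>r\<close>. Two
applications of the uniqueness theorem \<open>laplace_unique\<close> yield
\<open>T(x) = -2\<pi>i \<integral>\<^sub>0\<^sup>x f\<close> (\<open>gauss_inverse_eq\<close>,
\<open>index_inverse_eq_primitive\<close>), and the theorem is the derivative of this identity.

Every exchange of integrals is absolutely convergent. On the side of \<open>I\<close> this rests on
\<open>\<bar>\<Gamma>(1 + i\<tau>/2)\<bar>\<^bsup>-2\<^esup> \<le> e\<^bsup>\<pi>\<bar>\<tau>\<bar>/2\<^esup>\<close>, which the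
hypothesis on \<open>\<tau> e\<^bsup>\<pi>\<bar>\<tau>\<bar>\<^esup> F\<^sub>0(\<tau>)\<close> dominates. On the side of \<open>f\<close> it
rests on the integrability of \<open>f\<close> at infinity and on \<open>f(x) = O(x\<^bsup>-\<nu>\<^esup>)\<close> with
\<open>\<nu> < 1\<close>, which follows from the integrability of the Mellin transform on the line.

The variable of the Bessel functions is written as \<open>e\<^bsup>\<xi>\<^esup>\<close>. Scalings become translations,
and the transforms of Bessel functions reduce to the single integral \<open>Gamma_integral_exp\<close>.\<close>

section \<open>Dominated limits, Fubini and the Gamma integral\<close>

lemma continuous_on_integral_dominated:
  fixes f :: "'c::metric_space \<Rightarrow> 'a \<Rightarrow> 'b::{banach,second_countable_topology}"
  assumes cont: "\<And>\<omega>. \<omega> \<in> space M \<Longrightarrow> continuous_on S (\<lambda>y. f y \<omega>)"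
    and meas: "\<And>y. y \<in> S \<Longrightarrow> f y \<in> borel_measurable M"
    and bound: "\<And>y \<omega>. y \<in> S \<Longrightarrow> \<omega> \<in> space M \<Longrightarrow> norm (f y \<omega>) \<le> h \<omega>"
    and h: "integrable M h"
  shows "continuous_on S (\<lambda>y. \<integral>\<omega>. f y \<omega> \<partial>M)"
  unfolding continuous_on_sequentially comp_def
proof safe
  fix X x assume X: "\<forall>n. X n \<in> S" and x: "x \<in> S" and lim: "X \<longlonglongrightarrow> x"
  show "(\<lambda>n. \<integral>\<omega>. f (X n) \<omega> \<partial>M) \<longlonglongrightarrow> (\<integral>\<omega>. f x \<omega> \<partial>M)"
  proof (rule integral_dominated_convergence[where w = h])
    show "AE \<omega> in M. (\<lambda>n. f (X n) \<omega>) \<longlonglongrightarrow> f x \<omega>"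
      using cont X x lim
      by (intro AE_I2) (auto simp: continuous_on_sequentially comp_def)
  qed (use X x bound meas h in auto)
qed

text \<open>Here the majorant bounds the partial sums. For the series of \<open>I\<^sup>2\<close> such a bound is available
as a whole, through a Cauchy product of majorant series.\<close>

lemma has_bochner_integral_sums_dominated:
  fixes t :: "nat \<Rightarrow> 'a \<Rightarrow> 'b::{banach,second_countable_topology}"
  assumes t: "\<And>n. has_bochner_integral M (t n) (c n)"
    and sums: "\<And>x. (\<lambda>n. t n x) sums f x"
    and bound: "\<And>N x. norm (\<Sum>n<N. t n x) \<le> g x"
    and g: "integrable M g" and V: "c sums V"
  shows "has_bochner_integral M f V"
proof -
  define S where "S N x = (\<Sum>n<N. t n x)" for N x
  have S: "has_bochner_integral M (S N) (\<Sum>n<N. c n)" for N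
    unfolding S_def by (intro has_bochner_integral_sum t)
  have Sm: "S N \<in> borel_measurable M" for N
    using S[of N] by (auto simp: has_bochner_integral_iff)
  have lim: "(\<lambda>N. S N x) \<longlonglongrightarrow> f x" for x
    using sums unfolding S_def sums_def .
  have fm: "f \<in> borel_measurable M"
    by (rule borel_measurable_LIMSEQ_metric[OF Sm lim])
  have conv: "integrable M f" "(\<lambda>N. integral\<^sup>L M (S N)) \<longlonglongrightarrow> integral\<^sup>L M f"
    using fm Sm lim bound g
    by (auto intro!: integrable_dominated_convergence[where s = S and w = g]
         integral_dominated_convergence[where s = S and w = g] simp: S_def)
  have "c sums integral\<^sup>L M f"
    using conv(2) S unfolding sums_def by (simp add: has_bochner_integral_iff)
  thus ?thesis using V conv(1) by (auto simp: has_bochner_integral_iff intro: sums_unique2)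
qed

lemma has_vector_derivative_iff_slope:
  fixes f :: "real \<Rightarrow> 'a::real_normed_vector"
  shows "(f has_vector_derivative D) (at x within S) \<longleftrightarrow>
    ((\<lambda>y. (f y - f x) /\<^sub>R (y - x)) \<longlongrightarrow> D) (at x within S)"
proof -
  have "(f has_vector_derivative D) (at x within S) \<longleftrightarrow>
      ((\<lambda>y. norm ((f y - f x) - (y - x) *\<^sub>R D) / norm (y - x)) \<longlongrightarrow> 0) (at x within S)"
    unfolding has_vector_derivative_def has_derivative_iff_norm
    by (simp add: bounded_linear_scaleR_left)
  also have "\<dots> \<longleftrightarrow> ((\<lambda>y. norm ((f y - f x) /\<^sub>R (y - x) - D)) \<longlongrightarrow> 0) (at x within S)"
  proof (rule filterlim_cong[OF refl refl])
    show "\<forall>\<^sub>F y in at x within S.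
        norm ((f y - f x) - (y - x) *\<^sub>R D) / norm (y - x) = norm ((f y - f x) /\<^sub>R (y - x) - D)"
    proof (rule eventually_at_filter[THEN iffD2], rule always_eventually, safe)
      fix y assume "y \<noteq> x"
      hence "(f y - f x) /\<^sub>R (y - x) - D = ((f y - f x) - (y - x) *\<^sub>R D) /\<^sub>R (y - x)"
        by (simp add: scaleR_diff_right)
      thus "norm ((f y - f x) - (y - x) *\<^sub>R D) / norm (y - x) = norm ((f y - f x) /\<^sub>R (y - x) - D)"
        by (simp add: divide_inverse mult.commute)
    qed
  qed
  also have "\<dots> \<longleftrightarrow> ((\<lambda>y. (f y - f x) /\<^sub>R (y - x)) \<longlongrightarrow> D) (at x within S)"
    by (simp add: tendsto_norm_zero_iff LIM_zero_iff)
  finally show ?thesis .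
qed

text \<open>The mean value inequality carries the bound \<open>h\<close> over from the derivative to all difference
quotients, so that dominated convergence applies to these.\<close>

lemma has_vector_derivative_integral_dominated:
  fixes f :: "real \<Rightarrow> 'a \<Rightarrow> 'b::{banach,second_countable_topology}"
  assumes x: "x \<in> {a<..<b}"
    and int: "\<And>y. y \<in> {a<..<b} \<Longrightarrow> integrable M (f y)"
    and der: "\<And>y \<omega>. y \<in> {a<..<b} \<Longrightarrow> \<omega> \<in> space M \<Longrightarrow>
               ((\<lambda>y. f y \<omega>) has_vector_derivative f' y \<omega>) (at y)"
    and bound: "\<And>y \<omega>. y \<in> {a<..<b} \<Longrightarrow> \<omega> \<in> space M \<Longrightarrow> norm (f' y \<omega>) \<le> h \<omega>"
    and h: "integrable M h"
    and meas: "f' x \<in> borel_measurable M"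
  shows "integrable M (f' x)"
    and "((\<lambda>y. \<integral>\<omega>. f y \<omega> \<partial>M) has_vector_derivative (\<integral>\<omega>. f' x \<omega> \<partial>M)) (at x)"
proof -
  show int': "integrable M (f' x)"
    using h meas by (rule Bochner_Integration.integrable_bound)
       (use bound[OF x] in \<open>auto intro!: AE_I2 order_trans[OF _ abs_ge_self]\<close>)
  have lip: "norm (f y \<omega> - f x \<omega>) \<le> h \<omega> * \<bar>y - x\<bar>"
    if y: "y \<in> {a<..<b}" and w: "\<omega> \<in> space M" for y \<omega>
  proof -
    have "norm (f y \<omega> - f x \<omega>) \<le> h \<omega> * norm (y - x)"
    proof (rule differentiable_bound[where S = "{a<..<b}" and f = "\<lambda>y. f y \<omega>"
          and f' = "\<lambda>y t. t *\<^sub>R f' y \<omega>"])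
      fix z assume z: "z \<in> {a<..<b}"
      show "((\<lambda>y. f y \<omega>) has_derivative (\<lambda>t. t *\<^sub>R f' z \<omega>)) (at z within {a<..<b})"
        using der[OF z w] has_derivative_at_withinI has_vector_derivative_def by blast
      show "onorm (\<lambda>t. t *\<^sub>R f' z \<omega>) \<le> h \<omega>"
        using bound[OF z w] by (intro onorm_le) (simp add: mult.commute[of "h \<omega>"] mult_left_mono)
    qed (use x y in auto)
    thus ?thesis by simp
  qed
  have "((\<lambda>y. ((\<integral>\<omega>. f y \<omega> \<partial>M) - (\<integral>\<omega>. f x \<omega> \<partial>M)) /\<^sub>R (y - x)) \<longlongrightarrow> (\<integral>\<omega>. f' x \<omega> \<partial>M)) (at x within {a<..<b})"
    unfolding tendsto_at_iff_sequentially comp_def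
  proof safe
    fix X assume X: "\<forall>i::nat. X i \<in> {a<..<b} - {x}" and lim: "X \<longlonglongrightarrow> x"
    have eq: "((\<integral>\<omega>. f (X n) \<omega> \<partial>M) - (\<integral>\<omega>. f x \<omega> \<partial>M)) /\<^sub>R (X n - x)
            = (\<integral>\<omega>. (f (X n) \<omega> - f x \<omega>) /\<^sub>R (X n - x) \<partial>M)" for n
      using X int x by (simp add: Bochner_Integration.integral_diff)
    show "(\<lambda>n. ((\<integral>\<omega>. f (X n) \<omega> \<partial>M) - (\<integral>\<omega>. f x \<omega> \<partial>M)) /\<^sub>R (X n - x)) \<longlonglongrightarrow> (\<integral>\<omega>. f' x \<omega> \<partial>M)"
      unfolding eq
    proof (rule integral_dominated_convergence[where w = h])
      show "AE \<omega> in M. norm ((f (X n) \<omega> - f x \<omega>) /\<^sub>R (X n - x)) \<le> h \<omega>" for n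
      proof (intro AE_I2)
        fix \<omega> assume w: "\<omega> \<in> space M"
        have "X n \<noteq> x" and "X n \<in> {a<..<b}" using X by auto
        with lip[OF _ w, of "X n"]
        have "norm (f (X n) \<omega> - f x \<omega>) / \<bar>X n - x\<bar> \<le> h \<omega>"
          by (simp add: pos_divide_le_eq)
        thus "norm ((f (X n) \<omega> - f x \<omega>) /\<^sub>R (X n - x)) \<le> h \<omega>"
          by (simp add: divide_inverse mult.commute)
      qed
      show "AE \<omega> in M. (\<lambda>n. (f (X n) \<omega> - f x \<omega>) /\<^sub>R (X n - x)) \<longlonglongrightarrow> f' x \<omega>"
      proof (intro AE_I2)
        fix \<omega> assume w: "\<omega> \<in> space M"
        have "((\<lambda>y. (f y \<omega> - f x \<omega>) /\<^sub>R (y - x)) \<longlongrightarrow> f' x \<omega>) (at x)"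
          using der[OF x w] by (simp only: has_vector_derivative_iff_slope)
        moreover have "filterlim X (at x) sequentially"
          using X lim by (auto simp: filterlim_at)
        ultimately show "(\<lambda>n. (f (X n) \<omega> - f x \<omega>) /\<^sub>R (X n - x)) \<longlonglongrightarrow> f' x \<omega>"
          by (rule filterlim_compose)
      qed
      show "(\<lambda>\<omega>. (f (X n) \<omega> - f x \<omega>) /\<^sub>R (X n - x)) \<in> borel_measurable M" for n
        using X int x by (intro borel_measurable_integrable) auto
    qed (use meas h in auto)
  qed
  hence "((\<lambda>y. \<integral>\<omega>. f y \<omega> \<partial>M) has_vector_derivative (\<integral>\<omega>. f' x \<omega> \<partial>M)) (at x within {a<..<b})"
    unfolding has_vector_derivative_iff_slope .
  thus "((\<lambda>y. \<integral>\<omega>. f y \<omega> \<partial>M) has_vector_derivative (\<integral>\<omega>. f' x \<omega> \<partial>M)) (at x)"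
    using x by (metis at_within_open open_greaterThanLessThan)
qed

text \<open>Tonelli's criterion for a majorant whose inner integral need only be estimated.\<close>

lemma Fubini_dominated:
  fixes f :: "'a \<times> 'b \<Rightarrow> 'c::{banach,second_countable_topology}"
  assumes "sigma_finite_measure M1" and "sigma_finite_measure M2"
    and f [measurable]: "f \<in> borel_measurable (M1 \<Otimes>\<^sub>M M2)"
    and bound: "\<And>x y. x \<in> space M1 \<Longrightarrow> y \<in> space M2 \<Longrightarrow> norm (f (x, y)) \<le> h x y"
    and h: "\<And>x. x \<in> space M1 \<Longrightarrow> integrable M2 (h x)"
    and H: "integrable M1 H"
    and hH: "\<And>x. x \<in> space M1 \<Longrightarrow> (\<integral>y. h x y \<partial>M2) \<le> H x"
  shows "integrable (M1 \<Otimes>\<^sub>M M2) f"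
proof -
  interpret M1: sigma_finite_measure M1 by fact
  interpret M2: sigma_finite_measure M2 by fact
  interpret pair_sigma_finite M1 M2 ..
  have i: "integrable M2 (\<lambda>y. f (x, y))" if "x \<in> space M1" for x
    using h[OF that]
    by (rule Bochner_Integration.integrable_bound)
       (use that bound in \<open>auto intro!: AE_I2 order_trans[OF _ abs_ge_self]\<close>)
  show ?thesis
  proof (rule Fubini_integrable)
    show "integrable M1 (\<lambda>x. \<integral>y. norm (f (x, y)) \<partial>M2)"
    proof (rule Bochner_Integration.integrable_bound[OF H])
      show "AE x in M1. norm (\<integral>y. norm (f (x, y)) \<partial>M2) \<le> norm (H x)"
      proof (rule AE_I2)
        fix x assume x: "x \<in> space M1"
        have "(\<integral>y. norm (f (x, y)) \<partial>M2) \<le> (\<integral>y. h x y \<partial>M2)"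
          using i[OF x] h[OF x] bound[OF x] by (intro integral_mono) auto
        also have "\<dots> \<le> H x" using hH[OF x] .
        finally show "norm (\<integral>y. norm (f (x, y)) \<partial>M2) \<le> norm (H x)"
          by simp
      qed
    qed measurable
  qed (use i in auto)
qed

lemma Fubini_product_bound:
  fixes f :: "'a \<times> 'b \<Rightarrow> 'c::{banach,second_countable_topology}"
  assumes "sigma_finite_measure M1" and "sigma_finite_measure M2"
    and "f \<in> borel_measurable (M1 \<Otimes>\<^sub>M M2)"
    and bound: "\<And>x y. x \<in> space M1 \<Longrightarrow> y \<in> space M2 \<Longrightarrow> norm (f (x, y)) \<le> a x * b y"
    and "integrable M1 a" and "integrable M2 b"
  shows "integrable (M1 \<Otimes>\<^sub>M M2) f"
  by (rule Fubini_dominated[where h = "\<lambda>x y. a x * b y" and H = "\<lambda>x. a x * (\<integral>y. b y \<partial>M2)"])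
     (use assms in auto)

text \<open>Euler's integral after the substitution of \<open>e\<^sup>x\<close>; the constant \<open>c\<close> is a translation of
\<open>x\<close> by \<open>ln c\<close>.\<close>

lemma Gamma_integral_exp:
  fixes a :: complex and c :: real
  assumes a: "Re a > 0" and c: "c > 0"
  shows "has_bochner_integral lborel (\<lambda>x. exp (a * of_real x - of_real (c * exp x)))
           (Gamma a * exp (- a * of_real (ln c)))"
proof -
  let ?f = "\<lambda>t. complex_of_real t powr (a - 1) / of_real (exp t)"
  let ?g = "\<lambda>x::real. exp (a * of_real x - of_real (exp x))"
  have "integral {0<..} ?f = Gamma a"
    using Gamma_integral_complex'[OF a] by (rule integral_unique)
  moreover have "{0<..} = range (exp :: real \<Rightarrow> real)"
    by (auto simp: image_iff) (metis exp_ln)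
  ultimately have "(\<lambda>x. \<bar>exp x\<bar> *\<^sub>R ?f (exp x)) absolutely_integrable_on UNIV \<and>
      integral UNIV (\<lambda>x. \<bar>exp x\<bar> *\<^sub>R ?f (exp x)) = Gamma a"
    using absolutely_integrable_Gamma_integral'[OF a]
    by (subst has_absolute_integral_change_of_variables_real)
       (auto intro!: derivative_eq_intros inj_onI)
  also have "(\<lambda>x. \<bar>exp x\<bar> *\<^sub>R ?f (exp x)) = ?g"
  proof
    fix x :: real
    have "\<bar>exp x\<bar> *\<^sub>R ?f (exp x) = exp (of_real x) * (exp ((a - 1) * of_real x) / exp (of_real (exp x)))"
      by (simp add: powr_def scaleR_conv_of_real Ln_of_real exp_of_real)
    also have "\<dots> = ?g x"
      by (simp add: exp_diff[symmetric] exp_add[symmetric] field_simps)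
    finally show "\<bar>exp x\<bar> *\<^sub>R ?f (exp x) = ?g x" .
  qed
  finally have 1: "integrable lebesgue ?g" "integral\<^sup>L lebesgue ?g = Gamma a"
    using set_lebesgue_integral_eq_integral(2)[of UNIV ?g]
    by (auto simp: set_integrable_def set_lebesgue_integral_def)
  have [measurable]: "?g \<in> borel_measurable lborel" by measurable
  have g: "integrable lborel ?g" "integral\<^sup>L lborel ?g = Gamma a"
    using 1 by (simp_all add: integrable_completion integral_completion)
  have eq: "exp (a * of_real x - of_real (c * exp x)) = exp (- a * of_real (ln c)) * ?g (ln c + 1 * x)" for x
    using c by (simp add: exp_add exp_diff exp_minus field_simps flip: exp_of_real)
  have "integrable lborel (\<lambda>x. ?g (ln c + 1 * x))"
    by (rule lborel_integrable_real_affine[OF g(1)]) simp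
  moreover have "(LBINT x. ?g (ln c + 1 * x)) = Gamma a"
    using lborel_integral_real_affine[of 1 ?g "ln c"] g(2) by simp
  ultimately show ?thesis
    unfolding has_bochner_integral_iff eq by (simp del: of_real_add)
qed

lemma has_bochner_integral_affine:
  fixes f :: "real \<Rightarrow> 'a :: {banach, second_countable_topology}"
  assumes "has_bochner_integral lborel f I" and "c > 0"
  shows "has_bochner_integral lborel (\<lambda>x. f (t + c * x)) (I /\<^sub>R c)"
proof -
  have "integral\<^sup>L lborel f = c *\<^sub>R (LBINT x. f (t + c * x))"
    using lborel_integral_real_affine[of c f t] assms(2) by simp
  moreover have "(LBINT x. f (t + c * x)) = (c *\<^sub>R (LBINT x. f (t + c * x))) /\<^sub>R c"
    using assms(2) by simp
  ultimately have "(LBINT x. f (t + c * x)) = I /\<^sub>R c"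
    using assms(1) by (metis has_bochner_integral_iff)
  thus ?thesis
    using assms lborel_integrable_real_affine[of f c t] by (simp add: has_bochner_integral_iff)
qed

section \<open>Uniqueness of Laplace transforms\<close>

text \<open>The vanishing integrals say that the integrable function \<open>e\<^bsup>-lE\<^esup> \<phi>\<close> is orthogonal to all
polynomials in \<open>y = e\<^bsup>-E\<^esup>\<close>, hence, by Bernstein's form of the Weierstrass theorem on
\<open>[0, 1]\<close>, to all continuous functions of \<open>y\<close>. A tent function of \<open>y\<close> is concentrated near
\<open>x\<^sub>0\<close> because \<open>E\<close> is strictly monotone, and it detects \<open>\<phi>(x\<^sub>0) \<noteq> 0\<close>. Carrying
\<open>E\<close> along makes the lemma applicable to Laplace transforms in \<open>e\<^bsup>\<xi>\<^esup>\<close> and in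
\<open>e\<^bsup>2\<xi>\<^esup>\<close> without a change of variables.\<close>

lemma laplace_unique:
  fixes \<phi> :: "real \<Rightarrow> complex" and E :: "real \<Rightarrow> real"
  assumes mono: "strict_mono E" and nonneg: "\<And>x. E x \<ge> 0"
    and contE: "continuous_on UNIV E" and cont: "continuous_on UNIV \<phi>"
    and int: "integrable lborel (\<lambda>x. of_real (exp (- l * E x)) * \<phi> x)"
    and zero: "\<And>n::nat. (LBINT x. of_real (exp (- (l + n) * E x)) * \<phi> x) = 0"
  shows "\<phi> x\<^sub>0 = 0"
proof (rule ccontr)
  define y where "y x = exp (- E x)" for x
  define \<psi> where "\<psi> x = of_real (exp (- l * E x)) * \<phi> x" for x
  have y01: "0 < y x" "y x \<le> 1" for x
    using nonneg by (auto simp: y_def)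
  have [measurable]: "E \<in> borel_measurable borel" "\<phi> \<in> borel_measurable borel"
    using contE cont by (auto intro: borel_measurable_continuous_onI)
  have [measurable]: "y \<in> borel_measurable borel" "\<psi> \<in> borel_measurable borel"
    unfolding y_def[abs_def] \<psi>_def[abs_def] by measurable
  have \<psi>: "integrable lborel \<psi>" using int unfolding \<psi>_def[abs_def] .
  have intc: "integrable lborel (\<lambda>x. of_real (c (y x)) * \<psi> x)"
    if [measurable]: "c \<in> borel_measurable borel" and "\<And>t. 0 \<le> t \<Longrightarrow> t \<le> 1 \<Longrightarrow> \<bar>c t\<bar> \<le> B" for c :: "real \<Rightarrow> real" and B
  proof (rule Bochner_Integration.integrable_bound)
    show "integrable lborel (\<lambda>x. B * norm (\<psi> x))" using \<psi> by simp
    show "AE x in lborel. norm (of_real (c (y x)) * \<psi> x) \<le> norm (B * norm (\<psi> x))"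
    proof (rule AE_I2)
      fix x
      have "\<bar>c (y x)\<bar> \<le> \<bar>B\<bar>" using that(2)[of "y x"] y01[of x] by simp
      thus "norm (of_real (c (y x)) * \<psi> x) \<le> norm (B * norm (\<psi> x))"
        by (simp add: norm_mult abs_mult mult_right_mono)
    qed
  qed measurable
  have poly: "(LBINT x. of_real (y x ^ a * (1 - y x) ^ b) * \<psi> x) = 0" for a b
  proof (induction b arbitrary: a)
    case 0
    have "of_real (y x ^ a) * \<psi> x = of_real (exp (- (l + a) * E x)) * \<phi> x" for x
      by (simp add: y_def \<psi>_def exp_of_nat_mult[symmetric] exp_add[symmetric] algebra_simps
               flip: of_real_mult of_real_power)
    thus ?case using zero by simp
  next
    case (Suc b)
    have i: "integrable lborel (\<lambda>x. of_real (y x ^ a * (1 - y x) ^ b) * \<psi> x)" for a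
    proof (rule intc[where c = "\<lambda>t. t ^ a * (1 - t) ^ b" and B = 1])
      fix t :: real assume "0 \<le> t" "t \<le> 1"
      thus "\<bar>t ^ a * (1 - t) ^ b\<bar> \<le> 1"
        by (simp add: abs_mult mult_le_one power_le_one)
    qed measurable
    have "of_real (y x ^ a * (1 - y x) ^ Suc b) * \<psi> x =
        of_real (y x ^ a * (1 - y x) ^ b) * \<psi> x - of_real (y x ^ Suc a * (1 - y x) ^ b) * \<psi> x" for x
      by (simp add: algebra_simps)
    thus ?case using Suc i by (simp only: Bochner_Integration.integral_diff[OF i i]) simp
  qed
  have contint: "(LBINT x. of_real (c (y x)) * \<psi> x) = 0"
    if c: "continuous_on UNIV c" for c :: "real \<Rightarrow> real"
  proof -
    have [measurable]: "c \<in> borel_measurable borel"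
      using c by (rule borel_measurable_continuous_onI)
    have c01: "continuous_on {0..1} c" using c continuous_on_subset by blast
    hence "bounded (c ` {0..1})"
      by (intro compact_imp_bounded compact_continuous_image) auto
    then obtain B where B: "\<And>t. 0 \<le> t \<Longrightarrow> t \<le> 1 \<Longrightarrow> \<bar>c t\<bar> \<le> B"
      unfolding bounded_iff by (metis atLeastAtMost_iff imageI real_norm_def)
    have ic: "integrable lborel (\<lambda>x. of_real (c (y x)) * \<psi> x)"
      using B by (intro intc) auto
    have est: "norm (LBINT x. of_real (c (y x)) * \<psi> x) \<le> e * (LBINT x. norm (\<psi> x))" if e: "e > 0" for e
    proof -
      obtain N where N: "\<And>t. t \<in> {0..1} \<Longrightarrow> \<bar>c t - (\<Sum>k\<le>N. c (k / N) * Bernstein N k t)\<bar> < e"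
        using Bernstein_Weierstrass[OF c01 e] by blast
      define P where "P t = (\<Sum>k\<le>N. c (k / N) * Bernstein N k t)" for t
      have b: "of_real (P (y x)) * \<psi> x =
          (\<Sum>k\<le>N. of_real (c (k / N) * (N choose k)) * (of_real (y x ^ k * (1 - y x) ^ (N - k)) * \<psi> x))" for x
        by (simp add: P_def Bernstein_def sum_distrib_left sum_distrib_right mult_ac)
      have "(LBINT x. of_real (P (y x)) * \<psi> x) = 0 \<and> integrable lborel (\<lambda>x. of_real (P (y x)) * \<psi> x)"
      proof -
        have i: "integrable lborel (\<lambda>x. of_real (y x ^ k * (1 - y x) ^ (N - k)) * \<psi> x)" for k
        proof (rule intc[where c = "\<lambda>t. t ^ k * (1 - t) ^ (N - k)" and B = 1])
          fix t :: real assume "0 \<le> t" "t \<le> 1"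
          thus "\<bar>t ^ k * (1 - t) ^ (N - k)\<bar> \<le> 1"
            by (simp add: abs_mult mult_le_one power_le_one)
        qed measurable
        show ?thesis unfolding b
          by (auto simp del: of_real_mult of_real_power intro!: Bochner_Integration.integrable_sum i integrable_mult_right)
             (subst Bochner_Integration.integral_sum; use i poly in \<open>simp del: of_real_mult of_real_power\<close>)
      qed
      hence "(LBINT x. of_real (c (y x)) * \<psi> x) = (LBINT x. of_real (c (y x)) * \<psi> x - of_real (P (y x)) * \<psi> x)"
        using ic by simp
      also have "norm \<dots> \<le> (LBINT x. e * norm (\<psi> x))"
      proof (rule Bochner_Integration.integral_norm_bound_integral)
        fix x
        have "\<bar>c (y x) - P (y x)\<bar> \<le> e"
          using N[of "y x"] y01[of x] unfolding P_def by simp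
        thus "norm (of_real (c (y x)) * \<psi> x - of_real (P (y x)) * \<psi> x) \<le> e * norm (\<psi> x)"
          by (simp add: left_diff_distrib[symmetric] norm_mult mult_right_mono flip: of_real_diff)
      qed (use ic \<open>_ \<and> _\<close> \<psi> in auto)
      finally show ?thesis by simp
    qed
    have "norm (LBINT x. of_real (c (y x)) * \<psi> x) \<le> 0"
    proof (rule field_le_epsilon)
      fix d :: real assume "d > 0"
      define I where "I = (LBINT x. norm (\<psi> x))"
      have "I \<ge> 0" by (simp add: I_def)
      from \<open>d > 0\<close> this have "d / (I + 1) * I \<le> d"
        by (simp add: field_simps)
      with est[of "d / (I + 1)"] \<open>d > 0\<close> \<open>I \<ge> 0\<close>
      show "norm (LBINT x. of_real (c (y x)) * \<psi> x) \<le> 0 + d"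
        unfolding I_def[symmetric] by simp
    qed
    thus ?thesis by simp
  qed
  define z where "z = \<phi> x\<^sub>0"
  assume "\<phi> x\<^sub>0 \<noteq> 0"
  hence z: "norm z > 0" by (simp add: z_def)
  have "continuous (at x\<^sub>0) \<phi>" using cont by (simp add: continuous_on_eq_continuous_at)
  then obtain \<epsilon> where \<epsilon>: "\<epsilon> > 0" and near: "\<And>x. \<bar>x - x\<^sub>0\<bar> < \<epsilon> \<Longrightarrow> norm (\<phi> x - z) < norm z / 2"
    unfolding continuous_at_eps_delta z_def[symmetric] using z
    by (metis dist_norm half_gt_zero real_norm_def)
  \<comment> \<open>Points at which \<open>y\<close> differs from \<open>y x\<^sub>0\<close> by less than \<open>\<delta>\<close> lie within \<open>\<epsilon>\<close> of \<open>x\<^sub>0\<close>.\<close>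
  define \<delta> where "\<delta> = min (y x\<^sub>0 - y (x\<^sub>0 + \<epsilon>)) (y (x\<^sub>0 - \<epsilon>) - y x\<^sub>0)"
  have ymono: "y b < y a" if "a < b" for a b
    using mono that by (simp add: y_def strict_mono_def)
  hence ymono': "y b \<le> y a" if "a \<le> b" for a b
    using that by (metis less_eq_real_def)
  have \<delta>: "\<delta> > 0" using ymono[of x\<^sub>0 "x\<^sub>0 + \<epsilon>"] ymono[of "x\<^sub>0 - \<epsilon>" x\<^sub>0] \<epsilon> by (simp add: \<delta>_def)
  define c where "c t = max 0 (\<delta> - \<bar>t - y x\<^sub>0\<bar>)" for t
  have contc: "continuous_on UNIV c" unfolding c_def by (intro continuous_intros)
  have [measurable]: "c \<in> borel_measurable borel"
    using contc by (rule borel_measurable_continuous_onI)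
  define w where "w x = Re (cnj z * (of_real (c (y x)) * \<psi> x))" for x
  have iw: "integrable lborel (\<lambda>x. of_real (c (y x)) * \<psi> x)"
    by (rule intc[where B = \<delta>]) (use \<delta> in \<open>auto simp: c_def\<close>)
  have w_eq: "w x = c (y x) * exp (- l * E x) * Re (cnj z * \<phi> x)" for x
    by (simp add: w_def \<psi>_def algebra_simps)
  have pos: "Re (cnj z * \<phi> x) > 0" if "c (y x) > 0" for x
  proof -
    have "\<bar>y x - y x\<^sub>0\<bar> < \<delta>" using that by (auto simp: c_def max_def split: if_splits)
    hence "\<not> x \<ge> x\<^sub>0 + \<epsilon>" "\<not> x \<le> x\<^sub>0 - \<epsilon>"
      using ymono'[of "x\<^sub>0 + \<epsilon>" x] ymono'[of x "x\<^sub>0 - \<epsilon>"] unfolding \<delta>_def by auto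
    hence n: "norm (\<phi> x - z) < norm z / 2" by (intro near) auto
    have "\<bar>Re (cnj z * (\<phi> x - z))\<bar> \<le> norm z * norm (\<phi> x - z)"
      using abs_Re_le_cmod[of "cnj z * (\<phi> x - z)"] by (simp add: norm_mult)
    also have "\<dots> < norm z * norm z" using n z by (intro mult_strict_left_mono) linarith+
    finally have "\<bar>Re (cnj z * (\<phi> x - z))\<bar> < (norm z)\<^sup>2" by (simp add: power2_eq_square)
    moreover have "cnj z * \<phi> x = of_real ((norm z)\<^sup>2) + cnj z * (\<phi> x - z)"
      by (simp add: algebra_simps complex_norm_square[symmetric] del: of_real_power)
    ultimately show ?thesis by simp
  qed
  have w0: "w x \<ge> 0" for x
  proof (cases "c (y x) > 0")
    case True thus ?thesis using pos[OF True] by (simp add: w_eq)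
  next
    case False thus ?thesis by (simp add: w_eq c_def max_def split: if_splits)
  qed
  have "(LBINT x. w x) = Re (cnj z * (LBINT x. of_real (c (y x)) * \<psi> x))"
    unfolding w_def using integral_Re[OF integrable_mult_right[OF iw, of "cnj z"]] by simp
  also have "\<dots> = 0" using contint[OF contc] by simp
  finally have "AE x in lborel. w x = 0"
    using w0 integrable_Re[OF integrable_mult_right[OF iw, of "cnj z"]]
    unfolding w_def by (subst integral_nonneg_eq_0_iff_AE[symmetric]) auto
  hence "{x. w x \<noteq> 0} \<in> null_sets lborel"
    using AE_iff_null_sets[of "{x. w x \<noteq> 0}" lborel] by (auto simp: w_def)
  hence "negligible {x. w x \<noteq> 0}"
    by (simp add: negligible_iff_null_sets null_sets_completionI)
  moreover have "open {x. w x \<noteq> 0}"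
  proof -
    have "continuous_on UNIV (\<lambda>x. c (y x))"
      unfolding y_def by (intro continuous_on_compose2[OF contc] continuous_intros contE) auto
    hence "continuous_on UNIV w" unfolding w_eq[abs_def] using cont contE
      by (intro continuous_intros) auto
    thus ?thesis by (intro open_Collect_neq continuous_intros)
  qed
  moreover have "w x\<^sub>0 > 0"
    using pos[of x\<^sub>0] \<delta> by (simp add: w_eq c_def)
  ultimately show False
    using open_not_negligible[of "{x. w x \<noteq> 0}"] by (metis (mono_tags) empty_Collect_eq less_irrefl)
qed

section \<open>A binomial series\<close>

text \<open>By Pascal's rule a forward difference in the upper argument lowers the lower one by one.\<close>

lemma gbinomial_nth_difference:
  fixes x :: "'a::field_char_0"
  shows "(\<Sum>k\<le>n. (-1) ^ (n + k) * of_nat (n choose k) * ((x + of_nat k) gchoose (n + d))) = x gchoose d"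
proof (induction n arbitrary: x d)
  case 0
  show ?case by simp
next
  case (Suc n)
  define g where "g k = ((x + of_nat k) gchoose (n + Suc d))" for k
  define b where "b k = (-1) ^ (Suc n + k) * of_nat (n choose k) * g k" for k
  have 1: "(\<Sum>k\<le>n. (-1) ^ (n + k) * of_nat (n choose k) * g (Suc k)) = (x + 1) gchoose (Suc d)"
    using Suc[of "x + 1" "Suc d"] by (simp add: g_def add_ac)
  have "(\<Sum>k\<le>n. b k) = - (x gchoose (Suc d))"
    using Suc[of x "Suc d"] by (simp add: g_def b_def sum_negf)
  moreover have "(\<Sum>k\<le>n. b k) = (\<Sum>k\<le>Suc n. b k)" by (simp add: b_def)
  ultimately have 2: "b 0 + (\<Sum>k\<le>n. b (Suc k)) = - (x gchoose (Suc d))"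
    by (simp only: sum.atMost_Suc_shift)
  have "(\<Sum>k\<le>Suc n. (-1) ^ (Suc n + k) * of_nat (Suc n choose k) * ((x + of_nat k) gchoose (Suc n + d)))
      = (\<Sum>k\<le>Suc n. (-1) ^ (Suc n + k) * of_nat (Suc n choose k) * g k)"
    by (simp add: g_def)
  also have "\<dots> = b 0 + (\<Sum>k\<le>n. (-1) ^ (n + k) * of_nat (n choose k) * g (Suc k) + b (Suc k))"
    by (subst sum.atMost_Suc_shift) (simp add: b_def algebra_simps)
  also have "\<dots> = ((x + 1) gchoose (Suc d)) - (x gchoose (Suc d))"
    using 1 2 by (simp add: sum.distrib)
  also have "\<dots> = x gchoose d"
    by (simp add: gbinomial_Suc_Suc)
  finally show ?case .
qed

lemma norm_gbinomial_le:
  fixes z :: complex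
  assumes "norm z \<le> real N" and "k \<le> m"
  shows "norm ((z + of_nat m) gchoose k) \<le> 2 ^ (N + m)"
proof -
  have "norm ((z + of_nat m) gchoose k) = (\<Prod>i = 0..<k. norm (z + of_nat m - of_nat i)) / fact k"
    by (simp add: gbinomial_prod_rev norm_divide prod_norm)
  also have "\<dots> \<le> (\<Prod>i = 0..<k. real (N + m) - real i) / fact k"
  proof (intro divide_right_mono prod_mono conjI)
    fix i assume i: "i \<in> {0..<k}"
    have "norm (z + of_nat m - of_nat i) = norm (z + of_nat (m - i))"
      using i assms(2) by (simp add: of_nat_diff add_diff_eq)
    also have "\<dots> \<le> real N + real (m - i)"
      using assms(1) norm_triangle_ineq[of z "of_nat (m - i)"] by simp
    also have "\<dots> = real (N + m) - real i" using i assms(2) by (simp add: of_nat_diff)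
    finally show "norm (z + of_nat m - of_nat i) \<le> real (N + m) - real i" .
  qed auto
  also have "\<dots> = real (N + m) gchoose k" by (simp add: gbinomial_prod_rev)
  also have "\<dots> = real ((N + m) choose k)" by (simp add: binomial_gbinomial)
  also have "\<dots> \<le> real (2 ^ (N + m))"
    by (intro of_nat_mono binomial_le_pow2)
  finally show ?thesis by simp
qed

text \<open>The product of the two coefficients is \<open>n choose k\<close> times a polynomial of degree \<open>n\<close> in
\<open>k\<close> with leading coefficient \<open>1 / n!\<close>, so the sum is an \<open>n\<close>-th difference that equals 1.\<close>

lemma gbinomial_diagonal_sum:
  fixes \<nu> :: complex
  shows "(\<Sum>k\<le>n. ((\<nu> + 2 * of_nat k) gchoose k) * ((-1) ^ (n - k) * ((\<nu> + of_nat k + of_nat n) gchoose (n - k)))) = 1"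
proof -
  have "((\<nu> + 2 * of_nat k) gchoose k) * ((-1) ^ (n - k) * ((\<nu> + of_nat k + of_nat n) gchoose (n - k)))
      = (-1) ^ (n + k) * of_nat (n choose k) * ((\<nu> + of_nat n + of_nat k) gchoose (n + 0))"
    if k: "k \<le> n" for k
  proof -
    have s: "(-1::complex) ^ (n - k) = (-1) ^ (n + k)"
      using k by (simp add: minus_one_power_iff)
    let ?a = "\<nu> + of_nat k + 1"
    have e1: "pochhammer ?a n = pochhammer ?a k * pochhammer (?a + of_nat k) (n - k)"
      using pochhammer_product[OF k, of ?a] .
    have e2: "(\<nu> + 2 * of_nat k) gchoose k = pochhammer ?a k / fact k"
      by (simp add: gbinomial_pochhammer' add_ac)
    have e3: "(\<nu> + of_nat k + of_nat n) gchoose (n - k) = pochhammer (?a + of_nat k) (n - k) / fact (n - k)"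
      using k by (simp add: gbinomial_pochhammer' of_nat_diff algebra_simps)
    have e4: "(\<nu> + of_nat n + of_nat k) gchoose (n + 0) = pochhammer ?a n / fact n"
      by (simp add: gbinomial_pochhammer' algebra_simps)
    have e5: "complex_of_nat (n choose k) = fact n / (fact k * fact (n - k))"
      using binomial_fact[OF k] .
    show ?thesis unfolding s e2 e3 e4 e5 e1 by simp
  qed
  hence "(\<Sum>k\<le>n. ((\<nu> + 2 * of_nat k) gchoose k) * ((-1) ^ (n - k) * ((\<nu> + of_nat k + of_nat n) gchoose (n - k))))
    = (\<Sum>k\<le>n. (-1) ^ (n + k) * of_nat (n choose k) * ((\<nu> + of_nat n + of_nat k) gchoose (n + 0)))"
    by (intro sum.cong) auto
  also have "\<dots> = 1" by (subst gbinomial_nth_difference) simp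
  finally show ?thesis .
qed

text \<open>Expanding the powers of \<open>1 + y\<close> by the binomial theorem gives a double series in which the
coefficient of \<open>y\<^sup>n\<close> is the diagonal sum 1. Estimating each binomial coefficient by a power of 2
shows absolute convergence for \<open>y < 1/16\<close>.\<close>

lemma gbinomial_double_series:
  fixes \<nu> :: complex and y :: real
  assumes y: "0 < y" "y < 1 / 16"
  shows "(\<lambda>k. ((\<nu> + 2 * of_nat k) gchoose k) * of_real y ^ k * (1 + of_real y) powr (- (\<nu> + 2 * of_nat k + 1)))
           sums (1 / (1 - of_real y))"
proof -
  define a where "a k j = ((\<nu> + 2 * of_nat k) gchoose k) * ((-1) ^ j * ((\<nu> + 2 * of_nat k + of_nat j) gchoose j))
                            * of_real y ^ (k + j)" for k j :: nat
  obtain N :: nat where N: "norm \<nu> \<le> real N" using real_arch_simple by blast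
  have bound: "norm (a k j) \<le> 4 ^ N * ((16 * y) ^ k * (2 * y) ^ j)" for k j
  proof -
    have 1: "norm ((\<nu> + 2 * of_nat k) gchoose k) \<le> 2 ^ (N + 2 * k)"
      using norm_gbinomial_le[OF N, of k "2 * k"] by simp
    have 2: "norm ((\<nu> + 2 * of_nat k + of_nat j) gchoose j) \<le> 2 ^ (N + (2 * k + j))"
      using norm_gbinomial_le[OF N, of j "2 * k + j"] by (simp add: add.assoc)
    have "norm (a k j) \<le> 2 ^ (N + 2 * k) * 2 ^ (N + (2 * k + j)) * y ^ (k + j)"
      unfolding a_def norm_mult norm_power using 1 2 y
      by (intro mult_mono mult_nonneg_nonneg) auto
    also have "\<dots> = 4 ^ N * ((16 * y) ^ k * (2 * y) ^ j)"
    proof -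
      have "(4::real) ^ N = 2 ^ N * 2 ^ N" "(16::real) ^ k = 4 ^ k * 4 ^ k"
        by (simp_all flip: power_mult_distrib)
      moreover have "(2::real) ^ (N + 2 * k) = 2 ^ N * 4 ^ k"
        "(2::real) ^ (N + (2 * k + j)) = 2 ^ N * (4 ^ k * 2 ^ j)"
        by (simp_all add: power_add power_mult)
      ultimately show ?thesis by (simp only: power_mult_distrib power_add mult_ac)
    qed
    finally show ?thesis .
  qed
  have geo: "(\<lambda>n. c ^ n) summable_on (UNIV :: nat set)" if "0 \<le> c" "c < 1" for c :: real
    using that by (intro norm_summable_imp_summable_on) (simp add: norm_power)
  have geo': "summable (\<lambda>n. norm (c ^ n))" if "0 \<le> c" "c < 1" for c :: real
    using that by (simp add: norm_power)
  have g1: "((\<lambda>j. (16 * y) ^ k * (2 * y) ^ j) has_sum ((16 * y) ^ k * (1 / (1 - 2 * y)))) UNIV" for k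
    using y by (intro has_sum_cmult_right norm_summable_imp_has_sum geometric_sums geo') auto
  have g2: "(\<lambda>k. (16 * y) ^ k * (1 / (1 - 2 * y))) summable_on (UNIV :: nat set)"
    using y by (intro summable_on_cmult_left geo) auto
  have "(\<lambda>(k, j). (16 * y) ^ k * (2 * y) ^ j) summable_on (UNIV :: nat set) \<times> (UNIV :: nat set)"
    by (rule summable_on_SigmaI[where g = "\<lambda>k. (16 * y) ^ k * (1 / (1 - 2 * y))"])
       (unfold prod.case, use g1 g2 y in auto)
  hence "(\<lambda>p. 4 ^ N * (case p of (k, j) \<Rightarrow> (16 * y) ^ k * (2 * y) ^ j)) summable_on UNIV"
    by (intro summable_on_cmult_right) simp
  hence abs: "(\<lambda>p. norm (case_prod a p)) summable_on UNIV"
    by (rule summable_on_comparison_test) (use bound in auto)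
  hence summ: "case_prod a summable_on UNIV"
    by (rule abs_summable_summable)
  then obtain A where A: "(case_prod a has_sum A) (UNIV \<times> UNIV)"
    using summable_iff_has_sum_infsum by auto
  have rows: "((\<lambda>j. a k j) has_sum
      (((\<nu> + 2 * of_nat k) gchoose k) * of_real y ^ k * (1 + of_real y) powr (- (\<nu> + 2 * of_nat k + 1)))) UNIV" for k
  proof -
    let ?s = "\<nu> + 2 * of_nat k + 1"
    have "(\<lambda>j. (-1) ^ j * ((?s + of_nat j - 1) gchoose j) * of_real y ^ j) sums (1 + complex_of_real y) powr (- ?s)"
      using y by (intro one_plus_neg_powr_powser) auto
    hence "(\<lambda>j. ((\<nu> + 2 * of_nat k) gchoose k) * of_real y ^ k *
           ((-1) ^ j * ((?s + of_nat j - 1) gchoose j) * of_real y ^ j)) sums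
         (((\<nu> + 2 * of_nat k) gchoose k) * of_real y ^ k * (1 + complex_of_real y) powr (- ?s))"
      by (rule sums_mult)
    hence "(\<lambda>j. a k j) sums (((\<nu> + 2 * of_nat k) gchoose k) * of_real y ^ k * (1 + complex_of_real y) powr (- ?s))"
      by (simp add: a_def power_add mult_ac add_ac)
    moreover have "summable (\<lambda>j. norm (a k j))"
    proof (rule summable_comparison_test')
      show "summable (\<lambda>j. 4 ^ N * (16 * y) ^ k * (2 * y) ^ j)"
        using y by (intro summable_mult summable_geometric) auto
      show "norm (norm (a k j)) \<le> 4 ^ N * (16 * y) ^ k * (2 * y) ^ j" if "j \<ge> 0" for j
        using bound[of k j] by (simp add: mult.assoc)
    qed
    ultimately show ?thesis by (rule norm_summable_imp_has_sum[rotated])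
  qed
  have "((\<lambda>k. ((\<nu> + 2 * of_nat k) gchoose k) * of_real y ^ k * (1 + of_real y) powr (- (\<nu> + 2 * of_nat k + 1)))
           has_sum A) UNIV"
    by (rule has_sum_SigmaD[OF A]) (use rows in simp)
  moreover have "A = 1 / (1 - of_real y)"
  proof -
    have bij: "bij_betw (\<lambda>(n, k). (k, n - k)) (SIGMA n:(UNIV :: nat set). {..n}) (UNIV \<times> UNIV)"
      by (rule bij_betw_byWitness[where f' = "\<lambda>(k, j). (k + j, k)"]) auto
    have "((\<lambda>p. case_prod a ((\<lambda>(n, k). (k, n - k)) p)) has_sum A) (SIGMA n:UNIV. {..n})"
      using has_sum_reindex_bij_betw[OF bij, of "case_prod a"] A by blast
    hence S: "((\<lambda>(n, k). a k (n - k)) has_sum A) (SIGMA n:UNIV. {..n})"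
      by (simp add: case_prod_unfold)
    have R: "((\<lambda>k. a k (n - k)) has_sum (of_real y ^ n)) {..n}" for n
    proof -
      have "a k (n - k) = of_real y ^ n * (((\<nu> + 2 * of_nat k) gchoose k) * ((-1) ^ (n - k) * ((\<nu> + of_nat k + of_nat n) gchoose (n - k))))"
        if "k \<le> n" for k
        using that by (simp add: a_def of_nat_diff add_ac)
      hence "(\<Sum>k\<le>n. a k (n - k)) = of_real y ^ n"
        using gbinomial_diagonal_sum[of \<nu> n] by (simp add: sum_distrib_left[symmetric])
      thus ?thesis using has_sum_finite[of "{..n}" "\<lambda>k. a k (n - k)"] by simp
    qed
    have "((\<lambda>n. complex_of_real y ^ n) has_sum A) UNIV"
      by (rule has_sum_SigmaD[OF S]) (simp only: prod.case R)
    hence "(\<lambda>n. complex_of_real y ^ n) sums A" by (rule has_sum_imp_sums)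
    moreover have "(\<lambda>n. complex_of_real y ^ n) sums (1 / (1 - of_real y))"
      using y by (intro geometric_sums) auto
    ultimately show ?thesis by (rule sums_unique2)
  qed
  ultimately show ?thesis by (auto dest: has_sum_imp_sums)
qed

text \<open>With \<open>y = e\<^bsup>-2w\<^esup>\<close> one has \<open>2 cosh w = e\<^sup>w (1 + y)\<close>, which turns the preceding
series into the generating function of the coefficients \<open>\<nu> + 2k choose k\<close>, the one that
belongs to the Catalan numbers. Both Bessel transforms below lead to it.\<close>

lemma gbinomial_series_cosh:
  fixes \<nu> :: complex and w :: real
  assumes w: "w \<ge> 2"
  shows "(\<lambda>k. ((\<nu> + 2 * of_nat k) gchoose k) * exp (- (\<nu> + 2 * of_nat k) * of_real (ln (2 * cosh w))))
           sums (exp (- \<nu> * of_real w) * of_real (cosh w / sinh w))"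
proof -
  define y where "y = exp (- 2 * w)"
  define L where "L = ln (2 * cosh w)"
  have "(2::real) ^ 4 < exp 1 ^ 4"
    using e_approx_32 by (intro power_strict_mono) (simp_all add: abs_if split: if_splits)
  also have "(exp 1 :: real) ^ 4 = exp 4" by (simp add: exp_of_nat_mult[symmetric])
  also have "\<dots> \<le> exp (2 * w)" using w by simp
  finally have y: "0 < y" "y < 1 / 16" by (auto simp: y_def exp_minus field_simps)
  have c: "2 * cosh w = exp w * (1 + y)"
    by (simp add: cosh_def y_def distrib_left exp_add[symmetric])
  have s: "2 * sinh w = exp w * (1 - y)"
    by (simp add: sinh_def y_def right_diff_distrib exp_add[symmetric])
  have L: "L = w + ln (1 + y)" using y by (simp add: L_def c ln_mult)
  have pos: "1 + y > 0" using y by simp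
  have "complex_of_real (cosh w / sinh w) = of_real ((exp w * (1 + y)) / (exp w * (1 - y)))"
    unfolding c[symmetric] s[symmetric] by simp
  also have "\<dots> = of_real (1 + y) / (1 - of_real y)" by simp
  finally have coth: "complex_of_real (cosh w / sinh w) = of_real (1 + y) / (1 - of_real y)" .
  have eq: "((\<nu> + 2 * of_nat k) gchoose k) * exp (- (\<nu> + 2 * of_nat k) * of_real L) =
     exp (- \<nu> * of_real w) * of_real (1 + y) * (((\<nu> + 2 * of_nat k) gchoose k) * of_real y ^ k * (1 + of_real y) powr (- (\<nu> + 2 * of_nat k + 1)))" for k
  proof -
    have 1: "complex_of_real y ^ k = exp (- 2 * of_nat k * of_real w)"
      unfolding y_def of_real_power[symmetric] exp_of_nat_mult[symmetric] exp_of_real[symmetric]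
      by (simp add: mult_ac)
    have 2: "complex_of_real (1 + y) = exp (of_real (ln (1 + y)))"
      using pos by (simp add: exp_of_real)
    have 3: "(1 + complex_of_real y) powr (- (\<nu> + 2 * of_nat k + 1)) = exp (- (\<nu> + 2 * of_nat k + 1) * of_real (ln (1 + y)))"
    proof -
      have "1 + complex_of_real y = of_real (1 + y)" by simp
      moreover have "complex_of_real (1 + y) \<noteq> 0" using pos by (simp only: of_real_eq_0_iff)
      ultimately show ?thesis using Ln_of_real[OF pos] by (simp only: powr_def if_False)
    qed
    have 4: "exp (- (\<nu> + 2 * of_nat k) * of_real L) =
        exp (- \<nu> * of_real w) * exp (of_real (ln (1 + y))) *
          (exp (- 2 * of_nat k * of_real w) * exp (- (\<nu> + 2 * of_nat k + 1) * of_real (ln (1 + y))))"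
      unfolding exp_add[symmetric] L by (rule arg_cong[where f = exp]) (simp add: algebra_simps)
    show ?thesis unfolding 1 2 3 4 by (simp only: mult_ac)
  qed
  have "exp (- \<nu> * of_real w) * complex_of_real (cosh w / sinh w) =
      exp (- \<nu> * of_real w) * of_real (1 + y) * (1 / (1 - of_real y))"
    unfolding coth by simp
  thus ?thesis unfolding L_def[symmetric] eq
    by (simp only:) (rule sums_mult[OF gbinomial_double_series[OF y]])
qed

section \<open>The modified Bessel function of the first kind\<close>

text \<open>The entire function \<open>C\<^sub>\<mu>\<close> with
\<open>I\<^sub>\<mu>(x) = (x/2)\<^bsup>\<mu>\<^esup> C\<^sub>\<mu>(x\<^sup>2/4)\<close>. Its derivative is \<open>C\<^bsub>\<mu>+1\<^esub>\<close>.\<close>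

definition bessel_clifford :: "complex \<Rightarrow> complex \<Rightarrow> complex" where
  "bessel_clifford \<mu> z = (\<Sum>k. rGamma (\<mu> + of_nat k + 1) / fact k * z ^ k)"

text \<open>In the functional equation of \<open>1/\<Gamma>\<close> each factor \<open>\<mu> + j\<close> has modulus at least
\<open>j\<close>.\<close>

lemma norm_rGamma_shift_le:
  assumes "Re \<mu> \<ge> 0"
  shows "norm (rGamma (\<mu> + of_nat k + 1)) \<le> norm (rGamma (\<mu> + 1)) / fact k"
proof (induction k)
  case (Suc k)
  let ?z = "\<mu> + of_nat k + 1"
  have "norm ?z \<ge> real k + 1"
    using complex_Re_le_cmod[of ?z] assms by simp
  have "norm ?z * norm (rGamma (?z + 1)) = norm (rGamma ?z)"
    by (simp only: rGamma_plus1 flip: norm_mult)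
  hence "(real k + 1) * norm (rGamma (?z + 1)) \<le> norm (rGamma (\<mu> + 1)) / fact k"
    using Suc mult_right_mono[OF \<open>norm ?z \<ge> real k + 1\<close>, of "norm (rGamma (?z + 1))"] by simp
  thus ?case by (simp add: algebra_simps pos_le_divide_eq add_pos_nonneg)
qed auto

lemma norm_bessel_clifford_term_le:
  assumes "Re \<mu> \<ge> 0"
  shows "norm (rGamma (\<mu> + of_nat k + 1) / fact k * z ^ k) \<le> norm (rGamma (\<mu> + 1)) * (norm z ^ k / (fact k)\<^sup>2)"
proof -
  have "norm (rGamma (\<mu> + of_nat k + 1) / fact k * z ^ k) = norm (rGamma (\<mu> + of_nat k + 1)) * (norm z ^ k / fact k)"
    by (simp add: norm_mult norm_divide norm_power)
  also have "\<dots> \<le> norm (rGamma (\<mu> + 1)) / fact k * (norm z ^ k / fact k)"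
    by (intro mult_right_mono norm_rGamma_shift_le assms) auto
  finally show ?thesis by (simp add: power2_eq_square field_simps)
qed

lemma power_div_fact_le_exp:
  fixes x :: real
  assumes "x \<ge> 0"
  shows "x ^ k / fact k \<le> exp x"
proof -
  have "(\<lambda>n. x ^ n / fact n) sums exp x"
    using exp_converges[of x] by (simp add: field_simps)
  thus ?thesis
    using sum_le_suminf[of "\<lambda>n. x ^ n / fact n" "{k}"] assms
    by (simp add: sums_iff)
qed

text \<open>The terms are the squares of the terms of \<open>e\<^bsup>x/2\<^esup>\<close>, each of which is at most
\<open>e\<^bsup>x/2\<^esup>\<close>. The growth \<open>e\<^sup>x\<close> is what makes the Laplace transform of \<open>I\<^sub>\<mu>\<close>
at \<open>u > 1\<close> absolutely convergent.\<close>

lemma bessel_majorant: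
  fixes x :: real
  assumes "x \<ge> 0"
  shows "summable (\<lambda>k. (x\<^sup>2 / 4) ^ k / (fact k)\<^sup>2)"
    and "(\<Sum>k. (x\<^sup>2 / 4) ^ k / (fact k)\<^sup>2) \<le> exp x"
proof -
  define a where "a k = (x / 2) ^ k / fact k" for k
  have a: "a sums exp (x / 2)"
    using exp_converges[of "x / 2"] by (simp add: a_def[abs_def] field_simps)
  have b: "(x\<^sup>2 / 4) ^ k / (fact k)\<^sup>2 \<le> exp (x / 2) * a k" for k
  proof -
    have "(x\<^sup>2 / 4) ^ k / (fact k)\<^sup>2 = a k * a k"
      by (simp add: a_def power2_eq_square power_mult_distrib[symmetric] flip: power_divide)
    also have "\<dots> \<le> exp (x / 2) * a k"
      using power_div_fact_le_exp[of "x / 2" k] assms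
      by (intro mult_right_mono) (auto simp: a_def)
    finally show ?thesis .
  qed
  have s: "(\<lambda>k. exp (x / 2) * a k) sums (exp (x / 2) * exp (x / 2))"
    by (rule sums_mult[OF a])
  show *: "summable (\<lambda>k. (x\<^sup>2 / 4) ^ k / (fact k)\<^sup>2)"
    by (rule summable_comparison_test'[OF sums_summable[OF s]]) (use b in auto)
  have "(\<Sum>k. (x\<^sup>2 / 4) ^ k / (fact k)\<^sup>2) \<le> exp (x / 2) * exp (x / 2)"
    using suminf_le[OF b * sums_summable[OF s]] s by (simp add: sums_iff)
  thus "(\<Sum>k. (x\<^sup>2 / 4) ^ k / (fact k)\<^sup>2) \<le> exp x"
    by (simp flip: exp_add)
qed

lemma summable_bessel_clifford:
  assumes "Re \<mu> \<ge> 0"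
  shows "summable (\<lambda>k. norm (rGamma (\<mu> + of_nat k + 1) / fact k * z ^ k))"
proof (rule summable_comparison_test')
  have "summable (\<lambda>k. (((2 * sqrt (norm z))\<^sup>2 / 4) ^ k / (fact k)\<^sup>2))"
    by (rule bessel_majorant) auto
  thus "summable (\<lambda>k. norm (rGamma (\<mu> + 1)) * (norm z ^ k / (fact k)\<^sup>2))"
    by (intro summable_mult) (simp add: power_mult_distrib)
qed (use norm_bessel_clifford_term_le[OF assms] in auto)

lemma suminf_norm_bessel_clifford_le:
  assumes "Re \<mu> \<ge> 0" and "x \<ge> 0"
  shows "(\<Sum>k. norm (rGamma (\<mu> + of_nat k + 1) / fact k * of_real (x\<^sup>2 / 4) ^ k)) \<le> norm (rGamma (\<mu> + 1)) * exp x"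
proof -
  have n: "norm (complex_of_real (x\<^sup>2 / 4)) = x\<^sup>2 / 4"
    by (subst norm_of_real) simp
  have "(\<Sum>k. norm (rGamma (\<mu> + of_nat k + 1) / fact k * of_real (x\<^sup>2 / 4) ^ k))
       \<le> (\<Sum>k. norm (rGamma (\<mu> + 1)) * ((x\<^sup>2 / 4) ^ k / (fact k)\<^sup>2))"
    by (intro suminf_le summable_bessel_clifford assms summable_mult bessel_majorant(1))
       (use norm_bessel_clifford_term_le[OF assms(1), of _ "of_real (x\<^sup>2 / 4)"] n in simp)
  also have "\<dots> = norm (rGamma (\<mu> + 1)) * (\<Sum>k. (x\<^sup>2 / 4) ^ k / (fact k)\<^sup>2)"
    by (intro suminf_mult bessel_majorant(1) assms)
  also have "\<dots> \<le> norm (rGamma (\<mu> + 1)) * exp x"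
    by (intro mult_left_mono bessel_majorant(2) assms) auto
  finally show ?thesis .
qed

lemma norm_bessel_clifford_le:
  assumes "Re \<mu> \<ge> 0" and "x \<ge> 0"
  shows "norm (bessel_clifford \<mu> (of_real (x\<^sup>2 / 4))) \<le> norm (rGamma (\<mu> + 1)) * exp x"
  unfolding bessel_clifford_def
  using summable_norm[OF summable_bessel_clifford[OF assms(1), of "of_real (x\<^sup>2 / 4)"]]
    suminf_norm_bessel_clifford_le[OF assms] by (rule order_trans)

lemma has_field_derivative_bessel_clifford [derivative_intros]:
  assumes "Re \<mu> \<ge> 0" and "(f has_field_derivative f') (at z within S)"
  shows "((\<lambda>z. bessel_clifford \<mu> (f z)) has_field_derivative (bessel_clifford (\<mu> + 1) (f z) * f')) (at z within S)"
proof -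
  have "diffs (\<lambda>k. rGamma (\<mu> + of_nat k + 1) / fact k) k = rGamma ((\<mu> + 1) + of_nat k + 1) / fact k" for k
    by (simp add: diffs_def add_ac) (simp add: divide_simps flip: of_nat_Suc)
  hence "(bessel_clifford \<mu> has_field_derivative bessel_clifford (\<mu> + 1) w) (at w)" for w
    using termdiffs_strong_converges_everywhere[OF summable_norm_cancel[OF summable_bessel_clifford[OF assms(1)]], of w]
    unfolding bessel_clifford_def[abs_def] by simp
  from DERIV_chain2[OF this assms(2)] show ?thesis .
qed

lemma borel_measurable_bessel_clifford [measurable]:
  assumes [measurable]: "f \<in> borel_measurable M" "g \<in> borel_measurable M"
  shows "(\<lambda>x. bessel_clifford (f x) (g x)) \<in> borel_measurable M"
proof -
  have [measurable]: "rGamma \<in> borel_measurable (borel :: complex measure)"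
    by (intro borel_measurable_continuous_onI continuous_on_rGamma)
  show ?thesis unfolding bessel_clifford_def by measurable
qed

text \<open>Divided by \<open>\<Gamma>(\<mu> + n + 1)\<^bsup>-2\<^esup>\<close>, the terms become products of binomial
coefficients, and the sum is Vandermonde's convolution.\<close>

lemma bessel_clifford_square_coeff:
  "(\<Sum>i\<le>n. rGamma (\<mu> + of_nat i + 1) / fact i * (rGamma (\<mu> + of_nat (n - i) + 1) / fact (n - i)))
     = ((2 * \<mu> + 2 * of_nat n) gchoose n) * (rGamma (\<mu> + of_nat n + 1))\<^sup>2"
  (is "?L = _")
proof -
  have *: "rGamma (\<mu> + of_nat (n - i) + 1) / fact i = ((\<mu> + of_nat n) gchoose i) * rGamma (\<mu> + of_nat n + 1)"
    if "i \<le> n" for i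
    using pochhammer_rGamma[of "\<mu> + of_nat (n - i) + 1" i] that
    by (simp add: gbinomial_pochhammer' of_nat_diff algebra_simps)
  have "?L = (\<Sum>i=0..n. ((\<mu> + of_nat n) gchoose i) * ((\<mu> + of_nat n) gchoose (n - i)) * (rGamma (\<mu> + of_nat n + 1))\<^sup>2)"
    unfolding atLeast0AtMost
  proof (intro sum.cong refl)
    fix i assume "i \<in> {..n}"
    hence i: "i \<le> n" by simp
    have "rGamma (\<mu> + of_nat i + 1) / fact i * (rGamma (\<mu> + of_nat (n - i) + 1) / fact (n - i))
       = (rGamma (\<mu> + of_nat (n - i) + 1) / fact i) * (rGamma (\<mu> + of_nat (n - (n - i)) + 1) / fact (n - i))"
      using i by simp
    also have "\<dots> = ((\<mu> + of_nat n) gchoose i) * ((\<mu> + of_nat n) gchoose (n - i)) * (rGamma (\<mu> + of_nat n + 1))\<^sup>2"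
      unfolding *[OF i] *[OF diff_le_self] by (simp add: power2_eq_square)
    finally show "rGamma (\<mu> + of_nat i + 1) / fact i * (rGamma (\<mu> + of_nat (n - i) + 1) / fact (n - i))
       = ((\<mu> + of_nat n) gchoose i) * ((\<mu> + of_nat n) gchoose (n - i)) * (rGamma (\<mu> + of_nat n + 1))\<^sup>2" .
  qed
  also have "\<dots> = ((2 * \<mu> + 2 * of_nat n) gchoose n) * (rGamma (\<mu> + of_nat n + 1))\<^sup>2"
    unfolding sum_distrib_right[symmetric] gbinomial_Vandermonde by (simp add: algebra_simps)
  finally show ?thesis .
qed

lemma bessel_clifford_square_sums:
  assumes "Re \<mu> \<ge> 0"
  shows "(\<lambda>n. ((2 * \<mu> + 2 * of_nat n) gchoose n) * (rGamma (\<mu> + of_nat n + 1))\<^sup>2 * z ^ n)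
           sums (bessel_clifford \<mu> z)\<^sup>2"
proof -
  let ?c = "\<lambda>k. rGamma (\<mu> + of_nat k + 1) / fact k * z ^ k"
  have "(\<lambda>k. \<Sum>i\<le>k. ?c i * ?c (k - i)) sums ((\<Sum>k. ?c k) * (\<Sum>k. ?c k))"
    by (intro Cauchy_product_sums summable_bessel_clifford assms)
  moreover have "(\<Sum>i\<le>k. ?c i * ?c (k - i)) = ((2 * \<mu> + 2 * of_nat k) gchoose k) * (rGamma (\<mu> + of_nat k + 1))\<^sup>2 * z ^ k" for k
  proof -
    have "?c i * ?c (k - i) = rGamma (\<mu> + of_nat i + 1) / fact i * (rGamma (\<mu> + of_nat (k - i) + 1) / fact (k - i)) * z ^ k"
      if "i \<le> k" for i
    proof -
      have "z ^ k = z ^ i * z ^ (k - i)" using that by (simp flip: power_add)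
      thus ?thesis by (simp add: mult_ac)
    qed
    thus ?thesis
      unfolding bessel_clifford_square_coeff[symmetric] sum_distrib_right by (intro sum.cong) auto
  qed
  ultimately show ?thesis by (simp add: bessel_clifford_def power2_eq_square)
qed

text \<open>The Cauchy product of the majorant series with itself bounds the coefficients of the square one by
one.\<close>

lemma norm_bessel_clifford_square_partial_le:
  assumes "Re \<mu> \<ge> 0" and "x \<ge> 0"
  shows "norm (\<Sum>n<N. ((2 * \<mu> + 2 * of_nat n) gchoose n) * (rGamma (\<mu> + of_nat n + 1))\<^sup>2 * of_real (x\<^sup>2 / 4) ^ n)
           \<le> (norm (rGamma (\<mu> + 1)) * exp x)\<^sup>2"
proof -
  define z where "z = complex_of_real (x\<^sup>2 / 4)"
  define a where "a k = norm (rGamma (\<mu> + of_nat k + 1) / fact k * z ^ k)" for k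
  have a: "summable a" "\<And>k. a k \<ge> 0"
    using summable_bessel_clifford[OF assms(1), of z] unfolding a_def[abs_def] by simp_all
  have s: "(\<lambda>k. \<Sum>i\<le>k. a i * a (k - i)) sums ((\<Sum>k. a k) * (\<Sum>k. a k))"
    by (intro Cauchy_product_sums) (use a in simp_all)
  have t: "norm (((2 * \<mu> + 2 * of_nat n) gchoose n) * (rGamma (\<mu> + of_nat n + 1))\<^sup>2 * z ^ n) \<le> (\<Sum>i\<le>n. a i * a (n - i))" for n
    unfolding bessel_clifford_square_coeff[symmetric] sum_distrib_right
  proof (rule order_trans[OF norm_sum], rule sum_mono)
    fix i assume i: "i \<in> {..n}"
    hence "z ^ n = z ^ i * z ^ (n - i)" by (simp flip: power_add)
    thus "norm (rGamma (\<mu> + of_nat i + 1) / fact i * (rGamma (\<mu> + of_nat (n - i) + 1) / fact (n - i)) * z ^ n) \<le> a i * a (n - i)"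
      by (simp add: a_def norm_mult norm_divide mult_ac)
  qed
  have "norm (\<Sum>n<N. ((2 * \<mu> + 2 * of_nat n) gchoose n) * (rGamma (\<mu> + of_nat n + 1))\<^sup>2 * z ^ n)
      \<le> (\<Sum>n<N. \<Sum>i\<le>n. a i * a (n - i))"
    by (rule order_trans[OF norm_sum]) (rule sum_mono[OF t])
  also have "\<dots> \<le> (\<Sum>n. \<Sum>i\<le>n. a i * a (n - i))"
    by (rule sum_le_suminf) (use s a in \<open>auto simp: sums_iff intro!: sum_nonneg\<close>)
  also have "\<dots> = (\<Sum>k. a k)\<^sup>2" using s by (simp add: sums_iff power2_eq_square)
  also have "\<dots> \<le> (norm (rGamma (\<mu> + 1)) * exp x)\<^sup>2"
    using suminf_norm_bessel_clifford_le[OF assms] a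
    by (intro power_mono suminf_nonneg a) (simp_all only: a_def z_def)
  finally show ?thesis by (simp add: z_def)
qed

lemma bessel_I_of_real:
  assumes "x > 0"
  shows "bessel_I \<mu> (of_real x) = exp (\<mu> * of_real (ln (x / 2))) * bessel_clifford \<mu> (of_real (x\<^sup>2 / 4))"
proof -
  have "(complex_of_real x / 2) powr \<mu> = exp (\<mu> * of_real (ln (x / 2)))"
    using assms Ln_of_real[of "x / 2"] by (simp add: powr_def)
  thus ?thesis
    by (simp add: bessel_I_def bessel_clifford_def mult_ac)
qed

definition bessel_I_square_deriv :: "complex \<Rightarrow> real \<Rightarrow> complex" where
  "bessel_I_square_deriv \<mu> x = exp (2 * \<mu> * of_real (ln (x / 2))) * bessel_clifford \<mu> (of_real (x\<^sup>2 / 4)) *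
        (2 * \<mu> / of_real x * bessel_clifford \<mu> (of_real (x\<^sup>2 / 4))
          + of_real x * bessel_clifford (\<mu> + 1) (of_real (x\<^sup>2 / 4)))"

lemma has_vector_derivative_bessel_I_square:
  assumes "Re \<mu> \<ge> 0" and x: "x > 0"
  shows "((\<lambda>y. (bessel_I \<mu> (of_real y))\<^sup>2) has_vector_derivative bessel_I_square_deriv \<mu> x) (at x)"
proof -
  let ?F = "\<lambda>z. exp (2 * \<mu> * Ln (z / 2)) * (bessel_clifford \<mu> (z\<^sup>2 / 4))\<^sup>2"
  have Ln: "Ln (of_real y / 2) = of_real (ln (y / 2))" if "y > 0" for y
    using that Ln_of_real[of "y / 2"] by simp
  have nonpos: "complex_of_real x / 2 \<notin> \<real>\<^sub>\<le>\<^sub>0"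
    using x by (simp add: complex_nonpos_Reals_iff)
  have "(?F has_field_derivative
      (exp (2 * \<mu> * Ln (of_real x / 2)) * bessel_clifford \<mu> ((of_real x)\<^sup>2 / 4) *
        (2 * \<mu> / of_real x * bessel_clifford \<mu> ((of_real x)\<^sup>2 / 4)
          + of_real x * bessel_clifford (\<mu> + 1) ((of_real x)\<^sup>2 / 4)))) (at (of_real x))"
    using x assms(1)
    by (auto intro!: derivative_eq_intros simp: nonpos) (simp add: field_simps power2_eq_square)
  hence "(?F has_field_derivative bessel_I_square_deriv \<mu> x) (at (of_real x))"
    using x by (simp add: Ln bessel_I_square_deriv_def)
  hence "((\<lambda>y. ?F (of_real y)) has_vector_derivative bessel_I_square_deriv \<mu> x) (at x)"
    by (rule has_vector_derivative_real_field)
  thus ?thesis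
    by (rule has_vector_derivative_transform_within_open[where S = "{0<..}"])
       (use x in \<open>auto simp: bessel_I_of_real Ln power_mult_distrib exp_double[symmetric] mult_ac\<close>)
qed

text \<open>For \<open>y \<noteq> 0\<close> the reflection formula, applied to a number and its conjugate, evaluates the left
side as \<open>sinh(\<pi>y) / (\<pi>y)\<close>.\<close>

lemma norm_rGamma_one_plus_imaginary:
  "(norm (rGamma (\<i> * of_real y + 1)))\<^sup>2 \<le> exp (pi * \<bar>y\<bar>)"
proof (cases "y = 0")
  case True thus ?thesis by simp
next
  case False
  define z where "z = \<i> * complex_of_real y"
  have z: "z \<noteq> 0" using False by (simp add: z_def)
  have "z * (- z) * (rGamma (z + 1) * rGamma (- z + 1)) = - z * sin (of_real pi * z) / of_real pi"
    using rGamma_reflection_complex'[of z] rGamma_plus1[of z] rGamma_plus1[of "- z"]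
    by (metis (no_types, lifting) mult.assoc mult.left_commute)
  hence eq: "of_real pi * z * (rGamma (z + 1) * rGamma (- z + 1)) = sin (of_real pi * z)"
    using z by (simp add: field_simps)
  have "- z + 1 = cnj (z + 1)" by (simp add: z_def)
  hence n: "norm (rGamma (- z + 1)) = norm (rGamma (z + 1))"
    by (metis cnj_rGamma complex_mod_cnj)
  have "norm (of_real pi * z * (rGamma (z + 1) * rGamma (- z + 1))) = pi * \<bar>y\<bar> * (norm (rGamma (z + 1)))\<^sup>2"
    unfolding norm_mult n by (simp add: z_def norm_mult power2_eq_square)
  moreover have "norm (sin (of_real pi * z)) \<le> pi * \<bar>y\<bar> * exp (pi * \<bar>y\<bar>)"
  proof -
    define a where "a = pi * \<bar>y\<bar>"
    have "sin (of_real pi * z) = (exp (of_real (- (pi * y))) - exp (of_real (pi * y))) / (2 * \<i>)"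
      by (simp add: sin_exp_eq z_def algebra_simps)
    have "norm (sin (of_real pi * z)) = \<bar>exp (- (pi * y)) - exp (pi * y)\<bar> / 2"
    proof -
      have "norm (complex_of_real (exp (- (pi * y))) - of_real (exp (pi * y))) = \<bar>exp (- (pi * y)) - exp (pi * y)\<bar>"
        by (metis norm_of_real of_real_diff)
      thus ?thesis unfolding \<open>sin _ = _\<close> norm_divide exp_of_real by simp
    qed
    also have "\<dots> = (exp a - exp (- a)) / 2"
      by (cases "y \<ge> 0") (auto simp: a_def abs_if zero_less_mult_iff)
    also have "\<dots> = exp a * (1 - exp (- 2 * a)) / 2"
      by (simp add: right_diff_distrib flip: exp_add)
    also have "\<dots> \<le> exp a * (2 * a) / 2"
      using exp_ge_add_one_self[of "- 2 * a"] by (intro divide_right_mono mult_left_mono) (linarith | simp)+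
    finally show ?thesis by (simp add: a_def mult_ac)
  qed
  ultimately have "pi * \<bar>y\<bar> * (norm (rGamma (z + 1)))\<^sup>2 \<le> pi * \<bar>y\<bar> * exp (pi * \<bar>y\<bar>)"
    by (simp only: eq)
  thus ?thesis using False by (simp add: z_def)
qed

section \<open>Integral transforms of the modified Bessel function and its square\<close>

lemma Gamma_integral_exp_real:
  fixes a c :: real
  assumes "a > 0" and "c > 0"
  shows "has_bochner_integral lborel (\<lambda>x. exp (a * x - c * exp x)) (Gamma a * exp (- a * ln c))"
proof -
  have "has_bochner_integral lborel (\<lambda>x. complex_of_real (exp (a * x - c * exp x))) (complex_of_real (Gamma a * exp (- a * ln c)))"
    using Gamma_integral_exp[of "of_real a" c] assms
    by (simp add: Gamma_complex_of_real flip: exp_of_real)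
  thus ?thesis
    by (simp only: has_bochner_integral_iff complex_of_real_integrable_eq integral_complex_of_real of_real_eq_iff)
qed

text \<open>The integrals over \<open>\<xi>\<close> and \<open>r\<close> are both Gamma integrals. For \<open>l = u\<^sup>2\<close> and
\<open>c = 1\<close> the kernel integrates over \<open>r\<close> to \<open>2 K\<^sub>0(2u e\<^bsup>\<xi>\<^esup>)\<close>, so this is the
Mellin transform of \<open>K\<^sub>0\<close>.\<close>

lemma K0_moment:
  fixes a :: complex and l c :: real
  assumes a: "Re a > 0" and l: "l > 0" and c: "c > 0"
  shows "has_bochner_integral (lborel :: (real \<times> real) measure)
           (\<lambda>(r, \<xi>). exp (2 * a * of_real \<xi> - of_real (l * exp r + c * exp (2 * \<xi> - r))))
           ((Gamma a)\<^sup>2 * exp (- a * of_real (ln l + ln c)) / 2)"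
proof -
  define f where "f = (\<lambda>(r, \<xi>). exp (2 * a * of_real \<xi> - of_real (l * exp r + c * exp (2 * \<xi> - r))))"
  have lnc: "ln (c * exp (- r)) = ln c - r" for r
    using c by (subst ln_mult) auto
  have inner: "has_bochner_integral lborel (\<lambda>\<xi>. f (r, \<xi>))
      (Gamma a * exp (- a * of_real (ln c)) / 2 * exp (a * of_real r - of_real (l * exp r)))" for r
  proof -
    have "has_bochner_integral lborel (\<lambda>\<xi>. exp (a * of_real (0 + 2 * \<xi>) - of_real ((c * exp (- r)) * exp (0 + 2 * \<xi>))))
        ((Gamma a * exp (- a * of_real (ln (c * exp (- r))))) /\<^sub>R 2)"
      using has_bochner_integral_affine[OF Gamma_integral_exp[OF a, of "c * exp (- r)"], of 2 0] c by simp
    hence "has_bochner_integral lborel (\<lambda>\<xi>. exp (- of_real (l * exp r)) * exp (a * of_real (0 + 2 * \<xi>) - of_real ((c * exp (- r)) * exp (0 + 2 * \<xi>))))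
        (exp (- of_real (l * exp r)) * ((Gamma a * exp (- a * of_real (ln (c * exp (- r))))) /\<^sub>R 2))"
      by (rule has_bochner_integral_mult_right)
    also have "(\<lambda>\<xi>. exp (- of_real (l * exp r)) * exp (a * of_real (0 + 2 * \<xi>) - of_real ((c * exp (- r)) * exp (0 + 2 * \<xi>)))) = (\<lambda>\<xi>. f (r, \<xi>))"
      unfolding f_def prod.case exp_add[symmetric]
      by (intro ext arg_cong[where f = exp]) (simp add: exp_diff exp_minus field_simps)
    also have "exp (- of_real (l * exp r)) * ((Gamma a * exp (- a * of_real (ln (c * exp (- r))))) /\<^sub>R 2)
        = Gamma a * exp (- a * of_real (ln c)) / 2 * exp (a * of_real r - of_real (l * exp r))"
      unfolding lnc using c by (simp add: scaleR_conv_of_real exp_add exp_diff exp_minus field_simps)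
    finally show ?thesis .
  qed
  define h where "h r \<xi> = exp (2 * Re a * \<xi> - (l * exp r + c * exp (2 * \<xi> - r)))" for r \<xi>
  have innerR: "has_bochner_integral lborel (h r)
      (Gamma (Re a) * exp (- Re a * ln c) / 2 * exp (Re a * r - l * exp r))" for r
  proof -
    have "has_bochner_integral lborel (\<lambda>\<xi>. exp (Re a * (0 + 2 * \<xi>) - (c * exp (- r)) * exp (0 + 2 * \<xi>)))
        ((Gamma (Re a) * exp (- Re a * ln (c * exp (- r)))) /\<^sub>R 2)"
      using has_bochner_integral_affine[OF Gamma_integral_exp_real[OF a, of "c * exp (- r)"], of 2 0] c by simp
    hence "has_bochner_integral lborel (\<lambda>\<xi>. exp (- (l * exp r)) * exp (Re a * (0 + 2 * \<xi>) - (c * exp (- r)) * exp (0 + 2 * \<xi>)))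
        (exp (- (l * exp r)) * ((Gamma (Re a) * exp (- Re a * ln (c * exp (- r)))) /\<^sub>R 2))"
      by (rule has_bochner_integral_mult_right)
    also have "(\<lambda>\<xi>. exp (- (l * exp r)) * exp (Re a * (0 + 2 * \<xi>) - (c * exp (- r)) * exp (0 + 2 * \<xi>))) = h r"
      unfolding h_def exp_add[symmetric]
      by (intro ext arg_cong[where f = exp]) (simp add: exp_diff exp_minus field_simps)
    also have "exp (- (l * exp r)) * ((Gamma (Re a) * exp (- Re a * ln (c * exp (- r)))) /\<^sub>R 2)
        = Gamma (Re a) * exp (- Re a * ln c) / 2 * exp (Re a * r - l * exp r)"
      unfolding lnc using c by (simp add: exp_add exp_diff exp_minus field_simps)
    finally show ?thesis .
  qed
  have fh: "norm (f (r, \<xi>)) = h r \<xi>" for r \<xi> by (simp add: f_def h_def)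
  have [measurable]: "f \<in> borel_measurable (lborel \<Otimes>\<^sub>M lborel)"
    unfolding f_def by measurable
  have int: "integrable (lborel \<Otimes>\<^sub>M lborel) f"
  proof (rule Fubini_dominated[where h = h])
    show "integrable lborel (\<lambda>r. Gamma (Re a) * exp (- Re a * ln c) / 2 * exp (Re a * r - l * exp r))"
      using Gamma_integral_exp_real[OF a l] by (auto simp: has_bochner_integral_iff)
  qed (use innerR fh in \<open>auto simp: sigma_finite_lborel has_bochner_integral_iff\<close>)
  have "(LBINT r. (LBINT \<xi>. f (r, \<xi>))) = integral\<^sup>L (lborel \<Otimes>\<^sub>M lborel) f"
    by (rule lborel_pair.integral_fst'[OF int])
  also have "(LBINT r. (LBINT \<xi>. f (r, \<xi>))) = Gamma a * exp (- a * of_real (ln c)) / 2 * (Gamma a * exp (- a * of_real (ln l)))"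
    by (simp only: has_bochner_integral_integral_eq[OF inner] integral_mult_right_zero
          has_bochner_integral_integral_eq[OF Gamma_integral_exp[OF a l]])
  also have "\<dots> = (Gamma a)\<^sup>2 * exp (- a * of_real (ln l + ln c)) / 2"
    by (simp add: power2_eq_square distrib_left exp_diff exp_minus field_simps exp_add)
  finally show ?thesis
    using int unfolding has_bochner_integral_iff f_def lborel_prod by simp
qed

text \<open>The square of \<open>e\<^bsup>r/2\<^esup>\<close> and that of \<open>e\<^bsup>\<xi>-r/2\<^esup>\<close> absorb the growth
\<open>exp(2e\<^bsup>\<xi>\<^esup>)\<close> of \<open>I\<^sup>2\<close>, at the price of the constants \<open>l - 2\<close> and
\<open>1/2\<close> in place of \<open>l\<close> and 1.\<close>

lemma K0_majorant:
  assumes "l > 2"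
  shows "integrable (lborel :: (real \<times> real) measure)
           (\<lambda>(r, \<xi>). exp (2 * \<xi> - (l * exp r + exp (2 * \<xi> - r))) * (exp (exp \<xi>))\<^sup>2)"
proof (rule Bochner_Integration.integrable_bound)
  show "integrable (lborel :: (real \<times> real) measure)
     (\<lambda>(r, \<xi>). exp (2 * 1 * complex_of_real \<xi> - of_real ((l - 2) * exp r + (1 / 2) * exp (2 * \<xi> - r))))"
    using K0_moment[of 1 "l - 2" "1 / 2"] assms by (simp add: has_bochner_integral_iff)
  show "(\<lambda>(r, \<xi>). exp (2 * \<xi> - (l * exp r + exp (2 * \<xi> - r))) * (exp (exp \<xi>))\<^sup>2) \<in> borel_measurable (lborel :: (real \<times> real) measure)"
    unfolding lborel_prod[symmetric] by measurable
  show "AE p in lborel. norm (case p of (r, \<xi>) \<Rightarrow> exp (2 * \<xi> - (l * exp r + exp (2 * \<xi> - r))) * (exp (exp \<xi>))\<^sup>2)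
     \<le> norm (case p of (r, \<xi>) \<Rightarrow> exp (2 * 1 * complex_of_real \<xi> - of_real ((l - 2) * exp r + (1 / 2) * exp (2 * \<xi> - r))))"
  proof (rule AE_I2, clarify)
    fix r \<xi> :: real
    define A B where "A = exp (r / 2)" and "B = exp (\<xi> - r / 2)"
    have "A * A = exp r" "B * B = exp (2 * \<xi> - r)" "A * B = exp \<xi>"
      by (simp_all add: A_def B_def flip: exp_add)
    moreover have "0 \<le> (2 * A - B) * (2 * A - B)" by simp
    ultimately have "2 * exp \<xi> \<le> 2 * exp r + (1 / 2) * exp (2 * \<xi> - r)"
      by (simp add: algebra_simps)
    thus "norm (exp (2 * \<xi> - (l * exp r + exp (2 * \<xi> - r))) * (exp (exp \<xi>))\<^sup>2)
       \<le> norm (exp (2 * 1 * complex_of_real \<xi> - of_real ((l - 2) * exp r + (1 / 2) * exp (2 * \<xi> - r))))"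
      by (simp add: power2_eq_square abs_mult algebra_simps flip: exp_add)
  qed
qed

lemma bessel_I_exp:
  "bessel_I \<mu> (of_real (exp \<xi>)) = exp (\<mu> * of_real (\<xi> - ln 2)) * bessel_clifford \<mu> (of_real ((exp \<xi>)\<^sup>2 / 4))"
  by (simp add: bessel_I_of_real ln_div)

lemma norm_bessel_I_exp_le:
  assumes "Re \<mu> = 0"
  shows "norm (bessel_I \<mu> (of_real (exp \<xi>))) \<le> norm (rGamma (\<mu> + 1)) * exp (exp \<xi>)"
  using norm_bessel_clifford_le[of \<mu> "exp \<xi>"] assms
  by (simp add: bessel_I_exp norm_mult del: of_real_divide of_real_power)

lemma borel_measurable_bessel_I_exp [measurable]:
  assumes [measurable]: "f \<in> borel_measurable M" "g \<in> borel_measurable M"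
  shows "(\<lambda>x. bessel_I (f x) (of_real (exp (g x)))) \<in> borel_measurable M"
  unfolding bessel_I_exp by measurable

lemma two_less_cosh:
  assumes "w \<ge> (2::real)"
  shows "2 < cosh w"
proof -
  have "(2::real) ^ 2 < exp 1 ^ 2"
    using e_approx_32 by (intro power_strict_mono) (simp_all add: abs_if split: if_splits)
  also have "(exp 1 :: real) ^ 2 = exp 2" by (simp add: exp_of_nat_mult[symmetric])
  also have "\<dots> \<le> exp w" using assms by simp
  finally show ?thesis using exp_gt_zero[of "- w"] by (simp add: cosh_def del: exp_gt_zero)
qed

lemma two_less_cosh_square:
  assumes "w \<ge> (2::real)"
  shows "2 < (cosh w)\<^sup>2"
proof -
  have "2 * 1 < cosh w * cosh w" using two_less_cosh[OF assms] by (intro mult_strict_mono) auto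
  thus ?thesis by (simp add: power2_eq_square)
qed

lemma quarter_square_power:
  "complex_of_real ((exp \<xi>)\<^sup>2 / 4) ^ k = exp (2 * of_nat k * of_real (\<xi> - ln 2))"
proof -
  have "(exp \<xi>)\<^sup>2 / 4 = exp (2 * (\<xi> - ln 2))"
    by (simp add: exp_diff exp_double power_divide right_diff_distrib)
  hence "((exp \<xi>)\<^sup>2 / 4) ^ k = exp (real k * (2 * (\<xi> - ln 2)))"
    by (simp only: exp_of_nat_mult)
  thus ?thesis unfolding of_real_power[symmetric] by (simp add: exp_of_real[symmetric] mult_ac)
qed

lemma Gamma_times_rGamma:
  assumes "Re z > 0"
  shows "Gamma z * rGamma z = (1 :: complex)"
proof -
  have "z \<notin> \<int>\<^sub>\<le>\<^sub>0" using assms by (auto elim!: nonpos_Ints_cases)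
  thus ?thesis by (simp add: rGamma_inverse_Gamma Gamma_eq_zero_iff)
qed

text \<open>Termwise integration produces \<open>\<Gamma>(\<mu> + 2k + 1)\<close>, and with the reciprocal Gamma factors of
the Bessel series this is the binomial coefficient of \<open>gbinomial_series_cosh\<close>.\<close>

lemma laplace_bessel_I:
  assumes \<mu>: "Re \<mu> = 0" and w: "w \<ge> 2"
  shows "has_bochner_integral lborel
           (\<lambda>\<xi>. of_real (exp (\<xi> - cosh w * exp \<xi>)) * bessel_I \<mu> (of_real (exp \<xi>)))
           (exp (- \<mu> * of_real w) / of_real (sinh w))"
proof -
  define u where "u = cosh w"
  have u: "u > 1" using w cosh_real_nonneg_less_iff[of 0 w] by (simp add: u_def)
  define t where "t k \<xi> = of_real (exp (\<xi> - u * exp \<xi>)) * (exp (\<mu> * of_real (\<xi> - ln 2)) *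
      (rGamma (\<mu> + of_nat k + 1) / fact k * of_real ((exp \<xi>)\<^sup>2 / 4) ^ k))" for k \<xi>
  have t_int: "has_bochner_integral lborel (t k) (((\<mu> + 2 * of_nat k) gchoose k) * exp (- (\<mu> + 2 * of_nat k) * of_real (ln (2 * u))) / of_real u)" for k
  proof -
    let ?a = "\<mu> + 2 * of_nat k + 1"
    let ?C = "rGamma (\<mu> + of_nat k + 1) / fact k * exp (- (\<mu> + 2 * of_nat k) * of_real (ln 2))"
    have a: "Re ?a > 0" using \<mu> by simp
    have "t k = (\<lambda>\<xi>. ?C * exp (?a * of_real \<xi> - of_real (u * exp \<xi>)))"
    proof
      fix \<xi>
      have 2: "exp (- (\<mu> + 2 * of_nat k) * of_real (ln 2)) * exp (?a * of_real \<xi> - of_real (u * exp \<xi>))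
         = of_real (exp (\<xi> - u * exp \<xi>)) * exp (\<mu> * of_real (\<xi> - ln 2)) * exp (2 * of_nat k * of_real (\<xi> - ln 2))"
        unfolding exp_of_real[symmetric] exp_add[symmetric]
        by (rule arg_cong[where f = exp]) (simp add: algebra_simps)
      show "t k \<xi> = ?C * exp (?a * of_real \<xi> - of_real (u * exp \<xi>))" unfolding t_def quarter_square_power
        using arg_cong[OF 2, of "\<lambda>z. rGamma (\<mu> + of_nat k + 1) / fact k * z"] by (simp only: mult_ac)
    qed
    moreover have "has_bochner_integral lborel (\<lambda>\<xi>. ?C * exp (?a * of_real \<xi> - of_real (u * exp \<xi>)))
        (?C * (Gamma ?a * exp (- ?a * of_real (ln u))))"
      using u by (intro has_bochner_integral_mult_right Gamma_integral_exp a) auto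
    moreover have "?C * (Gamma ?a * exp (- ?a * of_real (ln u))) = ((\<mu> + 2 * of_nat k) gchoose k) * exp (- (\<mu> + 2 * of_nat k) * of_real (ln (2 * u))) / of_real u"
    proof -
      have "rGamma (\<mu> + of_nat k + 1) = pochhammer (\<mu> + of_nat k + 1) k * rGamma ?a"
        using pochhammer_rGamma[of "\<mu> + of_nat k + 1" k] by (simp add: algebra_simps)
      also have "pochhammer (\<mu> + of_nat k + 1) k = fact k * ((\<mu> + 2 * of_nat k) gchoose k)"
        by (simp add: gbinomial_pochhammer' add_ac)
      finally have g: "rGamma (\<mu> + of_nat k + 1) / fact k * Gamma ?a = (\<mu> + 2 * of_nat k) gchoose k"
        using Gamma_times_rGamma[OF a] by (simp add: mult_ac)
      have "exp (- (\<mu> + 2 * of_nat k) * of_real (ln 2)) * exp (- ?a * of_real (ln u))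
          = exp (- (\<mu> + 2 * of_nat k) * of_real (ln (2 * u))) * exp (of_real (- ln u))"
        unfolding exp_add[symmetric] using u
        by (intro arg_cong[where f = exp]) (simp add: ln_mult algebra_simps)
      also have "exp (complex_of_real (- ln u)) = 1 / of_real u"
        using u unfolding exp_of_real by (simp add: exp_minus field_simps)
      finally have e: "exp (- (\<mu> + 2 * of_nat k) * of_real (ln 2)) * exp (- ?a * of_real (ln u))
          = exp (- (\<mu> + 2 * of_nat k) * of_real (ln (2 * u))) * (1 / of_real u)" .
      have "?C * (Gamma ?a * exp (- ?a * of_real (ln u))) = (rGamma (\<mu> + of_nat k + 1) / fact k * Gamma ?a) *
         (exp (- (\<mu> + 2 * of_nat k) * of_real (ln 2)) * exp (- ?a * of_real (ln u)))"
        by (simp only: mult_ac)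
      thus ?thesis unfolding g e by simp
    qed
    ultimately show ?thesis by (simp only: )
  qed
  define f where "f \<xi> = of_real (exp (\<xi> - u * exp \<xi>)) * bessel_I \<mu> (of_real (exp \<xi>))" for \<xi>
  have dom: "integrable lborel (\<lambda>\<xi>. norm (rGamma (\<mu> + 1)) * exp (\<xi> - (u - 1) * exp \<xi>))"
    using Gamma_integral_exp_real[of 1 "u - 1"] u by (simp add: has_bochner_integral_iff)
  have ts: "(\<lambda>k. t k \<xi>) sums f \<xi>" for \<xi>
    unfolding t_def f_def bessel_I_exp bessel_clifford_def
    by (intro sums_mult summable_sums summable_norm_cancel[OF summable_bessel_clifford]) (simp add: \<mu>)
  have bnd: "norm (\<Sum>k<N. t k \<xi>) \<le> norm (rGamma (\<mu> + 1)) * exp (\<xi> - (u - 1) * exp \<xi>)" for N \<xi>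
  proof -
    let ?c = "\<lambda>k. norm (rGamma (\<mu> + of_nat k + 1) / fact k * of_real ((exp \<xi>)\<^sup>2 / 4) ^ k)"
    have "norm (\<Sum>k<N. t k \<xi>) \<le> (\<Sum>k<N. norm (t k \<xi>))" by (rule norm_sum)
    also have "\<dots> = exp (\<xi> - u * exp \<xi>) * (\<Sum>k<N. ?c k)"
      unfolding t_def norm_mult sum_distrib_left using \<mu> by simp
    also have "(\<Sum>k<N. ?c k) \<le> (\<Sum>k. ?c k)"
      by (intro sum_le_suminf summable_bessel_clifford) (auto simp: \<mu>)
    also have "\<dots> \<le> norm (rGamma (\<mu> + 1)) * exp (exp \<xi>)"
      by (rule suminf_norm_bessel_clifford_le) (auto simp: \<mu>)
    finally have "norm (\<Sum>k<N. t k \<xi>) \<le> exp (\<xi> - u * exp \<xi>) * (norm (rGamma (\<mu> + 1)) * exp (exp \<xi>))" by simp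
    moreover have e: "exp (\<xi> - (u - 1) * exp \<xi>) = exp (\<xi> - u * exp \<xi>) * exp (exp \<xi>)"
      by (simp add: algebra_simps flip: exp_add)
    ultimately show ?thesis by (simp only: e mult_ac)
  qed
  have "has_bochner_integral lborel f (exp (- \<mu> * of_real w) * of_real (cosh w / sinh w) / of_real u)"
    by (rule has_bochner_integral_sums_dominated[OF t_int ts bnd dom])
       (unfold u_def, rule sums_divide[OF gbinomial_series_cosh[OF w]])
  also have "exp (- \<mu> * of_real w) * of_real (cosh w / sinh w) / of_real u = exp (- \<mu> * of_real w) / of_real (sinh w)"
    using u by (simp add: u_def)
  finally show ?thesis unfolding f_def u_def .
qed

text \<open>The two Gamma factors of \<open>K0_moment\<close> cancel the reciprocal ones in the series of \<open>I\<^sup>2\<close>, and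
the binomial series with parameter \<open>2\<mu>\<close> is left over. As \<open>\<mu>\<close> survives only in the
exponential, superpositions of \<open>I\<^bsub>i\<tau>/2\<^esub>\<^sup>2\<close> are sent to Fourier integrals in
\<open>\<tau>\<close>.\<close>

lemma K0_transform_bessel_I_square:
  assumes \<mu>: "Re \<mu> = 0" and w: "w \<ge> 2"
  shows "has_bochner_integral (lborel :: (real \<times> real) measure)
           (\<lambda>(r, \<xi>). of_real (exp (2 * \<xi> - ((cosh w)\<^sup>2 * exp r + exp (2 * \<xi> - r)))) * (bessel_I \<mu> (of_real (exp \<xi>)))\<^sup>2)
           (exp (- (2 * \<mu>) * of_real w) / of_real (2 * sinh w * cosh w))"
proof -
  define u where "u = cosh w"
  have u: "u > 2" and u2: "u\<^sup>2 > 2"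
    using two_less_cosh[OF w] two_less_cosh_square[OF w] by (simp_all add: u_def)
  define t where "t n = (\<lambda>(r, \<xi>). of_real (exp (2 * \<xi> - (u\<^sup>2 * exp r + exp (2 * \<xi> - r)))) * (exp (2 * \<mu> * of_real (\<xi> - ln 2)) *
      (((2 * \<mu> + 2 * of_nat n) gchoose n) * (rGamma (\<mu> + of_nat n + 1))\<^sup>2 * of_real ((exp \<xi>)\<^sup>2 / 4) ^ n)))" for n
  define s where "s n = ((2 * \<mu> + 2 * of_nat n) gchoose n) * exp (- (2 * \<mu> + 2 * of_nat n) * of_real (ln (2 * u)))" for n :: nat
  have t_int: "has_bochner_integral lborel (t n) (s n / of_real (2 * u\<^sup>2))" for n
  proof -
    let ?a = "\<mu> + of_nat n + 1"
    let ?C = "((2 * \<mu> + 2 * of_nat n) gchoose n) * (rGamma ?a)\<^sup>2 * exp (- (2 * \<mu> + 2 * of_nat n) * of_real (ln 2))"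
    let ?e = "\<lambda>(r, \<xi>). exp (2 * ?a * of_real \<xi> - of_real (u\<^sup>2 * exp r + 1 * exp (2 * \<xi> - r)))"
    have a: "Re ?a > 0" using \<mu> by simp
    have "t n = (\<lambda>p. ?C * ?e p)"
    proof
      fix p :: "real \<times> real"
      obtain r \<xi> where p: "p = (r, \<xi>)" by (cases p)
      have 2: "exp (- (2 * \<mu> + 2 * of_nat n) * of_real (ln 2)) * exp (2 * ?a * of_real \<xi> - of_real (u\<^sup>2 * exp r + 1 * exp (2 * \<xi> - r)))
         = of_real (exp (2 * \<xi> - (u\<^sup>2 * exp r + exp (2 * \<xi> - r)))) * exp (2 * \<mu> * of_real (\<xi> - ln 2)) * exp (2 * of_nat n * of_real (\<xi> - ln 2))"
        unfolding exp_of_real[symmetric] exp_add[symmetric]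
        by (rule arg_cong[where f = exp]) (simp add: algebra_simps)
      show "t n p = ?C * ?e p" unfolding t_def p prod.case quarter_square_power
        using arg_cong[OF 2, of "\<lambda>z. ((2 * \<mu> + 2 * of_nat n) gchoose n) * (rGamma ?a)\<^sup>2 * z"] by (simp only: mult_ac)
    qed
    moreover have "has_bochner_integral lborel (\<lambda>p. ?C * ?e p)
        (?C * ((Gamma ?a)\<^sup>2 * exp (- ?a * of_real (ln (u\<^sup>2) + ln 1)) / 2))"
      using u by (intro has_bochner_integral_mult_right K0_moment a) auto
    moreover have "?C * ((Gamma ?a)\<^sup>2 * exp (- ?a * of_real (ln (u\<^sup>2) + ln 1)) / 2) = s n / of_real (2 * u\<^sup>2)"
    proof -
      have g: "(rGamma ?a)\<^sup>2 * (Gamma ?a)\<^sup>2 = 1"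
        using Gamma_times_rGamma[OF a] by (simp flip: power_mult_distrib add: mult.commute)
      have "exp (- (2 * \<mu> + 2 * of_nat n) * of_real (ln 2)) * exp (- ?a * of_real (ln (u\<^sup>2) + ln 1))
          = exp (- (2 * \<mu> + 2 * of_nat n) * of_real (ln (2 * u))) * exp (of_real (- ln (u\<^sup>2)))"
        unfolding exp_add[symmetric] using u
        by (intro arg_cong[where f = exp]) (simp add: ln_mult ln_realpow algebra_simps)
      also have "exp (complex_of_real (- ln (u\<^sup>2))) = 1 / of_real (u\<^sup>2)"
        using u unfolding exp_of_real by (simp add: exp_minus field_simps)
      finally have e: "exp (- (2 * \<mu> + 2 * of_nat n) * of_real (ln 2)) * exp (- ?a * of_real (ln (u\<^sup>2) + ln 1))
          = exp (- (2 * \<mu> + 2 * of_nat n) * of_real (ln (2 * u))) * (1 / of_real (u\<^sup>2))" .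
      have "?C * ((Gamma ?a)\<^sup>2 * exp (- ?a * of_real (ln (u\<^sup>2) + ln 1)) / 2) =
         ((2 * \<mu> + 2 * of_nat n) gchoose n) * ((rGamma ?a)\<^sup>2 * (Gamma ?a)\<^sup>2) *
         (exp (- (2 * \<mu> + 2 * of_nat n) * of_real (ln 2)) * exp (- ?a * of_real (ln (u\<^sup>2) + ln 1))) / 2"
        by (simp only: mult_ac times_divide_eq_right)
      thus ?thesis unfolding g e s_def by simp
    qed
    ultimately show ?thesis by (simp only: )
  qed
  define f where "f = (\<lambda>(r, \<xi>). of_real (exp (2 * \<xi> - (u\<^sup>2 * exp r + exp (2 * \<xi> - r)))) * (bessel_I \<mu> (of_real (exp \<xi>)))\<^sup>2)"
  define g where "g p = (norm (rGamma (\<mu> + 1)))\<^sup>2 * (case p of (r, \<xi>) \<Rightarrow> exp (2 * \<xi> - (u\<^sup>2 * exp r + exp (2 * \<xi> - r))) * (exp (exp \<xi>))\<^sup>2)" for p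
  have dom: "integrable lborel g"
    unfolding g_def by (intro integrable_mult_right K0_majorant u2)
  have ts: "(\<lambda>n. t n p) sums f p" for p
  proof -
    obtain r \<xi> where p: "p = (r, \<xi>)" by (cases p)
    have sq: "(bessel_I \<mu> (of_real (exp \<xi>)))\<^sup>2 = exp (2 * \<mu> * of_real (\<xi> - ln 2)) * (bessel_clifford \<mu> (of_real ((exp \<xi>)\<^sup>2 / 4)))\<^sup>2"
      unfolding bessel_I_exp power_mult_distrib exp_double[symmetric] by (simp add: mult.assoc)
    show ?thesis
      unfolding t_def f_def p prod.case sq
      by (intro sums_mult bessel_clifford_square_sums) (simp add: \<mu>)
  qed
  have bnd: "norm (\<Sum>n<N. t n p) \<le> g p" for N p
  proof -
    obtain r \<xi> where p: "p = (r, \<xi>)" by (cases p)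
    let ?c = "\<lambda>n. ((2 * \<mu> + 2 * of_nat n) gchoose n) * (rGamma (\<mu> + of_nat n + 1))\<^sup>2 * of_real ((exp \<xi>)\<^sup>2 / 4) ^ n"
    have "norm (\<Sum>n<N. t n p) = exp (2 * \<xi> - (u\<^sup>2 * exp r + exp (2 * \<xi> - r))) * norm (\<Sum>n<N. ?c n)"
      unfolding t_def p prod.case sum_distrib_left[symmetric] norm_mult using \<mu> by simp
    also have "norm (\<Sum>n<N. ?c n) \<le> (norm (rGamma (\<mu> + 1)) * exp (exp \<xi>))\<^sup>2"
      by (rule norm_bessel_clifford_square_partial_le) (auto simp: \<mu>)
    finally show ?thesis by (simp add: g_def p power_mult_distrib mult_ac)
  qed
  have "has_bochner_integral lborel f (exp (- (2 * \<mu>) * of_real w) * of_real (cosh w / sinh w) / of_real (2 * u\<^sup>2))"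
    by (rule has_bochner_integral_sums_dominated[OF t_int ts bnd dom])
       (unfold u_def s_def, rule sums_divide[OF gbinomial_series_cosh[OF w]])
  also have "exp (- (2 * \<mu>) * of_real w) * of_real (cosh w / sinh w) / of_real (2 * u\<^sup>2) = exp (- (2 * \<mu>) * of_real w) / of_real (2 * sinh w * cosh w)"
    using u by (simp add: u_def power2_eq_square)
  finally show ?thesis unfolding f_def u_def .
qed

section \<open>A Fourier integral with a hyperbolic kernel\<close>

lemma borel_measurable_cosh [measurable]:
  assumes "f \<in> borel_measurable M"
  shows "(\<lambda>x. cosh (f x :: real)) \<in> borel_measurable M"
  by (rule borel_measurable_continuous_on[OF _ assms]) (intro continuous_intros)

text \<open>The denominator is written as a Laplace integral; after the exchange both integrals are Gamma
integrals.\<close>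

lemma logistic_integral:
  assumes s: "0 < Re s" "Re s < 1"
  shows "has_bochner_integral lborel (\<lambda>t. exp (s * of_real t) / of_real (1 + exp t)) (Gamma s * Gamma (1 - s))"
proof -
  define f where "f = (\<lambda>(v, t). exp (of_real (v - exp v) + (s * of_real t - of_real (exp v * exp t))))"
  define h where "h v t = exp (v - exp v) * exp (Re s * t - exp v * exp t)" for v t
  have fh: "norm (f (v, t)) = h v t" for v t
    by (simp add: f_def h_def exp_add norm_mult)
  have [measurable]: "f \<in> borel_measurable (lborel \<Otimes>\<^sub>M lborel)"
    unfolding f_def by measurable
  have hI: "has_bochner_integral lborel (h v) (exp (v - exp v) * (Gamma (Re s) * exp (- Re s * v)))" for v
    unfolding h_def using Gamma_integral_exp_real[OF s(1), of "exp v"]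
    by (intro has_bochner_integral_mult_right) auto
  have int: "integrable (lborel \<Otimes>\<^sub>M lborel) f"
  proof (rule Fubini_dominated[where h = h])
    have "integrable lborel (\<lambda>v. Gamma (Re s) * exp ((1 - Re s) * v - 1 * exp v))"
      using Gamma_integral_exp_real[of "1 - Re s" 1] s by (auto simp: has_bochner_integral_iff)
    also have "(\<lambda>v. Gamma (Re s) * exp ((1 - Re s) * v - 1 * exp v)) = (\<lambda>v. exp (v - exp v) * (Gamma (Re s) * exp (- Re s * v)))"
      by (auto simp: fun_eq_iff algebra_simps simp flip: exp_add)
    finally show "integrable lborel (\<lambda>v. exp (v - exp v) * (Gamma (Re s) * exp (- Re s * v)))" .
  qed (use hI fh in \<open>auto simp: sigma_finite_lborel has_bochner_integral_iff\<close>)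
  have t_int: "(LBINT t. f (v, t)) = Gamma s * exp ((1 - s) * of_real v - of_real (1 * exp v))" for v
  proof -
    have "(LBINT t. f (v, t)) = exp (of_real (v - exp v)) * (Gamma s * exp (- s * of_real (ln (exp v))))"
      unfolding f_def prod.case exp_add
      by (simp only: integral_mult_right_zero has_bochner_integral_integral_eq[OF Gamma_integral_exp[OF s(1) exp_gt_zero]])
    also have "\<dots> = Gamma s * (exp (of_real (v - exp v)) * exp (- s * of_real v))" by simp
    also have "exp (of_real (v - exp v)) * exp (- s * of_real v) = exp ((1 - s) * of_real v - of_real (1 * exp v))"
      unfolding exp_add[symmetric] by (rule arg_cong[where f = exp]) (simp add: algebra_simps)
    finally show ?thesis .
  qed
  have v_int: "(LBINT v. f (v, t)) = exp (s * of_real t) / of_real (1 + exp t)" for t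
  proof -
    have p: "1 + exp t > 0" by (simp add: add_pos_pos)
    have "f (v, t) = exp (s * of_real t) * exp (1 * of_real v - of_real ((1 + exp t) * exp v))" for v
      unfolding f_def prod.case exp_add[symmetric] by (rule arg_cong[where f = exp]) (simp add: algebra_simps exp_add)
    hence "(LBINT v. f (v, t)) = exp (s * of_real t) * (Gamma 1 * exp (- 1 * of_real (ln (1 + exp t))))"
      using has_bochner_integral_integral_eq[OF Gamma_integral_exp[of 1 "1 + exp t"]] p
      by (simp only: integral_mult_right_zero one_complex.sel zero_less_one)
    also have "exp (- 1 * complex_of_real (ln (1 + exp t))) = of_real (exp (- ln (1 + exp t)))"
      by (simp add: exp_of_real[symmetric])
    also have "exp (- ln (1 + exp t)) = 1 / (1 + exp t)" using p by (simp add: exp_minus field_simps)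
    finally show ?thesis by simp
  qed
  have f_split: "f = (\<lambda>(v, t). f (v, t))" by auto
  have "integrable lborel (\<lambda>t. LBINT v. f (v, t))"
    using lborel_pair.integrable_snd[of "\<lambda>v t. f (v, t)"] int by simp
  moreover have "(LBINT t. (LBINT v. f (v, t))) = Gamma s * Gamma (1 - s)"
  proof -
    have "(LBINT t. (LBINT v. f (v, t))) = integral\<^sup>L (lborel \<Otimes>\<^sub>M lborel) f"
      using lborel_pair.integral_snd[of "\<lambda>v t. f (v, t)"] int by simp
    also have "\<dots> = (LBINT v. (LBINT t. f (v, t)))"
      by (rule lborel_pair.integral_fst'[OF int, symmetric])
    also have "\<dots> = Gamma s * (Gamma (1 - s) * exp (- (1 - s) * of_real (ln 1)))"
    proof -
      have "0 < Re (1 - s)" using s by simp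
      from has_bochner_integral_integral_eq[OF Gamma_integral_exp[OF this zero_less_one]]
      show ?thesis unfolding t_int integral_mult_right_zero by (simp only:)
    qed
    finally show ?thesis by simp
  qed
  ultimately show ?thesis unfolding v_int has_bochner_integral_iff by blast
qed

text \<open>In partial fractions the kernel is a difference of two translates of the logistic function
\<open>e\<^sup>t / (1 + e\<^sup>t)\<close>. Inside the strip each of them is integrable against
\<open>e\<^bsup>\<mu>t\<^esup>\<close> by itself.\<close>

lemma cosh_kernel_integral_strip:
  fixes w :: real
  assumes m: "-1 < Re \<mu>" "Re \<mu> < 0" and w: "w > 0"
  shows "has_bochner_integral lborel (\<lambda>t. exp (\<mu> * of_real t) / of_real (cosh w + cosh t))
           (of_real pi * (exp (\<mu> * of_real w) - exp (- \<mu> * of_real w)) / (sin (of_real pi * \<mu>) * of_real (sinh w)))"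
proof -
  let ?s = "\<mu> + 1"
  let ?g = "\<lambda>t. exp (?s * of_real t) / of_real (1 + exp t)"
  let ?G = "Gamma ?s * Gamma (1 - ?s)"
  have sw: "sinh w > 0" using w by simp
  have G: "has_bochner_integral lborel ?g ?G"
    using m by (intro logistic_integral) auto
  have G': "?G = - (of_real pi / sin (of_real pi * \<mu>))"
    using Gamma_reflection_complex[of "- \<mu>"] by (simp add: mult.commute add.commute)
  have 1: "has_bochner_integral lborel (\<lambda>t. ?g (c + 1 * t)) (?G /\<^sub>R 1)" for c
    by (rule has_bochner_integral_affine[OF G]) simp
  have "has_bochner_integral lborel
     (\<lambda>t. (exp (- \<mu> * of_real w) * ?g (w + 1 * t) - exp (\<mu> * of_real w) * ?g (- w + 1 * t)) / of_real (sinh w))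
     ((exp (- \<mu> * of_real w) * (?G /\<^sub>R 1) - exp (\<mu> * of_real w) * (?G /\<^sub>R 1)) / of_real (sinh w))"
    by (intro has_bochner_integral_divide has_bochner_integral_diff has_bochner_integral_mult_right 1)
  also have "(\<lambda>t. (exp (- \<mu> * of_real w) * ?g (w + 1 * t) - exp (\<mu> * of_real w) * ?g (- w + 1 * t)) / of_real (sinh w))
     = (\<lambda>t. exp (\<mu> * of_real t) / of_real (cosh w + cosh t))"
  proof
    fix t :: real
    have p: "1 + exp (w + t) > 0" "1 + exp (t - w) > 0" "cosh w + cosh t > 0"
      by (simp_all add: add_pos_pos)
    have "exp (- \<mu> * of_real w) * exp (?s * of_real (w + t)) = exp (\<mu> * of_real t) * of_real (exp (w + t))"
      unfolding exp_of_real[symmetric] exp_add[symmetric] by (rule arg_cong[where f = exp]) (simp add: algebra_simps)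
    moreover have "exp (\<mu> * of_real w) * exp (?s * of_real (t - w)) = exp (\<mu> * of_real t) * of_real (exp (t - w))"
      unfolding exp_of_real[symmetric] exp_add[symmetric] by (rule arg_cong[where f = exp]) (simp add: algebra_simps)
    ultimately have "(exp (- \<mu> * of_real w) * ?g (w + 1 * t) - exp (\<mu> * of_real w) * ?g (- w + 1 * t)) / of_real (sinh w)
       = exp (\<mu> * of_real t) * of_real ((exp (w + t) / (1 + exp (w + t)) - exp (t - w) / (1 + exp (t - w))) / sinh w)"
      by (simp add: right_diff_distrib diff_divide_distrib)
    also have "(exp (w + t) / (1 + exp (w + t)) - exp (t - w) / (1 + exp (t - w))) / sinh w = 1 / (cosh w + cosh t)"
    proof -
      define A B where "A = exp t" and "B = exp w"
      have AB: "A > 0" "B > 0" by (simp_all add: A_def B_def)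
      have B1: "B > 1" using w by (simp add: B_def)
      have e: "exp (w + t) = A * B" "exp (t - w) = A / B" "sinh w = (B - 1 / B) / 2" "cosh w = (B + 1 / B) / 2" "cosh t = (A + 1 / A) / 2"
        by (simp_all add: A_def B_def exp_add exp_diff sinh_def cosh_def exp_minus field_simps)
      have s0: "(B - 1 / B) / 2 \<noteq> 0" using sw unfolding e by simp
      have c0: "(B + 1 / B) / 2 + (A + 1 / A) / 2 > 0" using AB by (intro add_pos_pos divide_pos_pos) auto
      have d: "1 + A * B > 0" "1 + A / B > 0" using AB by (auto intro!: add_pos_pos)
      have "A * B / (1 + A * B) - A / B / (1 + A / B) = (A * B - A / B) / ((1 + A * B) * (1 + A / B))"
      proof -
        have n: "A * B * (1 + A / B) - A / B * (1 + A * B) = A * B - A / B" by (simp add: algebra_simps)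
        show ?thesis by (subst diff_frac_eq) (use d n in simp_all)
      qed
      also have "(1 + A * B) * (1 + A / B) = 2 * A * ((B + 1 / B) / 2 + (A + 1 / A) / 2)"
        using AB by (simp add: field_simps)
      also have "A * B - A / B = 2 * A * ((B - 1 / B) / 2)" by (simp add: algebra_simps)
      finally have "A * B / (1 + A * B) - A / B / (1 + A / B) =
          2 * A * ((B - 1 / B) / 2) / (2 * A * ((B + 1 / B) / 2 + (A + 1 / A) / 2))" .
      moreover have "2 * A * S / (2 * A * C) / S = 1 / C" if "S \<noteq> 0" for S C :: real
        using AB that by simp
      ultimately show ?thesis unfolding e using s0 by (simp only: not_False_eq_True)
    qed
    finally show "(exp (- \<mu> * of_real w) * ?g (w + 1 * t) - exp (\<mu> * of_real w) * ?g (- w + 1 * t)) / of_real (sinh w)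
      = exp (\<mu> * of_real t) / of_real (cosh w + cosh t)" by simp
  qed
  also have "(exp (- \<mu> * of_real w) * (?G /\<^sub>R 1) - exp (\<mu> * of_real w) * (?G /\<^sub>R 1)) / of_real (sinh w)
     = of_real pi * (exp (\<mu> * of_real w) - exp (- \<mu> * of_real w)) / (sin (of_real pi * \<mu>) * of_real (sinh w))"
    unfolding G' by (simp add: field_simps diff_divide_distrib)
  finally show ?thesis .
qed

text \<open>The case \<open>\<mu> = -1/2\<close> of the strip and its reflection under \<open>t \<mapsto> -t\<close>.\<close>

lemma cosh_kernel_majorant:
  fixes w :: real
  assumes w: "w > 0"
  shows "integrable lborel (\<lambda>t. (exp (t / 2) + exp (- t / 2)) / (cosh w + cosh t))"
proof -
  let ?f = "\<lambda>t::real. exp (- t / 2) / (cosh w + cosh t)"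
  have "integrable lborel (\<lambda>t. complex_of_real (?f t))"
    using cosh_kernel_integral_strip[of "- 1 / 2" w] w
    by (simp add: has_bochner_integral_iff exp_of_real[symmetric])
  hence 1: "integrable lborel ?f" by (simp only: complex_of_real_integrable_eq)
  have "integrable lborel (\<lambda>t. ?f (0 + (-1) * t))"
    by (rule lborel_integrable_real_affine[OF 1]) simp
  hence "integrable lborel (\<lambda>t. ?f (0 + (-1) * t) + ?f t)" using 1 by (rule Bochner_Integration.integrable_add)
  thus ?thesis by (simp add: add_divide_distrib)
qed

text \<open>On the imaginary axis the two partial fractions are not integrable separately, but the whole kernel
is, and the value is the limit of those in the strip.\<close>

lemma cosh_kernel_integral:
  fixes w :: real
  assumes m: "Re \<mu> = 0" "\<mu> \<noteq> 0" and w: "w > 0"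
  shows "has_bochner_integral lborel (\<lambda>t. exp (\<mu> * of_real t) / of_real (cosh w + cosh t))
           (of_real pi * (exp (\<mu> * of_real w) - exp (- \<mu> * of_real w)) / (sin (of_real pi * \<mu>) * of_real (sinh w)))"
proof -
  \<comment> \<open>Shifts by at most \<open>1/2\<close> keep all integrands below \<open>cosh_kernel_majorant\<close>.\<close>
  define m where "m n = \<mu> - of_real (1 / (real n + 2))" for n
  have mlim: "m \<longlonglongrightarrow> \<mu>"
  proof -
    have "(\<lambda>n. 1 / (real n + 2)) \<longlonglongrightarrow> 0"
      using LIMSEQ_ignore_initial_segment[OF lim_1_over_n, of 2] by (simp add: add_ac)
    hence "(\<lambda>n. \<mu> - of_real (1 / (real n + 2))) \<longlonglongrightarrow> \<mu> - of_real 0"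
      by (intro tendsto_intros)
    thus ?thesis by (simp add: m_def[abs_def])
  qed
  have Rem: "Re (m n) = - (1 / (real n + 2))" for n using m by (simp add: m_def)
  define S where "S n t = exp (m n * of_real t) / of_real (cosh w + cosh t)" for n t
  define V where "V \<mu> = of_real pi * (exp ((\<mu> :: complex) * of_real w) - exp (- \<mu> * of_real w)) / (sin (of_real pi * \<mu>) * of_real (sinh w))" for \<mu>
  have S: "has_bochner_integral lborel (S n) (V (m n))" for n
    unfolding S_def V_def using w Rem[of n] by (intro cosh_kernel_integral_strip) auto
  define f where "f t = exp (\<mu> * of_real t) / of_real (cosh w + cosh t)" for t
  have [measurable]: "f \<in> borel_measurable lborel" unfolding f_def by measurable
  have Sm: "S n \<in> borel_measurable lborel" for n using S[of n] by (auto simp: has_bochner_integral_iff)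
  have lim: "(\<lambda>n. S n t) \<longlonglongrightarrow> f t" for t
    unfolding S_def f_def divide_inverse by (intro tendsto_intros mlim)
  have bnd: "norm (S n t) \<le> (exp (t / 2) + exp (- t / 2)) / (cosh w + cosh t)" for n t
  proof -
    have "norm (S n t) = exp (Re (m n) * t) / (cosh w + cosh t)"
    proof -
      have "cosh w + cosh t > 0" by (simp add: add_pos_pos)
      hence "norm (complex_of_real (cosh w + cosh t)) = cosh w + cosh t" by (simp only: norm_of_real)
      thus ?thesis by (simp add: S_def norm_divide)
    qed
    also have "exp (Re (m n) * t) \<le> exp (t / 2) + exp (- t / 2)"
    proof -
      have r: "1 / (real n + 2) \<le> 1 / 2" "1 / (real n + 2) \<ge> 0" by (auto simp: field_simps)
      show ?thesis
      proof (cases "t \<ge> 0")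
        case True
        have "Re (m n) * t \<le> 0 * t" unfolding Rem using r True by (intro mult_right_mono) auto
        hence "Re (m n) * t \<le> t / 2" using True by linarith
        hence "exp (Re (m n) * t) \<le> exp (t / 2)" by simp
        thus ?thesis using exp_ge_zero[of "- t / 2"] by linarith
      next
        case False
        have "- (1 / (real n + 2)) * t \<le> - (1 / 2) * t" using r False by (intro mult_right_mono_neg) auto
        hence "Re (m n) * t \<le> - t / 2" unfolding Rem by simp
        hence "exp (Re (m n) * t) \<le> exp (- t / 2)" by simp
        thus ?thesis using exp_ge_zero[of "t / 2"] by linarith
      qed
    qed
    finally show ?thesis by (simp add: divide_right_mono)
  qed
  have conv: "integrable lborel f" "(\<lambda>n. integral\<^sup>L lborel (S n)) \<longlonglongrightarrow> integral\<^sup>L lborel f"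
    using lim bnd Sm cosh_kernel_majorant[OF w]
    by (auto intro!: integrable_dominated_convergence[where s = S and w = "\<lambda>t. (exp (t / 2) + exp (- t / 2)) / (cosh w + cosh t)"]
         integral_dominated_convergence[where s = S and w = "\<lambda>t. (exp (t / 2) + exp (- t / 2)) / (cosh w + cosh t)"])
  have "sin (of_real pi * \<mu>) \<noteq> 0"
  proof
    assume "sin (of_real pi * \<mu>) = 0"
    then obtain k :: int where "of_real pi * \<mu> = of_real (of_int k * pi)" by (auto simp: sin_eq_0)
    hence "\<mu> = of_int k" by simp
    thus False using m by simp
  qed
  moreover have "sinh w \<noteq> 0" using w by simp
  ultimately have "(\<lambda>n. V (m n)) \<longlonglongrightarrow> V \<mu>"
    unfolding V_def by (intro tendsto_intros mlim) auto
  moreover have "(\<lambda>n. V (m n)) \<longlonglongrightarrow> integral\<^sup>L lborel f"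
    using conv(2) S by (simp add: has_bochner_integral_iff)
  ultimately have "integral\<^sup>L lborel f = V \<mu>" using LIMSEQ_unique by blast
  thus ?thesis using conv(1) unfolding has_bochner_integral_iff f_def V_def by blast
qed

lemma integrable_exp_minus_cosh:
  fixes c :: real
  assumes c: "c > 0"
  shows "integrable lborel (\<lambda>t. exp (- c * cosh t))"
proof (rule Bochner_Integration.integrable_bound)
  show "integrable lborel (\<lambda>t. (2 / c) * exp (1 * t - (c / 2) * exp t))"
    using Gamma_integral_exp_real[of 1 "c / 2"] c by (simp add: has_bochner_integral_iff)
  show "AE t in lborel. norm (exp (- c * cosh t)) \<le> norm ((2 / c) * exp (1 * t - (c / 2) * exp t))"
  proof (rule AE_I2)
    fix t :: real
    have "(c / 2) * exp (- t) \<le> exp ((c / 2) * exp (- t))"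
      using exp_ge_add_one_self[of "(c / 2) * exp (- t)"] by linarith
    hence "exp (- ((c / 2) * exp (- t))) \<le> (2 / c) * exp t"
      using c by (simp add: exp_minus field_simps)
    hence "exp (- ((c / 2) * exp t)) * exp (- ((c / 2) * exp (- t))) \<le> exp (- ((c / 2) * exp t)) * ((2 / c) * exp t)"
      by (intro mult_left_mono) auto
    moreover have "exp (- c * cosh t) = exp (- ((c / 2) * exp t)) * exp (- ((c / 2) * exp (- t)))"
      unfolding exp_add[symmetric] by (rule arg_cong[where f = exp]) (simp add: cosh_def algebra_simps)
    moreover have "exp (- ((c / 2) * exp t)) * ((2 / c) * exp t) = (2 / c) * exp (1 * t - (c / 2) * exp t)"
      by (simp only: diff_conv_add_uminus exp_add mult_1 mult_ac)
    ultimately have "exp (- c * cosh t) \<le> (2 / c) * exp (1 * t - (c / 2) * exp t)"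
      by (simp only:)
    thus "norm (exp (- c * cosh t)) \<le> norm ((2 / c) * exp (1 * t - (c / 2) * exp t))"
      using c by (simp add: abs_mult)
  qed
qed measurable

section \<open>Integral representations of the Macdonald function\<close>

lemma imaginary_notin_Ints:
  assumes "Re \<mu> = 0" "\<mu> \<noteq> 0"
  shows "\<mu> \<notin> \<int>"
proof
  assume "\<mu> \<in> \<int>"
  then obtain k :: int where "\<mu> = of_int k" by (elim Ints_cases)
  thus False using assms by simp
qed

text \<open>Both sides have the same Laplace transform in \<open>e\<^bsup>\<xi>\<^esup>\<close>: on the left it follows from
\<open>laplace_bessel_I\<close> for \<open>\<mu>\<close> and \<open>-\<mu>\<close>, on the right the inner integral is
\<open>1 / (cosh w + cosh t)\<close>.\<close>

lemma bessel_K_integral: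
  assumes m: "Re \<mu> = 0" "\<mu> \<noteq> 0"
  shows "bessel_K \<mu> (of_real (exp \<xi>)) = (LBINT t. exp (\<mu> * of_real t - of_real (exp \<xi> * cosh t))) / 2"
proof -
  define k where "k \<xi> t = exp (\<mu> * of_real t - of_real (exp \<xi> * cosh t))" for \<xi> t :: real
  define c where "c = of_real (pi / 2) / sin (of_real pi * \<mu>)"
  define B where "B \<xi> = c * (bessel_I (- \<mu>) (of_real (exp \<xi>)) - bessel_I \<mu> (of_real (exp \<xi>)))" for \<xi>
  define \<phi> where "\<phi> \<xi> = of_real (exp \<xi>) * (B \<xi> - (LBINT t. k \<xi> t) / 2)" for \<xi>
  define l where "l = cosh (2 :: real)"
  have K: "bessel_K \<mu> (of_real (exp \<xi>)) = B \<xi>" for \<xi>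
    using imaginary_notin_Ints[OF m] by (simp add: bessel_K_def B_def c_def Let_def)
  have m': "Re (- \<mu>) = 0" using m by simp
  have norm_k: "norm (k \<xi> t) = exp (- exp \<xi> * cosh t)" for \<xi> t using m by (simp add: k_def)
  have contB: "continuous_on UNIV B"
  proof -
    have "continuous_on UNIV (\<lambda>\<xi>. bessel_clifford \<mu> (of_real ((exp \<xi>)\<^sup>2 / 4)))" if "Re \<mu> = 0" for \<mu>
    proof (rule continuous_on_compose2[where g = "bessel_clifford \<mu>" and t = UNIV])
      show "continuous_on UNIV (bessel_clifford \<mu>)"
        by (rule DERIV_continuous_on, rule has_field_derivative_bessel_clifford[where f = "\<lambda>z. z" and f' = 1])
           (use that in auto)
    qed (auto intro!: continuous_intros)
    thus ?thesis unfolding B_def bessel_I_exp using m m' by (intro continuous_intros) auto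
  qed
  have contk: "continuous_on UNIV (\<lambda>\<xi>. LBINT t. k \<xi> t)"
  proof -
    have *: "continuous_on {a..} (\<lambda>\<xi>. LBINT t. k \<xi> t)" for a
    proof (rule continuous_on_integral_dominated[where h = "\<lambda>t. exp (- exp a * cosh t)"])
      show "continuous_on {a..} (\<lambda>\<xi>. k \<xi> t)" for t unfolding k_def by (intro continuous_intros)
      show "k \<xi> \<in> borel_measurable lborel" for \<xi> unfolding k_def by measurable
      show "norm (k \<xi> t) \<le> exp (- exp a * cosh t)" if "\<xi> \<in> {a..}" for \<xi> t
        using that by (simp add: norm_k mult_right_mono)
    qed (intro integrable_exp_minus_cosh exp_gt_zero)
    have "isCont (\<lambda>\<xi>. LBINT t. k \<xi> t) x" for x
      using *[of "x - 1"] by (rule continuous_on_interior) (simp add: interior_Ici[of "x - 2"])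
    thus ?thesis by (intro continuous_at_imp_continuous_on) auto
  qed
  have LB: "has_bochner_integral lborel (\<lambda>\<xi>. of_real (exp (\<xi> - cosh w * exp \<xi>)) * B \<xi>)
      (c * (exp (\<mu> * of_real w) - exp (- \<mu> * of_real w)) / of_real (sinh w))" if w: "w \<ge> 2" for w
  proof -
    have "has_bochner_integral lborel (\<lambda>\<xi>. c * (of_real (exp (\<xi> - cosh w * exp \<xi>)) * bessel_I (- \<mu>) (of_real (exp \<xi>)) -
        of_real (exp (\<xi> - cosh w * exp \<xi>)) * bessel_I \<mu> (of_real (exp \<xi>))))
       (c * (exp (- (- \<mu>) * of_real w) / of_real (sinh w) - exp (- \<mu> * of_real w) / of_real (sinh w)))"
      by (intro has_bochner_integral_mult_right has_bochner_integral_diff laplace_bessel_I m m' w)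
    thus ?thesis by (simp add: B_def algebra_simps diff_divide_distrib)
  qed
  have Lk: "has_bochner_integral lborel (\<lambda>\<xi>. of_real (exp (\<xi> - cosh w * exp \<xi>)) * ((LBINT t. k \<xi> t) / 2))
      (c * (exp (\<mu> * of_real w) - exp (- \<mu> * of_real w)) / of_real (sinh w))" if w: "w \<ge> 2" for w
  proof -
    define u where "u = cosh w"
    have w0: "w > 0" using w by simp
    have u: "u > 0" by (simp add: u_def)
    have uc: "u + cosh t > 0" for t using u by (simp add: add_pos_pos)
    define f where "f = (\<lambda>(t, \<xi>). of_real (exp (\<xi> - u * exp \<xi>)) * k \<xi> t)"
    define h where "h t \<xi> = exp (1 * \<xi> - (u + cosh t) * exp \<xi>)" for t \<xi>
    have fh: "norm (f (t, \<xi>)) = h t \<xi>" for t \<xi>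
      unfolding f_def h_def prod.case norm_mult norm_k by (simp add: algebra_simps flip: exp_add)
    have hI: "has_bochner_integral lborel (h t) (1 / (u + cosh t))" for t
      unfolding h_def using Gamma_integral_exp_real[of 1 "u + cosh t"] uc[of t] by (simp add: exp_minus inverse_eq_divide)
    have [measurable]: "f \<in> borel_measurable (lborel \<Otimes>\<^sub>M lborel)"
      unfolding f_def k_def by measurable
    have H: "integrable lborel (\<lambda>t. 1 / (u + cosh t))"
    proof (rule Bochner_Integration.integrable_bound[OF cosh_kernel_majorant[OF w0]])
      show "AE t in lborel. norm (1 / (u + cosh t)) \<le> norm ((exp (t / 2) + exp (- t / 2)) / (cosh w + cosh t))"
      proof (rule AE_I2)
        fix t :: real
        have "1 \<le> exp (t / 2) + exp (- t / 2)"
          using exp_ge_add_one_self[of "t / 2"] exp_ge_add_one_self[of "- t / 2"] by linarith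
        thus "norm (1 / (u + cosh t)) \<le> norm ((exp (t / 2) + exp (- t / 2)) / (cosh w + cosh t))"
          using uc[of t] by (simp add: u_def divide_right_mono)
      qed
    qed measurable
    have int: "integrable (lborel \<Otimes>\<^sub>M lborel) f"
      by (rule Fubini_dominated[where h = h, OF _ _ _ _ _ H])
         (use hI fh in \<open>auto simp: sigma_finite_lborel has_bochner_integral_iff\<close>)
    have inner: "(LBINT \<xi>. f (t, \<xi>)) = exp (\<mu> * of_real t) / of_real (cosh w + cosh t)" for t
    proof -
      have "f (t, \<xi>) = exp (\<mu> * of_real t) * of_real (h t \<xi>)" for \<xi>
        unfolding f_def h_def k_def prod.case exp_of_real[symmetric] exp_add[symmetric]
        by (rule arg_cong[where f = exp]) (simp add: algebra_simps)
      hence "(LBINT \<xi>. f (t, \<xi>)) = exp (\<mu> * of_real t) * of_real (LBINT \<xi>. h t \<xi>)"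
        by simp
      thus ?thesis using hI[of t] by (simp add: has_bochner_integral_iff u_def)
    qed
    have "(LBINT \<xi>. (LBINT t. f (t, \<xi>))) = (LBINT t. (LBINT \<xi>. f (t, \<xi>)))"
      using lborel_pair.integral_snd[of "\<lambda>t \<xi>. f (t, \<xi>)"] lborel_pair.integral_fst'[OF int] int by simp
    also have "\<dots> = of_real pi * (exp (\<mu> * of_real w) - exp (- \<mu> * of_real w)) / (sin (of_real pi * \<mu>) * of_real (sinh w))"
      unfolding inner using cosh_kernel_integral[OF m w0] by (simp only: has_bochner_integral_iff)
    finally have eq: "(LBINT \<xi>. (LBINT t. f (t, \<xi>))) = \<dots>" .
    have i: "integrable lborel (\<lambda>\<xi>. LBINT t. f (t, \<xi>))"
      using lborel_pair.integrable_snd[of "\<lambda>t \<xi>. f (t, \<xi>)"] int by simp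
    have "has_bochner_integral lborel (\<lambda>\<xi>. (LBINT t. f (t, \<xi>)) / 2)
       (of_real pi * (exp (\<mu> * of_real w) - exp (- \<mu> * of_real w)) / (sin (of_real pi * \<mu>) * of_real (sinh w)) / 2)"
      using i eq by (intro has_bochner_integral_divide) (simp add: has_bochner_integral_iff)
    thus ?thesis by (simp add: f_def c_def u_def mult_ac)
  qed
  have "\<phi> \<xi> = 0"
  proof (rule laplace_unique[where E = exp and l = l and \<phi> = \<phi>])
    show "strict_mono (exp :: real \<Rightarrow> real)" by (simp add: strict_mono_def)
    show "continuous_on UNIV \<phi>" unfolding \<phi>_def by (intro continuous_intros contB contk) auto
    have L0: "has_bochner_integral lborel (\<lambda>\<xi>. of_real (exp (- (l + real n) * exp \<xi>)) * \<phi> \<xi>) 0" for n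
    proof -
      define w where "w = arcosh (l + real n)"
      have l1: "l \<ge> 1" unfolding l_def by (rule cosh_real_ge_1)
      hence cw: "cosh w = l + real n" and "w \<ge> 0" by (auto simp: w_def cosh_arcosh_real)
      have w: "w \<ge> 2"
      proof -
        have "cosh 2 \<le> cosh w" by (simp add: cw l_def)
        thus ?thesis using \<open>w \<ge> 0\<close> by (simp add: cosh_real_nonneg_le_iff)
      qed
      have "has_bochner_integral lborel (\<lambda>\<xi>. of_real (exp (\<xi> - cosh w * exp \<xi>)) * B \<xi> -
          of_real (exp (\<xi> - cosh w * exp \<xi>)) * ((LBINT t. k \<xi> t) / 2)) 0"
        using has_bochner_integral_diff[OF LB[OF w] Lk[OF w]] by simp
      also have "(\<lambda>\<xi>. of_real (exp (\<xi> - cosh w * exp \<xi>)) * B \<xi> -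
          of_real (exp (\<xi> - cosh w * exp \<xi>)) * ((LBINT t. k \<xi> t) / 2)) = (\<lambda>\<xi>. of_real (exp (- (l + real n) * exp \<xi>)) * \<phi> \<xi>)"
      proof
        fix \<xi>
        have "exp (\<xi> - cosh w * exp \<xi>) = exp (- (l + real n) * exp \<xi>) * exp \<xi>"
          unfolding cw exp_add[symmetric] by (simp add: algebra_simps)
        thus "of_real (exp (\<xi> - cosh w * exp \<xi>)) * B \<xi> -
          of_real (exp (\<xi> - cosh w * exp \<xi>)) * ((LBINT t. k \<xi> t) / 2) = of_real (exp (- (l + real n) * exp \<xi>)) * \<phi> \<xi>"
          by (simp only: \<phi>_def of_real_mult right_diff_distrib mult.assoc)
      qed
      finally show ?thesis .
    qed
    show "integrable lborel (\<lambda>\<xi>. of_real (exp (- l * exp \<xi>)) * \<phi> \<xi>)"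
      using L0[of 0] by (simp add: has_bochner_integral_iff)
    show "(LBINT \<xi>. of_real (exp (- (l + real n) * exp \<xi>)) * \<phi> \<xi>) = 0" for n :: nat
      using L0[of n] by (simp only: has_bochner_integral_iff)
  qed (auto intro!: continuous_intros)
  thus ?thesis by (simp add: K \<phi>_def k_def)
qed

text \<open>In the product of two copies of the preceding integral one passes to the half sum \<open>t\<close> and the half
difference \<open>v\<close> of the variables, where the exponent becomes \<open>-2x cosh t cosh v\<close>. The shift
\<open>r = v + ln (x / cosh t)\<close> then separates \<open>x\<close> from \<open>cosh t\<close>.\<close>

lemma bessel_K_square_integral:
  assumes m: "Re \<mu> = 0" "\<mu> \<noteq> 0" and x: "x > 0"
  shows "(bessel_K \<mu> (of_real x))\<^sup>2 =
     (LBINT t. (LBINT r. exp (2 * \<mu> * of_real t) * of_real (exp (- ((cosh t)\<^sup>2 * exp r + x\<^sup>2 * exp (- r)))))) / 2"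
proof -
  define k where "k t = exp (\<mu> * of_real t - of_real (x * cosh t))" for t
  have nk: "norm (k t) = exp (- x * cosh t)" for t using m by (simp add: k_def)
  have km [measurable]: "k \<in> borel_measurable borel" unfolding k_def by measurable
  have kI: "integrable lborel k"
    by (rule Bochner_Integration.integrable_bound[OF integrable_exp_minus_cosh[OF x]])
       (simp_all add: nk)
  have K: "bessel_K \<mu> (of_real x) = (LBINT t. k t) / 2"
    using bessel_K_integral[OF m, of "ln x"] x by (simp add: k_def)
  have aff: "(LBINT b. k b) = 2 * (LBINT t. k (2 * t - a))" for a
    using lborel_integral_real_affine[of 2 k "- a"] by (simp add: scaleR_conv_of_real)
  have affR: "(LBINT t. norm (k (2 * t - a))) = (LBINT b. norm (k b)) / 2" for a
    using lborel_integral_real_affine[of 2 "\<lambda>b. norm (k b)" "- a"] by simp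
  define f where "f = (\<lambda>(a, t). k a * k (2 * t - a))"
  have [measurable]: "f \<in> borel_measurable (lborel \<Otimes>\<^sub>M lborel)"
    unfolding f_def k_def by measurable
  have int: "integrable (lborel \<Otimes>\<^sub>M lborel) f"
  proof (rule Fubini_dominated[where h = "\<lambda>a t. norm (k a) * norm (k (2 * t - a))"
          and H = "\<lambda>a. norm (k a) * ((LBINT b. norm (k b)) / 2)"])
    show "integrable lborel (\<lambda>t. norm (k a) * norm (k (2 * t - a)))" for a
      using lborel_integrable_real_affine[OF integrable_norm[OF kI], of 2 "- a"] by simp
    show "(LBINT t. norm (k a) * norm (k (2 * t - a))) \<le> norm (k a) * ((LBINT b. norm (k b)) / 2)" for a
      by (simp only: integral_mult_right_zero affR order_refl)
  qed (use kI in \<open>auto simp: sigma_finite_lborel f_def norm_mult\<close>)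
  have inner: "(LBINT a. f (a, t)) = (LBINT r. exp (2 * \<mu> * of_real t) * of_real (exp (- ((cosh t)\<^sup>2 * exp r + x\<^sup>2 * exp (- r)))))" for t
  proof -
    define c where "c = t + ln (cosh t) - ln x"
    have feq: "f (c + 1 * r, t) = exp (2 * \<mu> * of_real t) * of_real (exp (- ((cosh t)\<^sup>2 * exp r + x\<^sup>2 * exp (- r))))" for r
    proof -
      define v where "v = ln (cosh t) - ln x + r"
      have c1: "c + 1 * r = t + v" and c2: "2 * t - (c + 1 * r) = t - v" by (simp_all add: c_def v_def)
      have e: "exp v = cosh t / x * exp r" "exp (- v) = x / cosh t * exp (- r)"
        using x by (simp_all add: v_def exp_add exp_diff exp_minus field_simps)
      have "x * cosh (t + v) + x * cosh (t - v) = x * cosh t * (exp v + exp (- v))"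
        by (simp add: cosh_add cosh_diff cosh_def[of v] algebra_simps)
      also have "\<dots> = (cosh t)\<^sup>2 * exp r + x\<^sup>2 * exp (- r)"
        unfolding e using x by (simp add: field_simps power2_eq_square)
      finally have s: "x * cosh (t + v) + x * cosh (t - v) = (cosh t)\<^sup>2 * exp r + x\<^sup>2 * exp (- r)" .
      have "f (c + 1 * r, t) = exp (2 * \<mu> * of_real t - of_real (x * cosh (t + v) + x * cosh (t - v)))"
        unfolding f_def prod.case c2 c1 k_def exp_add[symmetric]
        by (rule arg_cong[where f = exp]) (simp add: algebra_simps)
      also have "\<dots> = exp (2 * \<mu> * of_real t) * of_real (exp (- ((cosh t)\<^sup>2 * exp r + x\<^sup>2 * exp (- r))))"
        unfolding s exp_of_real[symmetric] exp_add[symmetric]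
        by (rule arg_cong[where f = exp]) (simp add: algebra_simps)
      finally show ?thesis .
    qed
    have "(LBINT a. f (a, t)) = (LBINT r. f (c + 1 * r, t))"
      using lborel_integral_real_affine[of 1 "\<lambda>a. f (a, t)" c] by simp
    thus ?thesis by (simp only: feq)
  qed
  have "(bessel_K \<mu> (of_real x))\<^sup>2 = (LBINT a. k a * (LBINT b. k b)) / 4"
    by (simp add: K power2_eq_square)
  also have "(LBINT a. k a * (LBINT b. k b)) = (LBINT a. 2 * (LBINT t. f (a, t)))"
  proof (rule Bochner_Integration.integral_cong[OF refl])
    show "k a * (LBINT b. k b) = 2 * (LBINT t. f (a, t))" for a
      unfolding aff[of a] by (simp add: f_def)
  qed
  also have "\<dots> = 2 * (LBINT a. (LBINT t. f (a, t)))" by simp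
  also have "(LBINT a. (LBINT t. f (a, t))) = (LBINT t. (LBINT a. f (a, t)))"
    using lborel_pair.integral_snd[of "\<lambda>t \<xi>. f (t, \<xi>)"] lborel_pair.integral_fst'[OF int] int by simp
  finally show ?thesis unfolding inner by simp
qed

section \<open>Fourier inversion and Mellin inversion\<close>

lemma gaussian_fourier:
  "integrable lborel (\<lambda>z. exp (\<i> * of_real (a * z)) * of_real (exp (- z\<^sup>2 / 2)))"
  "(LBINT z. exp (\<i> * of_real (a * z)) * of_real (exp (- z\<^sup>2 / 2))) = of_real (sqrt (2 * pi) * exp (- a\<^sup>2 / 2))"
proof -
  have n: "std_normal_density z = exp (- z\<^sup>2 / 2) / sqrt (2 * pi)" for z
    by (simp add: std_normal_density_def)
  have "integrable lborel (\<lambda>z. sqrt (2 * pi) * std_normal_density z)"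
    by (intro integrable_mult_right) (rule integrable_normal_density, simp)
  hence G: "integrable lborel (\<lambda>z::real. exp (- z\<^sup>2 / 2))" by (simp add: n)
  show "integrable lborel (\<lambda>z. exp (\<i> * of_real (a * z)) * of_real (exp (- z\<^sup>2 / 2)))"
    by (rule Bochner_Integration.integrable_bound[OF G]) (auto simp: norm_mult)
  have "char std_normal_distribution a = (LBINT z. exp (\<i> * of_real (a * z)) * of_real (exp (- z\<^sup>2 / 2)) / of_real (sqrt (2 * pi)))"
    unfolding char_def by (subst integral_density) (auto simp: n scaleR_conv_of_real mult_ac)
  hence "(LBINT z. exp (\<i> * of_real (a * z)) * of_real (exp (- z\<^sup>2 / 2))) = of_real (sqrt (2 * pi)) * char std_normal_distribution a"
    by simp
  thus "(LBINT z. exp (\<i> * of_real (a * z)) * of_real (exp (- z\<^sup>2 / 2))) = of_real (sqrt (2 * pi) * exp (- a\<^sup>2 / 2))"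
    by (simp only: char_std_normal_distribution of_real_mult)
qed

text \<open>Gaussian summation: with the factor \<open>exp(-(\<tau>/n)\<^sup>2/2)\<close> inserted, the left side is a
Gaussian mean of \<open>g\<close> of width \<open>1/n\<close> around \<open>t\<close>.\<close>

lemma fourier_inversion:
  fixes g F :: "real \<Rightarrow> complex"
  assumes cont: "continuous_on UNIV g" and g: "integrable lborel g" and B: "\<And>t. norm (g t) \<le> B"
    and F_def: "\<And>\<tau>. F \<tau> = (LBINT t. exp (\<i> * of_real (\<tau> * t)) * g t)" and F: "integrable lborel F"
  shows "(LBINT \<tau>. F \<tau> * exp (- \<i> * of_real (\<tau> * t))) = 2 * of_real pi * g t"
proof -
  define e where "e n \<tau> = exp (- (\<tau> / real (Suc n))\<^sup>2 / 2)" for n \<tau>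
  define G where "G z = exp (- z\<^sup>2 / 2)" for z :: real
  have Gint: "integrable lborel G" "(LBINT z. of_real (G z)) = complex_of_real (sqrt (2 * pi))"
    using gaussian_fourier[of 0] by (simp_all add: G_def[abs_def] complex_of_real_integrable_eq del: integral_complex_of_real)
  have [measurable]: "g \<in> borel_measurable borel" "F \<in> borel_measurable borel"
    using g F by auto
  have eint: "integrable lborel (e n)" for n
  proof -
    have "e n = (\<lambda>\<tau>. G (0 + (1 / real (Suc n)) * \<tau>))" by (simp add: fun_eq_iff e_def G_def)
    thus ?thesis using lborel_integrable_real_affine[OF Gint(1), of "1 / real (Suc n)" 0] by simp
  qed
  define f where "f n = (\<lambda>(s, \<tau>). exp (\<i> * of_real (\<tau> * s)) * g s * (exp (- \<i> * of_real (\<tau> * t)) * of_real (e n \<tau>)))" for n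
  have fint: "integrable (lborel \<Otimes>\<^sub>M lborel) (f n)" for n
  proof (rule Fubini_product_bound[where a = "\<lambda>s. norm (g s)" and b = "e n"])
    show "f n \<in> borel_measurable (lborel \<Otimes>\<^sub>M lborel)" unfolding f_def e_def by measurable
  qed (use g eint in \<open>auto simp: sigma_finite_lborel f_def norm_mult e_def\<close>)
  have inner: "(LBINT \<tau>. f n (s, \<tau>)) = g s * of_real (real (Suc n) * sqrt (2 * pi) * G (real (Suc n) * (s - t)))" for n s
  proof -
    let ?N = "real (Suc n)"
    have "(LBINT \<tau>. f n (s, \<tau>)) = ?N *\<^sub>R (LBINT z. f n (s, 0 + ?N * z))"
      using lborel_integral_real_affine[of ?N "\<lambda>\<tau>. f n (s, \<tau>)" 0] by simp
    also have "(\<lambda>z. f n (s, 0 + ?N * z)) = (\<lambda>z. g s * (exp (\<i> * of_real ((?N * (s - t)) * z)) * of_real (exp (- z\<^sup>2 / 2))))"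
    proof
      fix z
      have "exp (\<i> * of_real ((0 + ?N * z) * s)) * exp (- \<i> * of_real ((0 + ?N * z) * t)) = exp (\<i> * of_real ((?N * (s - t)) * z))"
        unfolding exp_add[symmetric] by (rule arg_cong[where f = exp]) (simp add: algebra_simps)
      moreover have "e n (0 + ?N * z) = exp (- z\<^sup>2 / 2)" by (simp add: e_def)
      ultimately show "f n (s, 0 + ?N * z) = g s * (exp (\<i> * of_real ((?N * (s - t)) * z)) * of_real (exp (- z\<^sup>2 / 2)))"
      proof -
        have rearrange: "A * D * (B * E) = D * (C * E)" if "A * B = C" for A B C D E :: complex
          by (simp add: that[symmetric] mult_ac)
        assume "exp (\<i> * of_real ((0 + ?N * z) * s)) * exp (- \<i> * of_real ((0 + ?N * z) * t)) = exp (\<i> * of_real ((?N * (s - t)) * z))"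
          and e: "e n (0 + ?N * z) = exp (- z\<^sup>2 / 2)"
        from rearrange[OF this(1)] show ?thesis unfolding f_def prod.case e .
      qed
    qed
    also have "(LBINT z. g s * (exp (\<i> * of_real ((?N * (s - t)) * z)) * of_real (exp (- z\<^sup>2 / 2))))
       = g s * of_real (sqrt (2 * pi) * exp (- (?N * (s - t))\<^sup>2 / 2))"
      by (simp only: integral_mult_right_zero gaussian_fourier)
    finally show ?thesis by (simp add: G_def scaleR_conv_of_real)
  qed
  have outer: "(LBINT \<tau>. F \<tau> * exp (- \<i> * of_real (\<tau> * t)) * of_real (e n \<tau>))
      = of_real (sqrt (2 * pi)) * (LBINT v. g (t + v / real (Suc n)) * of_real (G v))" for n
  proof -
    let ?N = "real (Suc n)"
    have "(LBINT s. f n (s, \<tau>)) = F \<tau> * exp (- \<i> * of_real (\<tau> * t)) * of_real (e n \<tau>)" for \<tau>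
      unfolding f_def prod.case F_def by (subst integral_mult_left_zero) (simp only: mult.assoc)
    hence "(LBINT \<tau>. F \<tau> * exp (- \<i> * of_real (\<tau> * t)) * of_real (e n \<tau>)) = (LBINT \<tau>. (LBINT s. f n (s, \<tau>)))"
      by simp
    also have "\<dots> = (LBINT s. (LBINT \<tau>. f n (s, \<tau>)))"
      using lborel_pair.integral_snd[of "\<lambda>s \<tau>. f n (s, \<tau>)"] lborel_pair.integral_fst'[OF fint[of n]] fint[of n] by simp
    also have "\<dots> = (1 / ?N) *\<^sub>R (LBINT v. g (t + (1 / ?N) * v) * of_real (?N * sqrt (2 * pi) * G (?N * ((t + (1 / ?N) * v) - t))))"
      unfolding inner
      using lborel_integral_real_affine[of "1 / ?N" "\<lambda>s. g s * of_real (?N * sqrt (2 * pi) * G (?N * (s - t)))" t] by simp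
    also have "(\<lambda>v. g (t + (1 / ?N) * v) * of_real (?N * sqrt (2 * pi) * G (?N * ((t + (1 / ?N) * v) - t))))
       = (\<lambda>v. of_real (?N * sqrt (2 * pi)) * (g (t + v / ?N) * of_real (G v)))"
      by (simp add: fun_eq_iff)
    also have "(1 / ?N) *\<^sub>R (LBINT v. of_real (?N * sqrt (2 * pi)) * (g (t + v / ?N) * of_real (G v)))
       = of_real (sqrt (2 * pi)) * (LBINT v. g (t + v / ?N) * of_real (G v))"
      by (simp only: integral_mult_right_zero) (simp add: scaleR_conv_of_real del: of_nat_Suc)
    finally show ?thesis .
  qed
  have "(\<lambda>n. of_real (sqrt (2 * pi)) * (LBINT v. g (t + v / real (Suc n)) * of_real (G v)))
     \<longlonglongrightarrow> of_real (sqrt (2 * pi)) * (LBINT v. g t * of_real (G v))"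
  proof (intro tendsto_intros integral_dominated_convergence[where w = "\<lambda>v. B * G v"])
    show "AE v in lborel. (\<lambda>n. g (t + v / real (Suc n)) * of_real (G v)) \<longlonglongrightarrow> g t * of_real (G v)"
    proof (intro AE_I2 tendsto_intros)
      fix v
      have "(\<lambda>n. v / real (Suc n)) \<longlonglongrightarrow> 0"
        by (rule LIMSEQ_Suc[OF lim_const_over_n])
      hence "(\<lambda>n. t + v / real (Suc n)) \<longlonglongrightarrow> t + 0" by (intro tendsto_intros)
      hence lim: "(\<lambda>n. t + v / real (Suc n)) \<longlonglongrightarrow> t" by (simp only: add_0_right)
      have "isCont g t" using cont by (simp add: continuous_on_eq_continuous_at)
      thus "(\<lambda>n. g (t + v / real (Suc n))) \<longlonglongrightarrow> g t"
        by (rule isCont_tendsto_compose[OF _ lim])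
    qed
    show "AE v in lborel. norm (g (t + v / real (Suc n)) * of_real (G v)) \<le> B * G v" for n
      using B by (auto simp: norm_mult G_def mult_right_mono)
  qed (use Gint in auto)
  moreover have "(\<lambda>n. LBINT \<tau>. F \<tau> * exp (- \<i> * of_real (\<tau> * t)) * of_real (e n \<tau>))
      \<longlonglongrightarrow> (LBINT \<tau>. F \<tau> * exp (- \<i> * of_real (\<tau> * t)))"
  proof (intro integral_dominated_convergence[where w = "\<lambda>\<tau>. norm (F \<tau>)"])
    show "AE \<tau> in lborel. (\<lambda>n. F \<tau> * exp (- \<i> * of_real (\<tau> * t)) * of_real (e n \<tau>)) \<longlonglongrightarrow> F \<tau> * exp (- \<i> * of_real (\<tau> * t))"
    proof (intro AE_I2)
      fix \<tau>
      have "(\<lambda>n. \<tau> / real (Suc n)) \<longlonglongrightarrow> 0"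
        by (rule LIMSEQ_Suc[OF lim_const_over_n])
      hence "(\<lambda>n. e n \<tau>) \<longlonglongrightarrow> exp (- 0\<^sup>2 / 2)" unfolding e_def by (intro tendsto_intros) auto
      hence "(\<lambda>n. F \<tau> * exp (- \<i> * of_real (\<tau> * t)) * of_real (e n \<tau>)) \<longlonglongrightarrow> F \<tau> * exp (- \<i> * of_real (\<tau> * t)) * of_real (exp (- 0\<^sup>2 / 2))"
        by (intro tendsto_intros)
      thus "(\<lambda>n. F \<tau> * exp (- \<i> * of_real (\<tau> * t)) * of_real (e n \<tau>)) \<longlonglongrightarrow> F \<tau> * exp (- \<i> * of_real (\<tau> * t))"
        by simp
    qed
    show "AE \<tau> in lborel. norm (F \<tau> * exp (- \<i> * of_real (\<tau> * t)) * of_real (e n \<tau>)) \<le> norm (F \<tau>)" for n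
      by (auto simp: norm_mult e_def mult_left_le)
    show "(\<lambda>\<tau>. F \<tau> * exp (- \<i> * of_real (\<tau> * t)) * of_real (e n \<tau>)) \<in> borel_measurable lborel" for n
      unfolding e_def by measurable
  qed (use F in auto)
  ultimately have "(LBINT \<tau>. F \<tau> * exp (- \<i> * of_real (\<tau> * t))) = of_real (sqrt (2 * pi)) * (LBINT v. g t * of_real (G v))"
    unfolding outer by (rule LIMSEQ_unique[rotated])
  also have "\<dots> = of_real (sqrt (2 * pi) * sqrt (2 * pi)) * g t"
    unfolding integral_mult_right_zero Gint(2) by (simp only: of_real_mult mult_ac)
  also have "complex_of_real (sqrt (2 * pi) * sqrt (2 * pi)) = 2 * of_real pi"
    by (subst real_sqrt_mult_self) simp
  finally show ?thesis .
qed

lemma integrable_inverse_one_plus_square: "integrable lborel (\<lambda>t::real. inverse (1 + t\<^sup>2))"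
  using integrable_inverse_1_plus_square by (simp add: set_integrable_def)

text \<open>A form of Hoelder's inequality. The modulus of \<open>F\<close> is \<open>a b\<close> with
\<open>a = (1 + \<bar>t\<bar>) \<bar>F\<bar>\<close> in \<open>L\<^sub>p\<close> and \<open>b = 1 / (1 + \<bar>t\<bar>)\<close>. Since
\<open>1 < p \<le> 2\<close> and \<open>b \<le> 1\<close>, one has \<open>a b \<le> a\<^sup>p + b\<^sup>2\<close>.\<close>

lemma Lp_line_imp_integrable:
  assumes p: "1 < p" "p \<le> 2" and F: "Lp_line \<nu> p F" and sF: "Lp_line \<nu> p (\<lambda>s. s * F s)"
  shows "integrable lebesgue (\<lambda>t. F (Complex \<nu> t))"
proof (rule Bochner_Integration.integrable_bound)
  let ?N = "\<lambda>t. norm (F (Complex \<nu> t)) powr p" and ?M = "\<lambda>t. norm (Complex \<nu> t * F (Complex \<nu> t)) powr p"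
  have "integrable lebesgue (\<lambda>t::real. inverse (1 + t\<^sup>2))"
    using integrable_inverse_one_plus_square by (subst integrable_completion) auto
  thus "integrable lebesgue (\<lambda>t. 2 powr p * (?N t + ?M t) + inverse (1 + t\<^sup>2))"
    using F sF unfolding Lp_line_def by (intro Bochner_Integration.integrable_add integrable_mult_right) auto
  show "(\<lambda>t. F (Complex \<nu> t)) \<in> borel_measurable lebesgue"
    using F by (simp add: Lp_line_def)
  show "AE t in lebesgue. norm (F (Complex \<nu> t)) \<le> norm (2 powr p * (?N t + ?M t) + inverse (1 + t\<^sup>2))"
  proof (rule AE_I2)
    fix t :: real
    define x y where "x = norm (F (Complex \<nu> t))" and "y = norm (Complex \<nu> t * F (Complex \<nu> t))"
    define a b where "a = (1 + \<bar>t\<bar>) * x" and "b = 1 / (1 + \<bar>t\<bar>)"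
    have nn: "x \<ge> 0" "y \<ge> 0" "a \<ge> 0" "b > 0" "b \<le> 1" by (auto simp: x_def y_def a_def b_def)
    have "\<bar>t\<bar> \<le> norm (Complex \<nu> t)" using abs_Im_le_cmod[of "Complex \<nu> t"] by simp
    hence "\<bar>t\<bar> * x \<le> y" by (simp add: x_def y_def norm_mult mult_right_mono)
    hence a_le: "a \<le> 2 * max x y" by (simp add: a_def algebra_simps max_def)
    have "a powr p \<le> (2 * max x y) powr p" using a_le nn p by (intro powr_mono2) auto
    also have "\<dots> = 2 powr p * (max x y) powr p" using nn by (simp add: powr_mult max_def)
    also have "\<dots> \<le> 2 powr p * (x powr p + y powr p)"
      by (intro mult_left_mono) (auto simp: max_def)
    finally have ap: "a powr p \<le> 2 powr p * (x powr p + y powr p)" .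
    have "b\<^sup>2 \<le> inverse (1 + t\<^sup>2)"
    proof -
      have "1 + t\<^sup>2 \<le> (1 + \<bar>t\<bar>)\<^sup>2" by (simp add: power2_eq_square algebra_simps)
      thus ?thesis unfolding b_def power_divide
        by (simp add: inverse_eq_divide frac_le add_pos_nonneg)
    qed
    moreover have "x = a * b" by (simp add: a_def b_def add_nonneg_eq_0_iff add_pos_nonneg)
    moreover have "a * b \<le> a powr p + b\<^sup>2"
    proof (cases "a \<le> b")
      case True
      hence "a * b \<le> b\<^sup>2" using nn by (simp add: power2_eq_square mult_right_mono)
      thus ?thesis using powr_ge_zero[of a p] by linarith
    next
      case False
      have a0: "a > 0" using False nn by linarith
      have "b \<le> a powr (p - 1)"
      proof (cases "a \<le> 1")
        case True
        have "a powr 1 \<le> a powr (p - 1)" using True a0 p by (intro powr_mono') auto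
        thus ?thesis using False a0 by simp
      next
        case f: False
        have "1 \<le> a powr (p - 1)" using f p by (intro ge_one_powr_ge_zero) auto
        thus ?thesis using nn by linarith
      qed
      hence "a * b \<le> a * a powr (p - 1)" using a0 by (intro mult_left_mono) auto
      also have "\<dots> = a powr p" using a0 by (simp add: powr_mult_base)
      finally show ?thesis using zero_le_power2[of b] by linarith
    qed
    ultimately have "x \<le> 2 powr p * (x powr p + y powr p) + inverse (1 + t\<^sup>2)" using ap by linarith
    thus "norm (F (Complex \<nu> t)) \<le> norm (2 powr p * (?N t + ?M t) + inverse (1 + t\<^sup>2))"
      unfolding x_def y_def by simp
  qed
qed

lemma inverse_mellin_regular:
  assumes F: "integrable lebesgue (\<lambda>t. F (Complex \<nu> t))"
  shows "continuous_on {0<..} (inverse_mellin \<nu> F)"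
    and "\<exists>C. \<forall>x>0. norm (inverse_mellin \<nu> F x) \<le> C * x powr (- \<nu>)"
proof -
  let ?k = "\<lambda>t \<xi>. F (Complex \<nu> t) * (exp (- Complex \<nu> t * of_real \<xi>) * of_real (exp (\<nu> * \<xi>)))"
  have pw: "complex_of_real x powr (- Complex \<nu> t) = exp (- Complex \<nu> t * of_real (ln x))" if "x > 0" for x t
    using that Ln_of_real[of x] by (simp add: powr_def)
  have nrm: "norm (exp (- Complex \<nu> t * of_real (ln x))) = x powr (- \<nu>)" if "x > 0" for x t
    using that by (simp add: powr_def)
  have "norm (inverse_mellin \<nu> F x) \<le> (1 / (2 * pi) * (\<integral>t. norm (F (Complex \<nu> t)) \<partial>lebesgue)) * x powr (- \<nu>)" if x: "x > 0" for x
  proof -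
    have "norm (\<integral>t. F (Complex \<nu> t) * of_real x powr (- Complex \<nu> t) \<partial>lebesgue)
        \<le> (\<integral>t. norm (F (Complex \<nu> t) * of_real x powr (- Complex \<nu> t)) \<partial>lebesgue)" by (rule integral_norm_bound)
    also have "\<dots> = (\<integral>t. norm (F (Complex \<nu> t)) \<partial>lebesgue) * x powr (- \<nu>)"
      using x by (simp only: norm_mult pw nrm integral_mult_left_zero)
    finally show ?thesis
      by (simp add: inverse_mellin_def norm_mult norm_divide divide_right_mono)
  qed
  thus "\<exists>C. \<forall>x>0. norm (inverse_mellin \<nu> F x) \<le> C * x powr (- \<nu>)" by blast
  have m: "(\<lambda>t. exp (- Complex \<nu> t * of_real c)) \<in> borel_measurable lebesgue" for c
  proof -
    have "(\<lambda>t. exp (- Complex \<nu> t * of_real c)) \<in> borel_measurable borel"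
      by (intro borel_measurable_continuous_onI continuous_intros continuous_on_Complex)
    hence "(\<lambda>t. exp (- Complex \<nu> t * of_real c)) \<in> borel_measurable lborel" by simp
    thus ?thesis by (rule measurable_completion)
  qed
  have "continuous_on UNIV (\<lambda>\<xi>. \<integral>t. ?k t \<xi> \<partial>lebesgue)"
  proof (rule continuous_on_integral_dominated[where h = "\<lambda>t. norm (F (Complex \<nu> t))"])
    show "norm (?k t \<xi>) \<le> norm (F (Complex \<nu> t))" for t \<xi>
      by (simp add: norm_mult flip: exp_add)
    show "(\<lambda>t. ?k t \<xi>) \<in> borel_measurable lebesgue" for \<xi>
      using F m[of \<xi>] by (intro borel_measurable_times borel_measurable_const) auto
  qed (use F in \<open>auto intro!: continuous_intros\<close>)
  hence "continuous_on {0<..} (\<lambda>x. \<integral>t. ?k t (ln x) \<partial>lebesgue)"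
    by (rule continuous_on_compose2[of UNIV _ _ ln]) (auto intro!: continuous_intros)
  hence "continuous_on {0<..} (\<lambda>x. 1 / (2 * of_real pi) * (of_real (exp (- \<nu> * ln x)) * (\<integral>t. ?k t (ln x) \<partial>lebesgue)))"
    by (intro continuous_intros) auto
  also have "?this \<longleftrightarrow> continuous_on {0<..} (inverse_mellin \<nu> F)"
  proof (rule continuous_on_cong[OF refl])
    fix x :: real assume "x \<in> {0<..}"
    hence x: "x > 0" by simp
    have I: "(\<integral>t. ?k t (ln x) \<partial>lebesgue)
        = (\<integral>t. F (Complex \<nu> t) * exp (- Complex \<nu> t * of_real (ln x)) \<partial>lebesgue) * of_real (exp (\<nu> * ln x))"
      unfolding mult.assoc[symmetric] by (rule integral_mult_left_zero)
    have "of_real (exp (- \<nu> * ln x)) * (\<integral>t. ?k t (ln x) \<partial>lebesgue)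
        = (of_real (exp (- \<nu> * ln x)) * of_real (exp (\<nu> * ln x))) * (\<integral>t. F (Complex \<nu> t) * exp (- Complex \<nu> t * of_real (ln x)) \<partial>lebesgue)"
      unfolding I by (simp only: mult_ac)
    also have "complex_of_real (exp (- \<nu> * ln x)) * of_real (exp (\<nu> * ln x)) = 1"
      unfolding of_real_mult[symmetric] exp_add[symmetric] by simp
    finally show "1 / (2 * of_real pi) * (of_real (exp (- \<nu> * ln x)) * (\<integral>t. ?k t (ln x) \<partial>lebesgue)) = inverse_mellin \<nu> F x"
      using x by (simp only: inverse_mellin_def pw) simp
  qed
  finally show "continuous_on {0<..} (inverse_mellin \<nu> F)" .
qed

section \<open>The index transform as a Fourier transform\<close>

lemma exp_minus_le_powr:
  fixes e z :: real
  assumes "0 < e" "e \<le> 1" "z > 0"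
  shows "exp (- z) \<le> z powr (- e)"
proof -
  have "e * ln z \<le> z"
  proof (cases "ln z \<ge> 0")
    case True
    hence "e * ln z \<le> 1 * ln z" using assms by (intro mult_right_mono) auto
    also have "\<dots> \<le> z" using ln_le_minus_one[OF assms(3)] by simp
    finally show ?thesis .
  next
    case False
    hence "e * ln z \<le> 0" using assms by (simp add: mult_le_0_iff)
    thus ?thesis using assms by simp
  qed
  thus ?thesis using assms by (simp add: powr_def)
qed

text \<open>One half of the exponent is at least \<open>ux\<close> by the inequality of the means, and
\<open>e\<^bsup>-ux\<^esup> \<le> (ux)\<^bsup>-e\<^esup>\<close>. Of the other half, the
term with \<open>u\<close> yields the decay in \<open>e\<^sup>r\<close>, and the term with \<open>x\<close> is traded for a power.
The bound is a product of functions of \<open>u\<close>, \<open>x\<close> and \<open>r\<close>, and for small \<open>e\<close> it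
is only slightly singular at \<open>x = 0\<close>.\<close>

lemma K0_kernel_le:
  fixes e u x :: real
  assumes e: "0 < e" "e \<le> 1" and u: "u \<ge> 1" and x: "x > 0"
  shows "exp (- (u\<^sup>2 * exp r + x\<^sup>2 * exp (- r))) \<le> u powr (- e) * (x powr (- 3 * e) * (2 powr e * exp (e * r - exp r / 2)))"
proof -
  define A B where "A = u\<^sup>2 * exp r" and "B = x\<^sup>2 * exp (- r)"
  have AB: "A > 0" "B > 0" using u x by (auto simp: A_def B_def)
  have 1: "u * x \<le> (A + B) / 2"
  proof -
    define p q where "p = u * exp (r / 2)" and "q = x * exp (- r / 2)"
    have "p * p = A" "q * q = B" "p * q = u * x"
      by (simp_all add: p_def q_def A_def B_def power2_eq_square flip: exp_add)
    moreover have "0 \<le> (p - q) * (p - q)" by simp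
    ultimately show ?thesis by (simp add: algebra_simps)
  qed
  have 2: "exp r \<le> A" using u power_mono[of 1 u 2] by (simp add: A_def)
  have "exp (- (A + B)) \<le> exp (- (u * x)) * exp (- (exp r / 2)) * exp (- (B / 2))"
    using 1 2 unfolding exp_add[symmetric] by simp
  also have "\<dots> \<le> (u * x) powr (- e) * exp (- (exp r / 2)) * (B / 2) powr (- e)"
    using exp_minus_le_powr[OF e, of "u * x"] exp_minus_le_powr[OF e, of "B / 2"] AB u x
    by (intro mult_mono) auto
  also have "(B / 2) powr (- e) = 2 powr e * x powr (- 2 * e) * exp (e * r)"
    using x by (simp add: B_def powr_def ln_mult ln_div ln_realpow algebra_simps flip: exp_add)
  also have "(u * x) powr (- e) = u powr (- e) * x powr (- e)"
    using u x by (simp add: powr_mult)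
  also have "x powr (- 3 * e) = x powr (- e) * x powr (- 2 * e)"
    by (simp flip: powr_add)
  ultimately have "exp (- (A + B)) \<le> u powr (- e) * x powr (- e) * exp (- (exp r / 2)) * (2 powr e * x powr (- 2 * e) * exp (e * r))"
    by simp
  also have "\<dots> = u powr (- e) * ((x powr (- e) * x powr (- 2 * e)) * (2 powr e * (exp (e * r) * exp (- (exp r / 2)))))"
    by (simp only: mult_ac)
  also have "x powr (- e) * x powr (- 2 * e) = x powr (- 3 * e)"
    by (simp flip: powr_add)
  also have "exp (e * r) * exp (- (exp r / 2)) = exp (e * r - exp r / 2)"
    by (simp flip: exp_add)
  finally show ?thesis unfolding A_def B_def .
qed

text \<open>Compared with the logistic integral for \<open>s = 1/2\<close>, rescaled by \<open>2e\<close>.\<close>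

lemma integrable_cosh_powr:
  fixes e :: real
  assumes e: "e > 0"
  shows "integrable lborel (\<lambda>t. cosh t powr (- e))"
proof (rule Bochner_Integration.integrable_bound)
  have "integrable lborel (\<lambda>t. exp (1 / 2 * complex_of_real t) / of_real (1 + exp t))"
    using logistic_integral[of "1 / 2"] by (simp add: has_bochner_integral_iff)
  also have "(\<lambda>t. exp (1 / 2 * complex_of_real t) / of_real (1 + exp t)) = (\<lambda>t. complex_of_real (exp (t / 2) / (1 + exp t)))"
    by (simp add: fun_eq_iff flip: exp_of_real)
  finally have "integrable lborel (\<lambda>t::real. exp (t / 2) / (1 + exp t))"
    by (simp only: complex_of_real_integrable_eq)
  from lborel_integrable_real_affine[OF this, of "2 * e" 0] e
  have "integrable lborel (\<lambda>t. exp (e * t) / (1 + exp (2 * e * t)))" by simp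
  thus "integrable lborel (\<lambda>t. 2 * 2 powr e * (exp (e * t) / (1 + exp (2 * e * t))))"
    by (rule integrable_mult_right)
  show "AE t in lborel. norm (cosh t powr (- e)) \<le> norm (2 * 2 powr e * (exp (e * t) / (1 + exp (2 * e * t))))"
  proof (rule AE_I2)
    fix t :: real
    have "exp \<bar>t\<bar> / 2 \<le> cosh t"
      using exp_ge_zero[of "- t"] exp_ge_zero[of t] by (simp add: cosh_def abs_if divide_right_mono del: exp_ge_zero)
    hence "cosh t powr (- e) \<le> (exp \<bar>t\<bar> / 2) powr (- e)"
      using e by (intro powr_mono2') auto
    also have "\<dots> = 2 powr e * exp (- (e * \<bar>t\<bar>))"
      by (simp add: powr_def ln_div algebra_simps flip: exp_add)
    also have "exp (- (e * \<bar>t\<bar>)) \<le> 2 * (exp (e * t) / (1 + exp (2 * e * t)))"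
    proof -
      have "1 + exp (2 * e * t) \<le> 2 * (exp (e * t) * exp (e * \<bar>t\<bar>))"
      proof (cases "t \<ge> 0")
        case True
        have "exp (e * t) * exp (e * \<bar>t\<bar>) = exp (2 * e * t)" using True by (simp flip: exp_add)
        moreover have "1 \<le> exp (2 * e * t)" using True e by simp
        ultimately show ?thesis by simp
      next
        case False
        have "exp (e * t) * exp (e * \<bar>t\<bar>) = 1" using False by (simp flip: exp_add)
        moreover have "exp (2 * e * t) \<le> 1" using False e by (simp add: mult_le_0_iff)
        ultimately show ?thesis by simp
      qed
      moreover have "1 + exp (2 * e * t) > 0" by (simp add: add_pos_pos)
      ultimately show ?thesis by (simp add: exp_minus field_simps)
    qed
    finally have "cosh t powr (- e) \<le> 2 powr e * (2 * (exp (e * t) / (1 + exp (2 * e * t))))" by simp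
    moreover have "1 + exp (2 * e * t) > 0" by (simp add: add_pos_pos)
    ultimately show "norm (cosh t powr (- e)) \<le> norm (2 * 2 powr e * (exp (e * t) / (1 + exp (2 * e * t))))"
      by (simp add: mult_ac)
  qed
qed measurable

text \<open>Functions on the half line, extended by zero, for which the index transform converges absolutely: the
exponent \<open>e\<close> measures the room that the logarithmic singularity of \<open>K\<^sub>0\<close> needs at 0.\<close>

locale half_line_function =
  fixes f :: "real \<Rightarrow> complex" and e :: real
  assumes e: "0 < e" "e \<le> 1"
    and f_nonpos: "\<And>x. x \<le> 0 \<Longrightarrow> f x = 0"
    and f_cont: "continuous_on {0<..} f"
    and f_meas [measurable]: "f \<in> borel_measurable borel"
    and f_int: "integrable lborel f"
    and f_weight: "integrable lborel (\<lambda>x. x powr (- 3 * e) * norm (f x))"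
begin

text \<open>The Laplace transform of \<open>f\<close> in the variable \<open>x\<^sup>2\<close>, at the point \<open>e\<^bsup>-r\<^esup>\<close>.\<close>

definition gauss :: "real \<Rightarrow> complex" where
  "gauss r = (LBINT x. of_real (exp (- (x\<^sup>2 * exp (- r)))) * f x)"

text \<open>This is \<open>\<integral>\<^sub>0\<^sup>\<infinity> K\<^sub>0(2x cosh t) f(x) dx\<close>, the Meijer transform of \<open>f\<close>,
with the integral over \<open>r\<close> that defines \<open>K\<^sub>0\<close> taken outside.\<close>

definition meijer :: "real \<Rightarrow> complex" where
  "meijer t = (LBINT r. of_real (exp (- ((cosh t)\<^sup>2 * exp r))) * gauss r) / 2"

definition index_fourier :: "real \<Rightarrow> complex" where
  "index_fourier \<tau> = (LBINT t. exp (\<i> * of_real (\<tau> * t)) * meijer t)"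

definition kernel_majorant :: "real \<Rightarrow> real" where
  "kernel_majorant r = 2 powr e * exp (e * r - exp r / 2)"

definition weight_norm :: real where
  "weight_norm = (LBINT x. x powr (- 3 * e) * norm (f x))"

lemma kernel_majorant_int: "integrable lborel kernel_majorant"
  unfolding kernel_majorant_def using Gamma_integral_exp_real[of e "1 / 2"] e
  by (simp add: has_bochner_integral_iff)

lemma kernel_f_le:
  assumes "u \<ge> 1"
  shows "exp (- (u\<^sup>2 * exp r + x\<^sup>2 * exp (- r))) * norm (f x)
           \<le> u powr (- e) * (x powr (- 3 * e) * norm (f x) * kernel_majorant r)"
proof (cases "x > 0")
  case True
  have "exp (- (u\<^sup>2 * exp r + x\<^sup>2 * exp (- r))) * norm (f x) \<le> (u powr (- e) * (x powr (- 3 * e) * kernel_majorant r)) * norm (f x)"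
    using K0_kernel_le[OF e assms True] unfolding kernel_majorant_def by (intro mult_right_mono) auto
  thus ?thesis by (simp only: mult_ac)
next
  case False thus ?thesis using f_nonpos[of x] by simp
qed

lemma gauss_cont: "continuous_on UNIV gauss"
  unfolding gauss_def
proof (rule continuous_on_integral_dominated[where h = "\<lambda>x. norm (f x)"])
  show "norm (of_real (exp (- (x\<^sup>2 * exp (- r)))) * f x) \<le> norm (f x)" for x r
    by (simp add: norm_mult mult_left_le_one_le)
qed (use f_int in \<open>auto intro!: continuous_intros\<close>)

lemma gauss_meas [measurable]: "gauss \<in> borel_measurable borel"
  by (rule borel_measurable_continuous_onI[OF gauss_cont])

lemma norm_gauss_le:
  assumes "l \<ge> 1"
  shows "exp (- (l * exp r)) * norm (gauss r) \<le> weight_norm * kernel_majorant r"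
proof -
  have "exp (- (l * exp r)) * norm (gauss r) \<le> exp (- exp r) * (LBINT x. norm (of_real (exp (- (x\<^sup>2 * exp (- r)))) * f x))"
    unfolding gauss_def using assms by (intro mult_mono integral_norm_bound) auto
  also have "\<dots> = (LBINT x. exp (- (1\<^sup>2 * exp r + x\<^sup>2 * exp (- r))) * norm (f x))"
    unfolding integral_mult_right_zero[symmetric]
  proof (rule Bochner_Integration.integral_cong[OF refl])
    fix x
    have "exp (- (1\<^sup>2 * exp r + x\<^sup>2 * exp (- r))) = exp (- exp r) * exp (- (x\<^sup>2 * exp (- r)))"
      by (simp flip: exp_add)
    thus "exp (- exp r) * norm (of_real (exp (- (x\<^sup>2 * exp (- r)))) * f x)
        = exp (- (1\<^sup>2 * exp r + x\<^sup>2 * exp (- r))) * norm (f x)"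
      by (simp only: norm_mult norm_of_real abs_exp_cancel mult.assoc)
  qed
  also have "\<dots> \<le> (LBINT x. x powr (- 3 * e) * norm (f x) * kernel_majorant r)"
  proof (rule integral_mono)
    show "integrable lborel (\<lambda>x. x powr (- 3 * e) * norm (f x) * kernel_majorant r)"
      by (intro integrable_mult_left f_weight)
    show le: "exp (- (1\<^sup>2 * exp r + x\<^sup>2 * exp (- r))) * norm (f x) \<le> x powr (- 3 * e) * norm (f x) * kernel_majorant r" for x
      using kernel_f_le[of 1 r x] by simp
    show "integrable lborel (\<lambda>x. exp (- (1\<^sup>2 * exp r + x\<^sup>2 * exp (- r))) * norm (f x))"
      by (rule Bochner_Integration.integrable_bound[OF integrable_norm[OF f_int]])
         (auto intro!: AE_I2 mult_left_le_one_le simp: abs_mult add_nonneg_nonneg simp flip: minus_add_distrib)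
  qed
  also have "\<dots> = weight_norm * kernel_majorant r"
    unfolding weight_norm_def by (rule integral_mult_left_zero)
  finally show ?thesis .
qed

lemma meijer_integrand_int:
  assumes "l \<ge> 1"
  shows "integrable lborel (\<lambda>r. of_real (exp (- (l * exp r))) * gauss r)"
proof (rule Bochner_Integration.integrable_bound)
  show "integrable lborel (\<lambda>r. weight_norm * kernel_majorant r)"
    by (intro integrable_mult_right kernel_majorant_int)
  show "AE r in lborel. norm (of_real (exp (- (l * exp r))) * gauss r) \<le> norm (weight_norm * kernel_majorant r)"
    using norm_gauss_le[OF assms] by (intro AE_I2) (auto simp: norm_mult intro: order_trans[OF _ abs_ge_self])
qed measurable

lemma cosh_square_ge_1: "(cosh (t::real))\<^sup>2 \<ge> 1"
  using cosh_real_ge_1[of t] by simp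

lemma meijer_cont: "continuous_on UNIV meijer"
  unfolding meijer_def
proof (intro continuous_intros continuous_on_integral_dominated[where h = "\<lambda>r. weight_norm * kernel_majorant r"])
  show "integrable lborel (\<lambda>r. weight_norm * kernel_majorant r)"
    by (intro integrable_mult_right kernel_majorant_int)
  show "norm (of_real (exp (- ((cosh t)\<^sup>2 * exp r))) * gauss r) \<le> weight_norm * kernel_majorant r" for t r
    using norm_gauss_le[OF cosh_square_ge_1] by (simp add: norm_mult)
qed (auto intro!: continuous_intros)

lemma meijer_bounded: "norm (meijer t) \<le> (LBINT r. weight_norm * kernel_majorant r) / 2"
proof -
  have "norm (LBINT r. of_real (exp (- ((cosh t)\<^sup>2 * exp r))) * gauss r) \<le> (LBINT r. weight_norm * kernel_majorant r)"
    using norm_gauss_le[OF cosh_square_ge_1]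
    by (intro Bochner_Integration.integral_norm_bound_integral meijer_integrand_int cosh_square_ge_1
          integrable_mult_right kernel_majorant_int) (simp add: norm_mult)
  thus ?thesis by (simp add: meijer_def norm_divide)
qed

abbreviation triple_kernel :: "real \<Rightarrow> real \<Rightarrow> real \<Rightarrow> real \<Rightarrow> complex" where
  "triple_kernel \<tau> x t r \<equiv> exp (\<i> * of_real (\<tau> * t)) * of_real (exp (- ((cosh t)\<^sup>2 * exp r + x\<^sup>2 * exp (- r)))) * f x"

abbreviation gauss_kernel :: "real \<Rightarrow> real \<Rightarrow> real \<Rightarrow> complex" where
  "gauss_kernel \<tau> t r \<equiv> exp (\<i> * of_real (\<tau> * t)) * (of_real (exp (- ((cosh t)\<^sup>2 * exp r))) * gauss r)"

lemma triple_int: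
  "integrable (lborel \<Otimes>\<^sub>M (lborel :: (real \<times> real) measure))
     (\<lambda>(x, t, r). triple_kernel \<tau> x t r)"
  and pair_slice_int:
  "integrable (lborel :: (real \<times> real) measure)
     (\<lambda>(t, r). triple_kernel \<tau> x t r)"
proof -
  define b where "b = (\<lambda>(t, r). cosh t powr (- e) * kernel_majorant r)"
  have [measurable]: "kernel_majorant \<in> borel_measurable borel"
    using kernel_majorant_int by auto
  have b: "integrable (lborel :: (real \<times> real) measure) b"
    unfolding lborel_prod[symmetric]
  proof (rule Fubini_product_bound[where a = "\<lambda>t. cosh t powr (- e)" and b = kernel_majorant])
    show "b \<in> borel_measurable (lborel \<Otimes>\<^sub>M lborel)" unfolding b_def by measurable
    show "norm (b (t, r)) \<le> cosh t powr (- e) * kernel_majorant r" for t r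
      by (simp add: b_def kernel_majorant_def)
  qed (use kernel_majorant_int integrable_cosh_powr[OF e(1)] in \<open>auto simp: sigma_finite_lborel\<close>)
  have bound: "norm (triple_kernel \<tau> x t r)
     \<le> (x powr (- 3 * e) * norm (f x)) * b (t, r)" for x t r
    using kernel_f_le[OF cosh_real_ge_1, of t r x] by (simp add: norm_mult b_def mult_ac)
  show "integrable (lborel \<Otimes>\<^sub>M (lborel :: (real \<times> real) measure))
     (\<lambda>(x, t, r). triple_kernel \<tau> x t r)"
  proof (rule Fubini_product_bound[where a = "\<lambda>x. x powr (- 3 * e) * norm (f x)" and b = b])
    show "(\<lambda>(x, t, r). triple_kernel \<tau> x t r)
       \<in> borel_measurable (lborel \<Otimes>\<^sub>M (lborel :: (real \<times> real) measure))"
      unfolding lborel_prod[symmetric] by measurable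
  qed (use bound f_weight b in \<open>auto simp: sigma_finite_lborel\<close>)
  show "integrable (lborel :: (real \<times> real) measure)
     (\<lambda>(t, r). triple_kernel \<tau> x t r)"
  proof (rule Bochner_Integration.integrable_bound)
    show "integrable lborel (\<lambda>p. (x powr (- 3 * e) * norm (f x)) * b p)" using b by (rule integrable_mult_right)
    show "AE p in lborel. norm (case p of (t, r) \<Rightarrow> triple_kernel \<tau> x t r)
       \<le> norm ((x powr (- 3 * e) * norm (f x)) * b p)"
      using bound by (intro AE_I2) (auto intro!: order_trans[OF _ abs_ge_self] split: prod.split)
  qed (unfold lborel_prod[symmetric], measurable)
qed

lemma gauss_pair:
  "integrable (lborel :: (real \<times> real) measure)
     (\<lambda>(t, r). gauss_kernel \<tau> t r)"
  and triple_eq: "(LBINT x. (LBINT p. (case p of (t, r) \<Rightarrow> triple_kernel \<tau> x t r)))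
     = (LBINT p. (case p of (t, r) \<Rightarrow> gauss_kernel \<tau> t r))"
proof -
  let ?f = "\<lambda>x p. (case p of (t, r) \<Rightarrow> triple_kernel \<tau> x t r)"
  have T: "integrable (lborel \<Otimes>\<^sub>M (lborel :: (real \<times> real) measure)) (case_prod ?f)"
    using triple_int[of \<tau>] by (simp add: case_prod_unfold)
  have eq: "(LBINT x. ?f x p) = (case p of (t, r) \<Rightarrow> gauss_kernel \<tau> t r)" for p
  proof -
    obtain t r where p: "p = (t, r)" by (cases p)
    have "?f x p = exp (\<i> * of_real (\<tau> * t)) * (of_real (exp (- ((cosh t)\<^sup>2 * exp r))) * (of_real (exp (- (x\<^sup>2 * exp (- r)))) * f x))" for x
      unfolding p prod.case minus_add_distrib exp_add of_real_mult by (simp only: mult.assoc)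
    thus ?thesis by (simp only: integral_mult_right_zero gauss_def p prod.case)
  qed
  show "integrable (lborel :: (real \<times> real) measure)
     (\<lambda>(t, r). gauss_kernel \<tau> t r)"
    using lborel_pair.integrable_snd[OF T] by (simp only: eq)
  show "(LBINT x. (LBINT p. ?f x p))
     = (LBINT p. (case p of (t, r) \<Rightarrow> gauss_kernel \<tau> t r))"
    using lborel_pair.integral_snd[OF T] lborel_pair.integral_fst[OF T] by (simp only: eq)
qed

lemma meijer_int: "integrable lborel meijer"
  using lborel_pair.integrable_fst'[OF gauss_pair[of 0, folded lborel_prod]]
  by (simp add: meijer_def[abs_def])

lemma index_fourier_eq_pair:
  "index_fourier \<tau> = (LBINT p. (case p of (t, r) \<Rightarrow> gauss_kernel \<tau> t r)) / 2"
proof -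
  have "(LBINT t. (LBINT r. gauss_kernel \<tau> t r))
     = (LBINT p. (case p of (t, r) \<Rightarrow> gauss_kernel \<tau> t r))"
    using lborel_pair.integral_fst'[OF gauss_pair[of \<tau>, folded lborel_prod]] by (simp add: lborel_prod)
  thus ?thesis
    unfolding index_fourier_def meijer_def integral_mult_right_zero times_divide_eq_right integral_divide_zero by (simp only:)
qed

text \<open>\<open>bessel_K_square_integral\<close> is inserted and the integral over \<open>x\<close> is carried out first. The
value \<open>\<tau> = 0\<close> is excluded, since there \<open>K\<close> is defined by a limit; in the theorem it is
weighted by \<open>\<tau>\<close>.\<close>

lemma index_transform_eq_fourier:
  assumes "\<tau> \<noteq> 0" and h: "\<And>x. x > 0 \<Longrightarrow> h x = f x"
  shows "index_transform h \<tau> = index_fourier \<tau>"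
proof -
  let ?\<mu> = "\<i> * of_real \<tau> / 2"
  have m: "Re ?\<mu> = 0" "?\<mu> \<noteq> 0" using assms by auto
  define G where "G x = (LBINT p. (case p of (t, r) \<Rightarrow> triple_kernel \<tau> x t r)) / 2" for x
  have G_meas: "G \<in> borel_measurable lborel"
  proof -
    have "integrable lborel (\<lambda>x. LBINT p. (case p of (t, r) \<Rightarrow> triple_kernel \<tau> x t r))"
      using lborel_pair.integrable_fst'[OF triple_int[of \<tau>]] by simp
    thus ?thesis unfolding G_def by auto
  qed
  have eq: "indicator {0<..} x *\<^sub>R (bessel_K ?\<mu> (of_real x) ^ 2 * h x) = G x" for x
  proof (cases "x > 0")
    case True
    have "(LBINT t. (LBINT r. triple_kernel \<tau> x t r)) / 2 = G x"
      unfolding G_def using lborel_pair.integral_fst'[OF pair_slice_int[of \<tau> x, folded lborel_prod]]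
      by (simp add: lborel_prod)
    hence e1: "(LBINT t. (LBINT r. exp (\<i> * of_real (\<tau> * t)) * of_real (exp (- ((cosh t)\<^sup>2 * exp r + x\<^sup>2 * exp (- r)))))) * f x / 2 = G x"
      by (simp only: integral_mult_left_zero)
    have e2: "2 * ?\<mu> * of_real t = \<i> * of_real (\<tau> * t)" for t by simp
    have "bessel_K ?\<mu> (of_real x) ^ 2 * h x = G x"
      unfolding bessel_K_square_integral[OF m True] h[OF True] e2 e1[symmetric] by (rule times_divide_eq_left)
    thus ?thesis using True by simp
  next
    case False
    hence "f x = 0" using f_nonpos by simp
    thus ?thesis using False by (simp add: G_def case_prod_unfold)
  qed
  have "index_transform h \<tau> = (\<integral>x. G x \<partial>lebesgue)"
    unfolding index_transform_def set_lebesgue_integral_def eq ..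
  also have "\<dots> = (LBINT x. G x)" by (rule integral_completion[OF G_meas])
  also have "\<dots> = index_fourier \<tau>"
    unfolding G_def integral_divide_zero triple_eq index_fourier_eq_pair ..
  finally show ?thesis .
qed

lemma index_fourier_cont: "continuous_on UNIV index_fourier"
  unfolding index_fourier_def
proof (rule continuous_on_integral_dominated[where h = "\<lambda>t. norm (meijer t)"])
  show "(\<lambda>t. exp (\<i> * of_real (\<tau> * t)) * meijer t) \<in> borel_measurable lborel" for \<tau>
    using meijer_int by measurable
qed (use meijer_int in \<open>auto intro!: continuous_intros simp: norm_mult\<close>)

lemma index_fourier_bounded: "norm (index_fourier \<tau>) \<le> (LBINT t. norm (meijer t))"
proof -
  have "norm (index_fourier \<tau>) \<le> (LBINT t. norm (exp (\<i> * of_real (\<tau> * t)) * meijer t))"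
    unfolding index_fourier_def by (rule integral_norm_bound)
  thus ?thesis by (simp add: norm_mult)
qed

lemma index_fourier_meas [measurable]: "index_fourier \<in> borel_measurable borel"
  by (rule borel_measurable_continuous_onI[OF index_fourier_cont])

end

section \<open>Inverting the Fourier transform\<close>

lemma norm_bessel_I_imaginary_square_le:
  "norm ((bessel_I (\<i> * of_real \<tau> / 2) (of_real (exp \<xi>)))\<^sup>2) \<le> exp (pi * \<bar>\<tau>\<bar>) * (exp (exp \<xi>))\<^sup>2"
proof -
  let ?\<mu> = "\<i> * complex_of_real \<tau> / 2"
  have "(norm (rGamma (?\<mu> + 1)))\<^sup>2 \<le> exp (pi * \<bar>\<tau> / 2\<bar>)"
    using norm_rGamma_one_plus_imaginary[of "\<tau> / 2"] by simp
  also have "\<dots> \<le> exp (pi * \<bar>\<tau>\<bar>)" by simp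
  finally have 1: "(norm (rGamma (?\<mu> + 1)))\<^sup>2 \<le> exp (pi * \<bar>\<tau>\<bar>)" .
  have "norm ((bessel_I ?\<mu> (of_real (exp \<xi>)))\<^sup>2) \<le> (norm (rGamma (?\<mu> + 1)) * exp (exp \<xi>))\<^sup>2"
    unfolding norm_power using norm_bessel_I_exp_le[of ?\<mu> \<xi>] by (intro power_mono) auto
  also have "\<dots> = (norm (rGamma (?\<mu> + 1)))\<^sup>2 * (exp (exp \<xi>))\<^sup>2" by (rule power_mult_distrib)
  also have "\<dots> \<le> exp (pi * \<bar>\<tau>\<bar>) * (exp (exp \<xi>))\<^sup>2" using 1 by (intro mult_right_mono) auto
  finally show ?thesis .
qed

text \<open>The reciprocal Gamma functions grow like \<open>exp(\<pi>\<bar>\<tau>\<bar>/2)\<close>, and the factor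
\<open>\<bar>\<tau>\<bar>\<close> that differentiation of \<open>x\<^bsup>i\<tau>\<^esup>\<close> produces is absorbed by
another \<open>exp(\<pi>\<bar>\<tau>\<bar>/2)\<close>. The bound is uniform for \<open>x\<close> in \<open>(a, b)\<close>, as
differentiation under the integral requires.\<close>

lemma norm_bessel_I_square_deriv_le:
  assumes x: "0 < a" "a < x" "x < b"
  shows "norm (bessel_I_square_deriv (\<i> * of_real \<tau> / 2) x) \<le> (1 / a + b) * (exp b)\<^sup>2 * exp (pi * \<bar>\<tau>\<bar>)"
proof -
  let ?\<mu> = "\<i> * complex_of_real \<tau> / 2"
  define R where "R = norm (rGamma (?\<mu> + 1))"
  have R2: "R\<^sup>2 \<le> exp (pi * \<bar>\<tau>\<bar> / 2)"
    using norm_rGamma_one_plus_imaginary[of "\<tau> / 2"] by (simp add: R_def)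
  have C1: "norm (bessel_clifford ?\<mu> (of_real (x\<^sup>2 / 4))) \<le> R * exp b"
  proof -
    have "norm (bessel_clifford ?\<mu> (of_real (x\<^sup>2 / 4))) \<le> R * exp x"
      unfolding R_def using x by (intro norm_bessel_clifford_le) auto
    also have "\<dots> \<le> R * exp b" using x by (intro mult_left_mono) (auto simp: R_def)
    finally show ?thesis .
  qed
  have C2: "norm (bessel_clifford (?\<mu> + 1) (of_real (x\<^sup>2 / 4))) \<le> R * exp b"
  proof -
    have "norm (rGamma ((?\<mu> + 1) + 1)) \<le> R"
      using norm_rGamma_shift_le[of ?\<mu> 1] by (simp add: R_def add_ac)
    hence "norm (rGamma ((?\<mu> + 1) + 1)) * exp x \<le> R * exp b" using x by (intro mult_mono) (auto simp: R_def)
    moreover have "norm (bessel_clifford (?\<mu> + 1) (of_real (x\<^sup>2 / 4))) \<le> norm (rGamma ((?\<mu> + 1) + 1)) * exp x"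
      using x by (intro norm_bessel_clifford_le) auto
    ultimately show ?thesis by linarith
  qed
  have "norm (2 * ?\<mu> / of_real x * bessel_clifford ?\<mu> (of_real (x\<^sup>2 / 4)) + of_real x * bessel_clifford (?\<mu> + 1) (of_real (x\<^sup>2 / 4)))
      \<le> \<bar>\<tau>\<bar> / x * (R * exp b) + x * (R * exp b)"
  proof (rule order_trans[OF norm_triangle_ineq], rule add_mono)
    show "norm (2 * ?\<mu> / of_real x * bessel_clifford ?\<mu> (of_real (x\<^sup>2 / 4))) \<le> \<bar>\<tau>\<bar> / x * (R * exp b)"
      unfolding norm_mult[of "2 * ?\<mu> / of_real x"] using C1 x by (intro mult_mono) (auto simp: norm_divide norm_mult)
    show "norm (of_real x * bessel_clifford (?\<mu> + 1) (of_real (x\<^sup>2 / 4))) \<le> x * (R * exp b)"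
      unfolding norm_mult[of "of_real x"] using C2 x by (intro mult_mono) auto
  qed
  also have "\<dots> \<le> (1 + \<bar>\<tau>\<bar>) * (1 / a + b) * (R * exp b)"
  proof -
    have "\<bar>\<tau>\<bar> / x \<le> \<bar>\<tau>\<bar> * (1 / a)" using x by (simp add: frac_le)
    moreover have "x \<le> b" using x by simp
    moreover have "(1 + \<bar>\<tau>\<bar>) * (1 / a + b) = \<bar>\<tau>\<bar> * (1 / a) + b + (1 / a + \<bar>\<tau>\<bar> * b)" by (simp add: algebra_simps)
    moreover have "0 \<le> 1 / a + \<bar>\<tau>\<bar> * b" using x by (intro add_nonneg_nonneg mult_nonneg_nonneg) auto
    ultimately have "\<bar>\<tau>\<bar> / x + x \<le> (1 + \<bar>\<tau>\<bar>) * (1 / a + b)" by linarith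
    hence "(\<bar>\<tau>\<bar> / x + x) * (R * exp b) \<le> (1 + \<bar>\<tau>\<bar>) * (1 / a + b) * (R * exp b)"
      by (rule mult_right_mono) (simp add: R_def)
    thus ?thesis by (simp add: distrib_right)
  qed
  finally have S: "norm (2 * ?\<mu> / of_real x * bessel_clifford ?\<mu> (of_real (x\<^sup>2 / 4)) + of_real x * bessel_clifford (?\<mu> + 1) (of_real (x\<^sup>2 / 4)))
      \<le> (1 + \<bar>\<tau>\<bar>) * (1 / a + b) * (R * exp b)" .
  have "norm (exp (2 * ?\<mu> * of_real (ln (x / 2)))) = 1" by simp
  hence "norm (bessel_I_square_deriv ?\<mu> x) = norm (bessel_clifford ?\<mu> (of_real (x\<^sup>2 / 4))) *
      norm (2 * ?\<mu> / of_real x * bessel_clifford ?\<mu> (of_real (x\<^sup>2 / 4)) + of_real x * bessel_clifford (?\<mu> + 1) (of_real (x\<^sup>2 / 4)))"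
    by (simp only: bessel_I_square_deriv_def norm_mult mult_1)
  also have "\<dots> \<le> (R * exp b) * ((1 + \<bar>\<tau>\<bar>) * (1 / a + b) * (R * exp b))"
    by (rule mult_mono[OF C1 S]) (auto simp: R_def)
  also have "\<dots> = (1 + \<bar>\<tau>\<bar>) * R\<^sup>2 * ((1 / a + b) * (exp b)\<^sup>2)"
    by (simp add: power2_eq_square mult_ac)
  also have "(1 + \<bar>\<tau>\<bar>) * R\<^sup>2 \<le> exp (pi * \<bar>\<tau>\<bar> / 2) * exp (pi * \<bar>\<tau>\<bar> / 2)"
  proof (rule mult_mono[OF _ R2])
    have "1 + pi * \<bar>\<tau>\<bar> / 2 \<le> exp (pi * \<bar>\<tau>\<bar> / 2)" by (rule exp_ge_add_one_self)
    moreover have "2 * \<bar>\<tau>\<bar> \<le> pi * \<bar>\<tau>\<bar>" using pi_ge_two by (intro mult_right_mono) auto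
    ultimately show "1 + \<bar>\<tau>\<bar> \<le> exp (pi * \<bar>\<tau>\<bar> / 2)" by linarith
  qed auto
  also have "exp (pi * \<bar>\<tau>\<bar> / 2) * exp (pi * \<bar>\<tau>\<bar> / 2) = exp (pi * \<bar>\<tau>\<bar>)" by (simp flip: exp_add)
  finally show ?thesis using x by (simp add: mult_ac add_nonneg_nonneg mult_right_mono)
qed

locale index_transform_integrable = half_line_function +
  assumes index_int: "integrable lborel (\<lambda>\<tau>. of_real (\<tau> * exp (pi * \<bar>\<tau>\<bar>)) * index_fourier \<tau>)"
begin

lemma index_fourier_int: "integrable lborel index_fourier"
proof (rule Bochner_Integration.integrable_bound)
  let ?B = "\<integral>t. norm (meijer t) \<partial>lborel"
  have "integrable lborel (\<lambda>\<tau>::real. indicator {-1..1} \<tau> *\<^sub>R ?B)"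
    by (rule borel_integrable_compact[of "{-1..1::real}" "\<lambda>_. ?B"]) auto
  thus "integrable lborel (\<lambda>\<tau>. indicator {-1..1} \<tau> *\<^sub>R ?B + norm (of_real (\<tau> * exp (pi * \<bar>\<tau>\<bar>)) * index_fourier \<tau>))"
    using integrable_norm[OF index_int] by (rule Bochner_Integration.integrable_add)
  show "AE \<tau> in lborel. norm (index_fourier \<tau>)
      \<le> norm (indicator {-1..1} \<tau> *\<^sub>R ?B + norm (of_real (\<tau> * exp (pi * \<bar>\<tau>\<bar>)) * index_fourier \<tau>))"
  proof (rule AE_I2)
    fix \<tau> :: real
    have B: "?B \<ge> 0" by simp
    show "norm (index_fourier \<tau>)
      \<le> norm (indicator {-1..1} \<tau> *\<^sub>R ?B + norm (of_real (\<tau> * exp (pi * \<bar>\<tau>\<bar>)) * index_fourier \<tau>))"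
    proof (cases "\<tau> \<in> {-1..1}")
      case True
      thus ?thesis using index_fourier_bounded[of \<tau>] B by (simp add: add_increasing2)
    next
      case False
      hence "1 \<le> \<bar>\<tau>\<bar>" by auto
      hence "1 * 1 \<le> \<bar>\<tau>\<bar> * exp (pi * \<bar>\<tau>\<bar>)" by (intro mult_mono) auto
      hence "1 * norm (index_fourier \<tau>) \<le> (\<bar>\<tau>\<bar> * exp (pi * \<bar>\<tau>\<bar>)) * norm (index_fourier \<tau>)" by (intro mult_right_mono) auto
      thus ?thesis using False by (simp add: norm_mult abs_mult)
    qed
  qed
qed measurable

lemma tau_index_int: "integrable lborel (\<lambda>\<tau>. of_real \<tau> * index_fourier \<tau>)"
proof (rule Bochner_Integration.integrable_bound[OF index_int])
  show "AE \<tau> in lborel. norm (of_real \<tau> * index_fourier \<tau>) \<le> norm (of_real (\<tau> * exp (pi * \<bar>\<tau>\<bar>)) * index_fourier \<tau>)"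
  proof (rule AE_I2)
    fix \<tau> :: real
    have "\<bar>\<tau>\<bar> * 1 \<le> \<bar>\<tau>\<bar> * exp (pi * \<bar>\<tau>\<bar>)" by (intro mult_left_mono) auto
    hence "(\<bar>\<tau>\<bar> * 1) * norm (index_fourier \<tau>) \<le> (\<bar>\<tau>\<bar> * exp (pi * \<bar>\<tau>\<bar>)) * norm (index_fourier \<tau>)" by (intro mult_right_mono) auto
    thus "norm (of_real \<tau> * index_fourier \<tau>) \<le> norm (of_real (\<tau> * exp (pi * \<bar>\<tau>\<bar>)) * index_fourier \<tau>)"
      by (simp add: norm_mult abs_mult)
  qed
qed measurable

lemma meijer_eq: "(LBINT \<tau>. index_fourier \<tau> * exp (- \<i> * of_real (\<tau> * t))) = 2 * of_real pi * meijer t"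
  by (rule fourier_inversion[OF meijer_cont meijer_int meijer_bounded index_fourier_def index_fourier_int])

abbreviation laplace_gauss :: "real \<Rightarrow> complex" where
  "laplace_gauss l \<equiv> (LBINT r. of_real (exp r * exp (- (l * exp r))) * gauss r)"

lemma has_vector_derivative_laplace_gauss:
  assumes l: "l > 2"
  shows "((\<lambda>l. LBINT r. of_real (exp (- (l * exp r))) * gauss r) has_vector_derivative
           (- laplace_gauss l)) (at l)"
    and "integrable lborel (\<lambda>r. of_real (exp r * exp (- (l * exp r))) * gauss r)"
proof -
  have l': "l \<in> {2<..<l + 1}" using l by simp
  have der: "((\<lambda>l. of_real (exp (- (l * exp r))) * gauss r) has_vector_derivative
      (- (of_real (exp r * exp (- (y * exp r))) * gauss r))) (at y)" for y r
  proof -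
    have "((\<lambda>l. exp (- (l * exp r))) has_real_derivative - (exp r * exp (- (y * exp r)))) (at y)"
      by (auto intro!: derivative_eq_intros)
    hence "((\<lambda>l. exp (- (l * exp r)) *\<^sub>R gauss r) has_vector_derivative (- (exp r * exp (- (y * exp r)))) *\<^sub>R gauss r) (at y)"
      by (intro has_vector_derivative_scaleR[where g = "\<lambda>_. gauss r" and g' = 0, simplified] has_vector_derivative_const)
    thus ?thesis by (simp add: scaleR_conv_of_real)
  qed
  have bound: "norm (- (of_real (exp r * exp (- (y * exp r))) * gauss r)) \<le> weight_norm * kernel_majorant r"
    if "y \<in> {2<..<l + 1}" for y r
  proof -
    have "exp r * exp (- (y * exp r)) \<le> exp (- ((y - 1) * exp r))"
    proof -
      have "r \<le> exp r" using exp_ge_add_one_self[of r] by linarith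
      hence "exp r \<le> exp (exp r)" by simp
      hence "exp r * exp (- (y * exp r)) \<le> exp (exp r) * exp (- (y * exp r))" by (intro mult_right_mono) auto
      thus ?thesis by (simp add: algebra_simps flip: exp_add)
    qed
    hence "exp r * exp (- (y * exp r)) * norm (gauss r) \<le> exp (- ((y - 1) * exp r)) * norm (gauss r)"
      by (intro mult_right_mono) auto
    also have "\<dots> \<le> weight_norm * kernel_majorant r" using that by (intro norm_gauss_le) auto
    finally show ?thesis by (simp add: norm_mult)
  qed
  have int: "integrable lborel (\<lambda>r. of_real (exp (- (y * exp r))) * gauss r)" if "y \<in> {2<..<l + 1}" for y
    using that by (intro meijer_integrand_int) auto
  have wk: "integrable lborel (\<lambda>r. weight_norm * kernel_majorant r)"
    by (intro integrable_mult_right kernel_majorant_int)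
  have meas: "(\<lambda>r. - (of_real (exp r * exp (- (l * exp r))) * gauss r)) \<in> borel_measurable lborel" by measurable
  note D = has_vector_derivative_integral_dominated[where f = "\<lambda>y r. of_real (exp (- (y * exp r))) * gauss r"
      and f' = "\<lambda>y r. - (of_real (exp r * exp (- (y * exp r))) * gauss r)", OF l' int der bound wk meas]
  show "((\<lambda>l. LBINT r. of_real (exp (- (l * exp r))) * gauss r) has_vector_derivative
           (- laplace_gauss l)) (at l)"
    using D(2) by simp
  show "integrable lborel (\<lambda>r. of_real (exp r * exp (- (l * exp r))) * gauss r)"
    using D(1) by simp
qed

text \<open>Here \<open>meijer_eq\<close> is differentiated; \<open>meijer w\<close> is a function of \<open>cosh\<^sup>2 w\<close>,
whose derivative is \<open>2 cosh w sinh w\<close>.\<close>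

lemma tau_fourier_eq:
  assumes w: "w \<ge> 2"
  shows "(LBINT \<tau>. of_real \<tau> * index_fourier \<tau> * exp (- \<i> * of_real (\<tau> * w)))
    = - 2 * of_real pi * \<i> * of_real (cosh w * sinh w) * laplace_gauss ((cosh w)\<^sup>2)"
proof -
  let ?L = "\<lambda>l. \<integral>r. of_real (exp (- (l * exp r))) * gauss r \<partial>lborel"
  let ?D = "laplace_gauss ((cosh w)\<^sup>2)"
  note c2 = two_less_cosh_square[OF w]
  have "((\<lambda>y. (cosh y)\<^sup>2) has_real_derivative 2 * cosh w * sinh w) (at w)"
    by (auto intro!: derivative_eq_intros)
  hence "((\<lambda>y. ?L ((cosh y)\<^sup>2)) has_vector_derivative (2 * cosh w * sinh w) *\<^sub>R (- ?D)) (at w)"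
    using vector_diff_chain_at[of "\<lambda>y. (cosh y)\<^sup>2" "2 * cosh w * sinh w" w ?L "- ?D"]
      has_vector_derivative_laplace_gauss(1)[OF c2]
    by (simp add: o_def has_real_derivative_iff_has_vector_derivative)
  hence "((\<lambda>y. of_real pi * ?L ((cosh y)\<^sup>2)) has_vector_derivative of_real pi * ((2 * cosh w * sinh w) *\<^sub>R (- ?D))) (at w)"
    by (intro has_vector_derivative_mult_right)
  also have "(\<lambda>y. of_real pi * ?L ((cosh y)\<^sup>2)) = (\<lambda>y. LBINT \<tau>. index_fourier \<tau> * exp (- \<i> * of_real (\<tau> * y)))"
    unfolding meijer_eq meijer_def by (simp add: fun_eq_iff)
  finally have D1: "((\<lambda>y. LBINT \<tau>. index_fourier \<tau> * exp (- \<i> * of_real (\<tau> * y))) has_vector_derivative of_real pi * ((2 * cosh w * sinh w) *\<^sub>R (- ?D))) (at w)" .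
  have D2: "((\<lambda>y. LBINT \<tau>. index_fourier \<tau> * exp (- \<i> * of_real (\<tau> * y))) has_vector_derivative
     (LBINT \<tau>. - \<i> * (of_real \<tau> * index_fourier \<tau> * exp (- \<i> * of_real (\<tau> * w))))) (at w)"
  proof (rule has_vector_derivative_integral_dominated(2)[where a = "w - 1" and b = "w + 1" and h = "\<lambda>\<tau>. norm (of_real \<tau> * index_fourier \<tau>)"
          and f' = "\<lambda>y \<tau>. - \<i> * (of_real \<tau> * index_fourier \<tau> * exp (- \<i> * of_real (\<tau> * y)))"])
    show "integrable lborel (\<lambda>\<tau>. index_fourier \<tau> * exp (- \<i> * of_real (\<tau> * y)))" for y
      by (rule Bochner_Integration.integrable_bound[OF index_fourier_int]) (auto simp: norm_mult)
    show "((\<lambda>y. index_fourier \<tau> * exp (- \<i> * of_real (\<tau> * y))) has_vector_derivative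
         - \<i> * (of_real \<tau> * index_fourier \<tau> * exp (- \<i> * of_real (\<tau> * y)))) (at y)" for y \<tau>
    proof -
      have "((\<lambda>z. index_fourier \<tau> * exp (- \<i> * (of_real \<tau> * z))) has_field_derivative
         - \<i> * (of_real \<tau> * index_fourier \<tau> * exp (- \<i> * (of_real \<tau> * of_real y)))) (at (of_real y))"
        by (auto intro!: derivative_eq_intros)
      from has_vector_derivative_real_field[OF this] show ?thesis by simp
    qed
    show "integrable lborel (\<lambda>\<tau>. norm (of_real \<tau> * index_fourier \<tau>))" using tau_index_int by simp
  qed (auto simp: norm_mult)
  have "(LBINT \<tau>. - \<i> * (of_real \<tau> * index_fourier \<tau> * exp (- \<i> * of_real (\<tau> * w)))) = of_real pi * ((2 * cosh w * sinh w) *\<^sub>R (- ?D))"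
    by (rule vector_derivative_unique_at[OF D2 D1])
  hence "- \<i> * (LBINT \<tau>. of_real \<tau> * index_fourier \<tau> * exp (- \<i> * of_real (\<tau> * w))) = of_real pi * ((2 * cosh w * sinh w) *\<^sub>R (- ?D))"
    by (simp only: integral_mult_right_zero)
  hence "\<i> * (- \<i> * (LBINT \<tau>. of_real \<tau> * index_fourier \<tau> * exp (- \<i> * of_real (\<tau> * w)))) = \<i> * (of_real pi * ((2 * cosh w * sinh w) *\<^sub>R (- ?D)))"
    by (simp only:)
  thus ?thesis by (simp add: scaleR_conv_of_real mult_ac)
qed

end

section \<open>The inverse index transform\<close>

context index_transform_integrable
begin

definition primitive :: "real \<Rightarrow> complex" where
  "primitive x = (LBINT y. indicator {..x} y *\<^sub>R f y)"

abbreviation index_integrand :: "real \<Rightarrow> real \<Rightarrow> complex" where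
  "index_integrand x \<tau> \<equiv> of_real \<tau> * index_fourier \<tau> * (bessel_I (\<i> * of_real \<tau> / 2) (of_real x))\<^sup>2"

abbreviation deriv_integrand :: "real \<Rightarrow> real \<Rightarrow> complex" where
  "deriv_integrand x \<tau> \<equiv> of_real \<tau> * index_fourier \<tau> * bessel_I_square_deriv (\<i> * of_real \<tau> / 2) x"

text \<open>A primitive of the inversion integral in the theorem, up to the factor \<open>i/(2\<pi>)\<close>.\<close>

definition index_inverse :: "real \<Rightarrow> complex" where
  "index_inverse x = (LBINT \<tau>. index_integrand x \<tau>)"

definition index_majorant :: "real \<Rightarrow> real" where
  "index_majorant \<tau> = norm (of_real (\<tau> * exp (pi * \<bar>\<tau>\<bar>)) * index_fourier \<tau>)"

lemma index_majorant_int: "integrable lborel index_majorant"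
  unfolding index_majorant_def using index_int by (rule integrable_norm)

lemma norm_index_integrand_le:
  "norm (index_integrand (exp \<xi>) \<tau>)
     \<le> index_majorant \<tau> * (exp (exp \<xi>))\<^sup>2"
proof -
  have "norm (index_integrand (exp \<xi>) \<tau>)
     \<le> norm (of_real \<tau> * index_fourier \<tau>) * (exp (pi * \<bar>\<tau>\<bar>) * (exp (exp \<xi>))\<^sup>2)"
    unfolding norm_mult[of "of_real \<tau> * index_fourier \<tau>"]
    by (intro mult_left_mono norm_bessel_I_imaginary_square_le) auto
  also have "\<dots> = index_majorant \<tau> * (exp (exp \<xi>))\<^sup>2"
    by (simp add: index_majorant_def norm_mult mult_ac)
  finally show ?thesis .
qed

lemma index_integrand_int:
  "integrable lborel (\<lambda>\<tau>. index_integrand (exp \<xi>) \<tau>)"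
  by (rule Bochner_Integration.integrable_bound[OF integrable_mult_left[OF index_majorant_int, of "(exp (exp \<xi>))\<^sup>2"]])
     (use norm_index_integrand_le in \<open>auto intro!: AE_I2 order_trans[OF _ abs_ge_self]\<close>)

lemma norm_index_inverse_le:
  "norm (index_inverse (exp \<xi>)) \<le> (LBINT \<tau>. index_majorant \<tau>) * (exp (exp \<xi>))\<^sup>2"
proof -
  have "norm (index_inverse (exp \<xi>)) \<le> (LBINT \<tau>. index_majorant \<tau> * (exp (exp \<xi>))\<^sup>2)"
    unfolding index_inverse_def
    by (intro Bochner_Integration.integral_norm_bound_integral index_integrand_int
          integrable_mult_left index_majorant_int norm_index_integrand_le)
  thus ?thesis by simp
qed

lemma has_vector_derivative_index_inverse:
  assumes x: "x > 0"
  shows "integrable lborel (\<lambda>\<tau>. deriv_integrand x \<tau>)"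
    and "(index_inverse has_vector_derivative
           (LBINT \<tau>. deriv_integrand x \<tau>)) (at x)"
proof -
  let ?a = "x / 2" and ?b = "x + 1"
  let ?C = "(1 / ?a + ?b) * (exp ?b)\<^sup>2"
  have x': "x \<in> {?a<..<?b}" using x by simp
  have int: "integrable lborel (\<lambda>\<tau>. index_integrand y \<tau>)"
    if "y \<in> {?a<..<?b}" for y
    using index_integrand_int[of "ln y"] that x by simp
  have der: "((\<lambda>y. index_integrand y \<tau>) has_vector_derivative
      deriv_integrand y \<tau>) (at y)" if "y \<in> {?a<..<?b}" for y \<tau>
    using that x by (intro has_vector_derivative_mult_right has_vector_derivative_bessel_I_square) auto
  have bound: "norm (deriv_integrand y \<tau>) \<le> ?C * index_majorant \<tau>"
    if y: "y \<in> {?a<..<?b}" for y \<tau>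
  proof -
    have "norm (bessel_I_square_deriv (\<i> * of_real \<tau> / 2) y) \<le> ?C * exp (pi * \<bar>\<tau>\<bar>)"
      using x y by (intro norm_bessel_I_square_deriv_le) auto
    hence "norm (of_real \<tau> * index_fourier \<tau>) * norm (bessel_I_square_deriv (\<i> * of_real \<tau> / 2) y)
        \<le> norm (of_real \<tau> * index_fourier \<tau>) * (?C * exp (pi * \<bar>\<tau>\<bar>))"
      by (intro mult_left_mono) auto
    also have "\<dots> = ?C * index_majorant \<tau>"
      unfolding index_majorant_def norm_mult of_real_mult by (simp add: mult_ac)
    finally show ?thesis by (simp only: norm_mult)
  qed
  have C: "integrable lborel (\<lambda>\<tau>. ?C * index_majorant \<tau>)"
    by (intro integrable_mult_right index_majorant_int)
  have meas: "(\<lambda>\<tau>. deriv_integrand x \<tau>) \<in> borel_measurable lborel"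
    unfolding bessel_I_square_deriv_def by measurable
  note D = has_vector_derivative_integral_dominated[where f = "\<lambda>y \<tau>. index_integrand y \<tau>"
     and f' = "\<lambda>y \<tau>. deriv_integrand y \<tau>", OF x' int der bound C meas]
  show "integrable lborel (\<lambda>\<tau>. deriv_integrand x \<tau>)" by (rule D(1))
  show "(index_inverse has_vector_derivative
           (LBINT \<tau>. deriv_integrand x \<tau>)) (at x)"
    unfolding index_inverse_def[abs_def] by (rule D(2))
qed

lemma index_inverse_exp_cont: "continuous_on UNIV (\<lambda>\<xi>. index_inverse (exp \<xi>))"
proof (rule continuous_on_compose2[where g = index_inverse and t = "{0<..}"])
  show "continuous_on {0<..} index_inverse"
    using has_vector_derivative_index_inverse(2)
    by (intro continuous_at_imp_continuous_on) (auto intro: has_vector_derivative_continuous)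
qed (auto intro!: continuous_intros)

lemma index_inverse_exp_meas [measurable]: "(\<lambda>\<xi>. index_inverse (exp \<xi>)) \<in> borel_measurable borel"
  by (rule borel_measurable_continuous_onI[OF index_inverse_exp_cont])

text \<open>The counterpart of \<open>gauss\<close> for the function \<open>x T(x)\<close>, where \<open>T\<close> is
\<open>index_inverse\<close>: the integral of \<open>x exp(-x\<^sup>2 e\<^bsup>-r\<^esup>) T(x)\<close> over the half line.\<close>

definition gauss_inverse :: "real \<Rightarrow> complex" where
  "gauss_inverse r = (LBINT \<xi>. of_real (exp (2 * \<xi> - exp (2 * \<xi> - r))) * index_inverse (exp \<xi>))"

lemma gauss_weight_int:
  fixes c :: real
  assumes "c > 0"
  shows "has_bochner_integral lborel (\<lambda>\<xi>. exp (2 * \<xi> - c * exp (2 * \<xi>))) (1 / (2 * c))"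
  using has_bochner_integral_affine[OF Gamma_integral_exp_real[of 1 c], of 2 0] assms
  by (simp add: exp_minus inverse_eq_divide mult.commute)

text \<open>The growth \<open>exp(2e\<^bsup>\<xi>\<^esup>)\<close> of \<open>index_inverse\<close> is absorbed by half of the Gaussian
exponent; the bound is uniform for \<open>r \<le> b\<close>.\<close>

lemma gauss_inverse_dominated:
  assumes "r \<le> b"
  shows "norm (of_real (exp (2 * \<xi> - exp (2 * \<xi> - r))) * index_inverse (exp \<xi>))
    \<le> (LBINT \<tau>. index_majorant \<tau>) * exp (2 * exp b) * exp (2 * \<xi> - (exp (- b) / 2) * exp (2 * \<xi>))"
proof -
  define A B where "A = exp (b / 2)" and "B = exp (\<xi> - b / 2)"
  have "A * A = exp b" "B * B = exp (- b) * exp (2 * \<xi>)" "A * B = exp \<xi>"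
    by (simp_all add: A_def B_def flip: exp_add)
  moreover have "0 \<le> (2 * A - B) * (2 * A - B)" by simp
  ultimately have 1: "2 * exp \<xi> \<le> 2 * exp b + exp (- b) * exp (2 * \<xi>) / 2" by (simp add: algebra_simps)
  have 2: "exp (- b) * exp (2 * \<xi>) \<le> exp (2 * \<xi> - r)" using assms by (simp flip: exp_add)
  have "exp (2 * \<xi> - exp (2 * \<xi> - r)) * (exp (exp \<xi>))\<^sup>2 \<le> exp (2 * exp b) * exp (2 * \<xi> - (exp (- b) / 2) * exp (2 * \<xi>))"
  proof -
    have "(2 * \<xi> - exp (2 * \<xi> - r)) + (exp \<xi> + exp \<xi>) \<le> 2 * exp b + (2 * \<xi> - (exp (- b) / 2) * exp (2 * \<xi>))"
      using 1 2 by linarith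
    hence "exp ((2 * \<xi> - exp (2 * \<xi> - r)) + (exp \<xi> + exp \<xi>)) \<le> exp (2 * exp b + (2 * \<xi> - (exp (- b) / 2) * exp (2 * \<xi>)))"
      by (simp only: exp_le_cancel_iff)
    thus ?thesis by (simp only: exp_add power2_eq_square)
  qed
  hence "(LBINT \<tau>. index_majorant \<tau>) * (exp (2 * \<xi> - exp (2 * \<xi> - r)) * (exp (exp \<xi>))\<^sup>2)
     \<le> (LBINT \<tau>. index_majorant \<tau>) * (exp (2 * exp b) * exp (2 * \<xi> - (exp (- b) / 2) * exp (2 * \<xi>)))"
    by (intro mult_left_mono Bochner_Integration.integral_nonneg) (auto simp: index_majorant_def)
  moreover have "norm (of_real (exp (2 * \<xi> - exp (2 * \<xi> - r))) * index_inverse (exp \<xi>))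
      \<le> exp (2 * \<xi> - exp (2 * \<xi> - r)) * ((LBINT \<tau>. index_majorant \<tau>) * (exp (exp \<xi>))\<^sup>2)"
    unfolding norm_mult using norm_index_inverse_le by (intro mult_mono) auto
  ultimately show ?thesis by (simp add: mult_ac)
qed

lemma gauss_inverse_majorant_int:
  "integrable lborel (\<lambda>\<xi>. (LBINT \<tau>. index_majorant \<tau>) * exp (2 * exp b) * exp (2 * \<xi> - (exp (- b) / 2) * exp (2 * \<xi>)))"
  using gauss_weight_int[of "exp (- b) / 2"] by (intro integrable_mult_right) (auto simp: has_bochner_integral_iff)

lemma gauss_inverse_integrand_int:
  "integrable lborel (\<lambda>\<xi>. of_real (exp (2 * \<xi> - exp (2 * \<xi> - r))) * index_inverse (exp \<xi>))"
  by (rule Bochner_Integration.integrable_bound[OF gauss_inverse_majorant_int[of r]])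
     (use gauss_inverse_dominated[of r r] in \<open>auto intro!: AE_I2 order_trans[OF _ abs_ge_self]\<close>)

lemma gauss_inverse_cont: "continuous_on UNIV gauss_inverse"
proof -
  have *: "continuous_on {..b} gauss_inverse" for b
    unfolding gauss_inverse_def
  proof (rule continuous_on_integral_dominated[where h = "\<lambda>\<xi>. (LBINT \<tau>. index_majorant \<tau>) * exp (2 * exp b) * exp (2 * \<xi> - (exp (- b) / 2) * exp (2 * \<xi>))"])
    show "integrable lborel (\<lambda>\<xi>. (LBINT \<tau>. index_majorant \<tau>) * exp (2 * exp b) * exp (2 * \<xi> - (exp (- b) / 2) * exp (2 * \<xi>)))"
      by (rule gauss_inverse_majorant_int)
  qed (use gauss_inverse_dominated in \<open>auto intro!: continuous_intros\<close>)
  have "isCont gauss_inverse x" for x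
    using *[of "x + 1"] by (rule continuous_on_interior) (simp add: interior_Iic[of _ "x + 2"])
  thus ?thesis by (intro continuous_at_imp_continuous_on) auto
qed

text \<open>The integral over \<open>(r, \<xi>)\<close> of the kernel times \<open>index_inverse\<close> is computed in two ways.
Integration over \<open>(r, \<xi>)\<close> before \<open>\<tau>\<close> gives the Fourier integral of
\<open>tau_fourier_eq\<close>; integration over \<open>\<xi>\<close> before \<open>r\<close> gives the left side.\<close>

lemma K0_transform_index_inverse:
  assumes w: "w \<ge> 2"
  shows "integrable lborel (\<lambda>r. of_real (exp (- ((cosh w)\<^sup>2 * exp r))) * gauss_inverse r)"
    and "(LBINT r. of_real (exp (- ((cosh w)\<^sup>2 * exp r))) * gauss_inverse r)
      = - of_real pi * \<i> * laplace_gauss ((cosh w)\<^sup>2)"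
proof -
  note c2 = two_less_cosh_square[OF w]
  have sw: "sinh w > 0" using w by simp
  define P where "P = (\<lambda>(r, \<xi>). exp (2 * \<xi> - ((cosh w)\<^sup>2 * exp r + exp (2 * \<xi> - r))))"
  define h where "h \<tau> = (\<lambda>(r, \<xi>). of_real \<tau> * index_fourier \<tau> * (of_real (P (r, \<xi>)) * (bessel_I (\<i> * of_real \<tau> / 2) (of_real (exp \<xi>)))\<^sup>2))" for \<tau> :: real
  have [measurable]: "P \<in> borel_measurable (borel \<Otimes>\<^sub>M borel)" unfolding P_def by measurable
  have T: "integrable (lborel \<Otimes>\<^sub>M (lborel :: (real \<times> real) measure)) (case_prod h)"
  proof (rule Fubini_product_bound[where a = index_majorant and b = "\<lambda>(r, \<xi>). P (r, \<xi>) * (exp (exp \<xi>))\<^sup>2"])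
    show "case_prod h \<in> borel_measurable (lborel \<Otimes>\<^sub>M (lborel :: (real \<times> real) measure))"
      unfolding h_def lborel_prod[symmetric] by measurable
    show "integrable (lborel :: (real \<times> real) measure) (\<lambda>(r, \<xi>). P (r, \<xi>) * (exp (exp \<xi>))\<^sup>2)"
      unfolding P_def using K0_majorant[OF c2] by simp
    show "norm (case_prod h (\<tau>, p)) \<le> index_majorant \<tau> * (case p of (r, \<xi>) \<Rightarrow> P (r, \<xi>) * (exp (exp \<xi>))\<^sup>2)" for \<tau> p
    proof -
      obtain r \<xi> where p: "p = (r, \<xi>)" by (cases p)
      have Pn: "P (r, \<xi>) \<ge> 0" by (simp add: P_def)
      have "norm (case_prod h (\<tau>, p)) = P (r, \<xi>) * norm (index_integrand (exp \<xi>) \<tau>)"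
        using Pn by (simp add: h_def p norm_mult mult_ac)
      also have "\<dots> \<le> P (r, \<xi>) * (index_majorant \<tau> * (exp (exp \<xi>))\<^sup>2)"
        using Pn norm_index_integrand_le by (intro mult_left_mono) auto
      finally show ?thesis by (simp add: p mult_ac)
    qed
  qed (auto simp: sigma_finite_lborel index_majorant_int)
  have inner1: "(LBINT p. h \<tau> p) = of_real \<tau> * index_fourier \<tau> * exp (- \<i> * of_real (\<tau> * w)) / of_real (2 * sinh w * cosh w)" for \<tau>
  proof -
    have e: "- (2 * (\<i> * complex_of_real \<tau> / 2)) * of_real w = - \<i> * of_real (\<tau> * w)" by simp
    have "(LBINT p. h \<tau> p) = of_real \<tau> * index_fourier \<tau> * (exp (- (2 * (\<i> * complex_of_real \<tau> / 2)) * of_real w) / of_real (2 * sinh w * cosh w))"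
      using has_bochner_integral_integral_eq[OF K0_transform_bessel_I_square[of "\<i> * of_real \<tau> / 2" w]] w
      unfolding h_def P_def by (simp add: case_prod_unfold)
    thus ?thesis unfolding e by simp
  qed
  have inner2: "(LBINT \<tau>. h \<tau> (r, \<xi>)) = of_real (exp (- ((cosh w)\<^sup>2 * exp r))) * (of_real (exp (2 * \<xi> - exp (2 * \<xi> - r))) * index_inverse (exp \<xi>))" for r \<xi>
  proof -
    have "P (r, \<xi>) = exp (- ((cosh w)\<^sup>2 * exp r)) * exp (2 * \<xi> - exp (2 * \<xi> - r))"
      unfolding P_def prod.case exp_add[symmetric] by simp
    hence "h \<tau> (r, \<xi>) = of_real (exp (- ((cosh w)\<^sup>2 * exp r)) * exp (2 * \<xi> - exp (2 * \<xi> - r))) *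
         (index_integrand (exp \<xi>) \<tau>)" for \<tau>
      unfolding h_def prod.case by (simp only: mult_ac)
    thus ?thesis by (simp only: integral_mult_right_zero index_inverse_def of_real_mult mult.assoc)
  qed
  have swap: "(LBINT p. (LBINT \<tau>. h \<tau> p)) = (LBINT \<tau>. (LBINT p. h \<tau> p))"
    using lborel_pair.integral_snd[OF T] lborel_pair.integral_fst[OF T] by simp
  define q where "q = (\<lambda>(r, \<xi>). of_real (exp (- ((cosh w)\<^sup>2 * exp r))) * (of_real (exp (2 * \<xi> - exp (2 * \<xi> - r))) * index_inverse (exp \<xi>)))"
  have hq: "(LBINT \<tau>. h \<tau> p) = q p" for p
    by (cases p) (simp add: q_def inner2)
  have q: "integrable (lborel \<Otimes>\<^sub>M lborel) q"
    using lborel_pair.integrable_snd[OF T] unfolding hq lborel_prod .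
  have qg: "(LBINT \<xi>. q (r, \<xi>)) = of_real (exp (- ((cosh w)\<^sup>2 * exp r))) * gauss_inverse r" for r
    unfolding q_def prod.case gauss_inverse_def by (rule integral_mult_right_zero)
  show "integrable lborel (\<lambda>r. of_real (exp (- ((cosh w)\<^sup>2 * exp r))) * gauss_inverse r)"
    using lborel_pair.integrable_fst'[OF q] by (simp only: qg)
  have "(LBINT r. of_real (exp (- ((cosh w)\<^sup>2 * exp r))) * gauss_inverse r) = (LBINT p. q p)"
    using lborel_pair.integral_fst'[OF q] by (simp only: qg lborel_prod)
  also have "\<dots> = (LBINT \<tau>. of_real \<tau> * index_fourier \<tau> * exp (- \<i> * of_real (\<tau> * w))) / of_real (2 * sinh w * cosh w)"
    using swap unfolding hq inner1 integral_divide_zero .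
  also have "\<dots> = - of_real pi * \<i> * laplace_gauss ((cosh w)\<^sup>2)"
    unfolding tau_fourier_eq[OF w] using sw two_less_cosh[OF w] by simp
  finally show "(LBINT r. of_real (exp (- ((cosh w)\<^sup>2 * exp r))) * gauss_inverse r)
      = - of_real pi * \<i> * laplace_gauss ((cosh w)\<^sup>2)" .
qed

text \<open>Uniqueness of the Laplace transform in \<open>e\<^sup>r\<close>, known at the points \<open>cosh\<^sup>2 w\<close> with
\<open>w \<ge> 2\<close>, that is, on the half line from \<open>cosh\<^sup>2 2\<close> on.\<close>

lemma gauss_inverse_eq: "gauss_inverse r = - of_real pi * \<i> * (of_real (exp r) * gauss r)"
proof -
  define \<phi> where "\<phi> r = gauss_inverse r + of_real pi * \<i> * (of_real (exp r) * gauss r)" for r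
  define l where "l = (cosh (2::real))\<^sup>2"
  have "\<phi> r = 0"
  proof (rule laplace_unique[where E = exp and l = l and \<phi> = \<phi>])
    show "strict_mono (exp :: real \<Rightarrow> real)" by (simp add: strict_mono_def)
    show "continuous_on UNIV \<phi>" unfolding \<phi>_def by (intro continuous_intros gauss_inverse_cont gauss_cont)
    have L0: "has_bochner_integral lborel (\<lambda>r. of_real (exp (- (l + real n) * exp r)) * \<phi> r) 0" for n
    proof -
      define w where "w = arcosh (sqrt (l + real n))"
      have l1: "l \<ge> 1" unfolding l_def by (rule cosh_square_ge_1)
      hence s1: "sqrt (l + real n) \<ge> 1" by simp
      hence cw: "cosh w = sqrt (l + real n)" and w0: "w \<ge> 0" by (auto simp: w_def cosh_arcosh_real)
      have cw2: "(cosh w)\<^sup>2 = l + real n" using l1 by (simp add: cw)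
      have w: "w \<ge> 2"
      proof -
        have "(cosh 2)\<^sup>2 \<le> (cosh w)\<^sup>2" by (simp add: cw2 l_def)
        hence "cosh 2 \<le> cosh w" by (rule power2_le_imp_le) simp
        thus ?thesis using w0 by (simp add: cosh_real_nonneg_le_iff)
      qed
      note c2 = two_less_cosh_square[OF w]
      have 1: "has_bochner_integral lborel (\<lambda>r. of_real (exp (- ((cosh w)\<^sup>2 * exp r))) * gauss_inverse r)
          (- of_real pi * \<i> * laplace_gauss ((cosh w)\<^sup>2))"
        using K0_transform_index_inverse[OF w] by (simp add: has_bochner_integral_iff)
      have 2: "has_bochner_integral lborel (\<lambda>r. of_real pi * \<i> * (of_real (exp r * exp (- ((cosh w)\<^sup>2 * exp r))) * gauss r))
          (of_real pi * \<i> * laplace_gauss ((cosh w)\<^sup>2))"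
        by (intro has_bochner_integral_mult_right has_bochner_integral_integrable has_vector_derivative_laplace_gauss(2) c2)
      have "has_bochner_integral lborel (\<lambda>r. of_real (exp (- ((cosh w)\<^sup>2 * exp r))) * gauss_inverse r
           + of_real pi * \<i> * (of_real (exp r * exp (- ((cosh w)\<^sup>2 * exp r))) * gauss r)) 0"
        using has_bochner_integral_add[OF 1 2] by simp
      also have "(\<lambda>r. of_real (exp (- ((cosh w)\<^sup>2 * exp r))) * gauss_inverse r
           + of_real pi * \<i> * (of_real (exp r * exp (- ((cosh w)\<^sup>2 * exp r))) * gauss r)) = (\<lambda>r. of_real (exp (- (l + real n) * exp r)) * \<phi> r)"
        unfolding cw2 minus_mult_left \<phi>_def distrib_left of_real_mult by (simp only: mult_ac)
      finally show ?thesis .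
    qed
    show "integrable lborel (\<lambda>r. of_real (exp (- l * exp r)) * \<phi> r)"
      using L0[of 0] by (simp add: has_bochner_integral_iff)
    show "(LBINT r. of_real (exp (- (l + real n) * exp r)) * \<phi> r) = 0" for n :: nat
      using L0[of n] by (simp only: has_bochner_integral_iff)
  qed (auto intro!: continuous_intros)
  thus ?thesis by (simp add: \<phi>_def add_eq_0_iff2)
qed

end

section \<open>The inversion theorem\<close>

lemma gauss_tail_integral:
  fixes c y :: real
  assumes c: "c > 0" and y: "y > 0"
  shows "has_bochner_integral lborel (\<lambda>\<xi>. exp (2 * \<xi> - c * exp (2 * \<xi>)) * indicator {ln y..} \<xi>) (exp (- (c * y\<^sup>2)) / (2 * c))"
proof (rule has_bochner_integral_nn_integral)
  let ?F = "\<lambda>\<xi>. - (exp (- (c * exp (2 * \<xi>))) / (2 * c))"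
  have "filterlim (\<lambda>\<xi>. - (c * exp (2 * \<xi>))) at_bot (at_top :: real filter)"
    unfolding filterlim_uminus_at_bot minus_minus
    by (intro filterlim_tendsto_pos_mult_at_top[OF tendsto_const] c filterlim_compose[OF exp_at_top] filterlim_ident) simp
  hence "((\<lambda>\<xi>. exp (- (c * exp (2 * \<xi>)))) \<longlongrightarrow> 0) (at_top :: real filter)"
    by (rule filterlim_compose[OF exp_at_bot])
  hence "(?F \<longlongrightarrow> - (0 / (2 * c))) at_top" using c by (intro tendsto_intros) auto
  hence lim: "(?F \<longlongrightarrow> 0) at_top" by simp
  have "(\<integral>\<^sup>+ \<xi>. ennreal (exp (2 * \<xi> - c * exp (2 * \<xi>))) * indicator {ln y..} \<xi> \<partial>lborel) = ennreal (0 - ?F (ln y))"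
  proof (rule nn_integral_FTC_atLeast[OF _ _ _ lim])
    show "(?F has_real_derivative exp (2 * \<xi> - c * exp (2 * \<xi>))) (at \<xi>)" for \<xi>
      using c by (auto intro!: derivative_eq_intros simp: exp_diff exp_minus field_simps)
  qed auto
  also have "exp (2 * ln y) = y\<^sup>2" using y by (simp add: exp_double)
  finally show "(\<integral>\<^sup>+ \<xi>. ennreal (exp (2 * \<xi> - c * exp (2 * \<xi>)) * indicator {ln y..} \<xi>) \<partial>lborel) = ennreal (exp (- (c * y\<^sup>2)) / (2 * c))"
    by (simp add: ennreal_mult' ennreal_indicator)
qed (use c in auto)

context index_transform_integrable
begin

lemma has_vector_derivative_primitive:
  assumes x: "x > 0"
  shows "(primitive has_vector_derivative f x) (at x)"
proof -
  define a where "a = x / 2"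
  have a: "0 < a" "a < x" using x by (auto simp: a_def)
  have P: "primitive y = primitive a + integral {a..y} f" if y: "y \<in> {a<..<x + 1}" for y
  proof -
    have s: "set_integrable lborel {a<..y} f"
      unfolding set_integrable_def by (rule integrable_mult_indicator[OF _ f_int]) auto
    have s': "set_integrable lborel {a..y} f"
      unfolding set_integrable_def by (rule integrable_mult_indicator[OF _ f_int]) auto
    have sa: "integrable lborel (\<lambda>z. indicator {..a} z *\<^sub>R f z)"
      by (rule integrable_mult_indicator[OF _ f_int]) auto
    have "indicator {..y} z *\<^sub>R f z = indicator {..a} z *\<^sub>R f z + indicator {a<..y} z *\<^sub>R f z" for z
      using y by (auto simp: indicator_def)
    hence "primitive y = primitive a + (LBINT z. indicator {a<..y} z *\<^sub>R f z)"
      unfolding primitive_def using sa s by (simp add: set_integrable_def)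
    also have "(LBINT z. indicator {a<..y} z *\<^sub>R f z) = (LBINT z. indicator {a..y} z *\<^sub>R f z)"
    proof (rule integral_cong_AE)
      show "AE z in lborel. indicator {a<..y} z *\<^sub>R f z = indicator {a..y} z *\<^sub>R f z"
        using AE_lborel_singleton[of a] by eventually_elim (auto simp: indicator_def)
    qed auto
    also have "\<dots> = integral {a..y} f"
      using set_borel_integral_eq_integral(2)[OF s'] by (simp add: set_lebesgue_integral_def)
    finally show ?thesis .
  qed
  have "((\<lambda>u. integral {a..u} f) has_vector_derivative f x) (at x within {a..x + 1})"
    using a by (intro integral_has_vector_derivative continuous_on_subset[OF f_cont]) auto
  hence "((\<lambda>u. integral {a..u} f) has_vector_derivative f x) (at x)"
    using a at_within_interior[of x "{a..x + 1}"] by simp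
  hence "((\<lambda>u. primitive a + integral {a..u} f) has_vector_derivative 0 + f x) (at x)"
    by (intro has_vector_derivative_add has_vector_derivative_const)
  hence "(primitive has_vector_derivative 0 + f x) (at x)"
    by (rule has_vector_derivative_transform_within_open[where S = "{a<..<x + 1}"]) (use a P in auto)
  thus ?thesis by simp
qed

lemma primitive_exp_cont: "continuous_on UNIV (\<lambda>\<xi>. primitive (exp \<xi>))"
proof (rule continuous_on_compose2[where g = primitive and t = "{0<..}"])
  show "continuous_on {0<..} primitive"
    using has_vector_derivative_primitive
    by (intro continuous_at_imp_continuous_on) (auto intro: has_vector_derivative_continuous)
qed (auto intro!: continuous_intros)

text \<open>An integration by parts, carried out by exchanging the two integrals.\<close>

lemma gauss_primitive:
  assumes c: "c > 0"
  shows "has_bochner_integral lborel (\<lambda>\<xi>. of_real (exp (2 * \<xi> - c * exp (2 * \<xi>))) * primitive (exp \<xi>))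
           (gauss (- ln c) / of_real (2 * c))"
proof -
  define h where "h = (\<lambda>(y, \<xi>). of_real (exp (2 * \<xi> - c * exp (2 * \<xi>))) * (indicator {..exp \<xi>} y *\<^sub>R f y))"
  have [measurable]: "h \<in> borel_measurable (lborel \<Otimes>\<^sub>M lborel)"
  proof -
    have "h = (\<lambda>(y, \<xi>). of_real (exp (2 * \<xi> - c * exp (2 * \<xi>))) * (if y \<le> exp \<xi> then f y else 0))"
      by (auto simp: h_def fun_eq_iff)
    thus ?thesis by simp
  qed
  have T: "integrable (lborel \<Otimes>\<^sub>M lborel) h"
  proof (rule Fubini_product_bound[where a = "\<lambda>y. norm (f y)" and b = "\<lambda>\<xi>. exp (2 * \<xi> - c * exp (2 * \<xi>))"])
    show "norm (h (y, \<xi>)) \<le> norm (f y) * exp (2 * \<xi> - c * exp (2 * \<xi>))" for y \<xi>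
      by (auto simp: h_def norm_mult indicator_def)
  qed (use f_int gauss_weight_int[OF c] in \<open>auto simp: sigma_finite_lborel has_bochner_integral_iff\<close>)
  have inner: "(LBINT \<xi>. h (y, \<xi>)) = (of_real (exp (- (y\<^sup>2 * exp (- (- ln c))))) * f y) / of_real (2 * c)" for y
  proof (cases "y > 0")
    case True
    have "y \<le> exp \<xi> \<longleftrightarrow> ln y \<le> \<xi>" for \<xi>
      using True by (metis exp_le_cancel_iff exp_ln)
    hence "h (y, \<xi>) = of_real (exp (2 * \<xi> - c * exp (2 * \<xi>)) * indicator {ln y..} \<xi>) * f y" for \<xi>
      by (auto simp: h_def indicator_def)
    hence "(LBINT \<xi>. h (y, \<xi>)) = of_real (exp (- (c * y\<^sup>2)) / (2 * c)) * f y"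
      using has_bochner_integral_integral_eq[OF gauss_tail_integral[OF c True]]
      by (simp only: integral_mult_left_zero integral_complex_of_real)
    thus ?thesis using c by (simp add: mult.commute)
  next
    case False
    thus ?thesis using f_nonpos[of y] by (simp add: h_def)
  qed
  have inner2: "(LBINT y. h (y, \<xi>)) = of_real (exp (2 * \<xi> - c * exp (2 * \<xi>))) * primitive (exp \<xi>)" for \<xi>
    unfolding h_def prod.case primitive_def by (rule integral_mult_right_zero)
  have T': "integrable (lborel \<Otimes>\<^sub>M lborel) (\<lambda>(y, \<xi>). h (y, \<xi>))" using T by simp
  have "(LBINT \<xi>. (LBINT y. h (y, \<xi>))) = (LBINT y. (LBINT \<xi>. h (y, \<xi>)))"
    using lborel_pair.integral_snd[OF T'] lborel_pair.integral_fst[OF T'] by simp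
  also have "\<dots> = gauss (- ln c) / of_real (2 * c)"
    unfolding inner gauss_def by (rule integral_divide_zero)
  finally show ?thesis
    using lborel_pair.integrable_snd[OF T'] unfolding inner2 has_bochner_integral_iff by blast
qed

text \<open>By \<open>gauss_inverse_eq\<close> and \<open>gauss_primitive\<close> both sides, weighted by \<open>x\<close>, have the same
Laplace transform in \<open>x\<^sup>2\<close>; the point \<open>c\<close> of the transform corresponds to
\<open>r = -ln c\<close>.\<close>

lemma index_inverse_eq_primitive:
  assumes x: "x > 0"
  shows "index_inverse x = - 2 * of_real pi * \<i> * primitive x"
proof -
  define \<phi> where "\<phi> \<xi> = of_real (exp (2 * \<xi>)) * (index_inverse (exp \<xi>) + 2 * of_real pi * \<i> * primitive (exp \<xi>))" for \<xi>
  have "\<phi> (ln x) = 0"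
  proof (rule laplace_unique[where E = "\<lambda>\<xi>. exp (2 * \<xi>)" and l = 1 and \<phi> = \<phi>])
    show "strict_mono (\<lambda>\<xi>::real. exp (2 * \<xi>))" by (simp add: strict_mono_def)
    show "continuous_on UNIV \<phi>" unfolding \<phi>_def by (intro continuous_intros index_inverse_exp_cont primitive_exp_cont)
    have L0: "has_bochner_integral lborel (\<lambda>\<xi>. of_real (exp (- (1 + real n) * exp (2 * \<xi>))) * \<phi> \<xi>) 0" for n
    proof -
      define c where "c = 1 + real n"
      have c: "c > 0" by (simp add: c_def)
      have ec: "exp (2 * \<xi> - - ln c) = c * exp (2 * \<xi>)" for \<xi>
        using c by (simp add: exp_add)
      have 1: "has_bochner_integral lborel (\<lambda>\<xi>. of_real (exp (2 * \<xi> - c * exp (2 * \<xi>))) * index_inverse (exp \<xi>))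
          (- of_real pi * \<i> * (of_real (1 / c) * gauss (- ln c)))"
        using gauss_inverse_integrand_int[of "- ln c"] gauss_inverse_eq[of "- ln c"] c
        unfolding gauss_inverse_def ec by (simp add: has_bochner_integral_iff exp_minus inverse_eq_divide)
      have "has_bochner_integral lborel (\<lambda>\<xi>. of_real (exp (2 * \<xi> - c * exp (2 * \<xi>))) * index_inverse (exp \<xi>)
          + 2 * of_real pi * \<i> * (of_real (exp (2 * \<xi> - c * exp (2 * \<xi>))) * primitive (exp \<xi>)))
         (- of_real pi * \<i> * (of_real (1 / c) * gauss (- ln c)) + 2 * of_real pi * \<i> * (gauss (- ln c) / of_real (2 * c)))"
        by (intro has_bochner_integral_add has_bochner_integral_mult_right 1 gauss_primitive c)
      also have "- of_real pi * \<i> * (of_real (1 / c) * gauss (- ln c)) + 2 * of_real pi * \<i> * (gauss (- ln c) / of_real (2 * c)) = 0"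
        using c by simp
      also have "(\<lambda>\<xi>. of_real (exp (2 * \<xi> - c * exp (2 * \<xi>))) * index_inverse (exp \<xi>)
          + 2 * of_real pi * \<i> * (of_real (exp (2 * \<xi> - c * exp (2 * \<xi>))) * primitive (exp \<xi>))) = (\<lambda>\<xi>. of_real (exp (- (1 + real n) * exp (2 * \<xi>))) * \<phi> \<xi>)"
      proof
        fix \<xi>
        have "exp (2 * \<xi> - c * exp (2 * \<xi>)) = exp (- (1 + real n) * exp (2 * \<xi>)) * exp (2 * \<xi>)"
          unfolding exp_add[symmetric] by (simp add: c_def algebra_simps)
        thus "of_real (exp (2 * \<xi> - c * exp (2 * \<xi>))) * index_inverse (exp \<xi>)
          + 2 * of_real pi * \<i> * (of_real (exp (2 * \<xi> - c * exp (2 * \<xi>))) * primitive (exp \<xi>)) = of_real (exp (- (1 + real n) * exp (2 * \<xi>))) * \<phi> \<xi>"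
          unfolding \<phi>_def distrib_left of_real_mult by (simp only: of_real_mult mult_ac)
      qed
      finally show ?thesis .
    qed
    show "integrable lborel (\<lambda>\<xi>. of_real (exp (- 1 * exp (2 * \<xi>))) * \<phi> \<xi>)"
      using L0[of 0] by (simp add: has_bochner_integral_iff)
    show "(LBINT \<xi>. of_real (exp (- (1 + real n) * exp (2 * \<xi>))) * \<phi> \<xi>) = 0" for n :: nat
      using L0[of n] by (simp only: has_bochner_integral_iff)
  qed (auto intro!: continuous_intros)
  hence "index_inverse x + 2 * of_real pi * \<i> * primitive x = 0" using x by (simp add: \<phi>_def)
  thus ?thesis by (simp add: add_eq_0_iff2)
qed

lemma index_inversion:
  assumes x: "x > 0"
  shows "f x = \<i> / (2 * of_real pi) * (LBINT \<tau>. deriv_integrand x \<tau>)"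
proof -
  let ?D = "\<integral>\<tau>. deriv_integrand x \<tau> \<partial>lborel"
  have "((\<lambda>x. - 2 * of_real pi * \<i> * primitive x) has_vector_derivative - 2 * of_real pi * \<i> * f x) (at x)"
    by (intro has_vector_derivative_mult_right has_vector_derivative_primitive x)
  hence "(index_inverse has_vector_derivative - 2 * of_real pi * \<i> * f x) (at x)"
    by (rule has_vector_derivative_transform_within_open[where S = "{0<..}"]) (use x index_inverse_eq_primitive in auto)
  hence D: "?D = - 2 * of_real pi * \<i> * f x"
    using has_vector_derivative_index_inverse(2)[OF x] by (rule vector_derivative_unique_at[rotated])
  show ?thesis unfolding D by simp
qed

end

theorem theorem8:
  fixes \<nu> p q :: real
    and f :: "real \<Rightarrow> complex"
    and fstar :: "complex \<Rightarrow> complex"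
  assumes "\<nu> < 1" and "1 < p" and "p \<le> 2" and "q = p / (p - 1)"
    and "Lq_weighted \<nu> q f"
    and "mellin_in_mean \<nu> p f fstar"
    and "\<And>x. x > 0 \<Longrightarrow> f x = inverse_mellin \<nu> fstar x"
    and "Lp_line \<nu> p (\<lambda>s. s * fstar s)"
    and "set_integrable lebesgue {1<..} f"
    and "integrable lebesgue
           (\<lambda>\<tau>. of_real (\<tau> * exp (pi * \<bar>\<tau>\<bar>)) * index_transform f \<tau>)"
    and "mellin f 1 = 0"
  shows "\<forall>x>0.
    integrable lebesgue (\<lambda>\<tau>.
        vector_derivative (\<lambda>y. bessel_I (\<i> * of_real \<tau> / 2) (of_real y) ^ 2) (at x)
          * index_transform f \<tau> * of_real \<tau>) \<and>
    f x = \<i> / (2 * of_real pi) * (LINT \<tau>|lebesgue.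
        vector_derivative (\<lambda>y. bessel_I (\<i> * of_real \<tau> / 2) (of_real y) ^ 2) (at x)
          * index_transform f \<tau> * of_real \<tau>)"
proof -
  \<comment> \<open>The weight \<open>x\<^bsup>-3e\<^esup>\<close> of the locale must stay integrable against \<open>x\<^bsup>-\<nu>\<^esup>\<close> at 0.\<close>
  define e where "e = min 1 ((1 - \<nu>) / 6)"
  have "e \<le> (1 - \<nu>) / 6" unfolding e_def by (rule min.cobounded2)
  hence "3 * e + \<nu> < 1" using assms(1) by (simp add: field_simps)
  moreover have "0 < e" "e \<le> 1" using assms(1) by (simp_all add: e_def)
  ultimately have e: "0 < e" "e \<le> 1" "3 * e + \<nu> < 1" by auto
  define f0 where "f0 x = (if x > 0 then f x else 0)" for x
  have "Lp_line \<nu> p fstar" using assms(6) by (simp add: mellin_in_mean_def)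
  hence fs: "integrable lebesgue (\<lambda>t. fstar (Complex \<nu> t))"
    by (intro Lp_line_imp_integrable[OF assms(2,3)] assms(8))
  have cont: "continuous_on {0<..} f"
    using inverse_mellin_regular(1)[OF fs] assms(7)
      continuous_on_cong[of "{0<..}" "{0<..}" f "inverse_mellin \<nu> fstar"] by auto
  obtain C where C: "\<And>x. x > 0 \<Longrightarrow> norm (f x) \<le> C * x powr (- \<nu>)"
    using inverse_mellin_regular(2)[OF fs] assms(7) by auto
  have C0: "C \<ge> 0" using order_trans[OF norm_ge_zero C[of 1]] by simp
  have f0_cont: "continuous_on {0<..} f0"
    using cont continuous_on_cong[of "{0<..}" "{0<..}" f0 f] by (auto simp: f0_def)
  have f0_meas [measurable]: "f0 \<in> borel_measurable borel"
    using borel_measurable_continuous_on_if[of "{0<..}" f "\<lambda>_. 0"] cont unfolding f0_def by simp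
  \<comment> \<open>One majorant serves for \<open>f0\<close> and for its weighted form, as the weight exceeds 1 only below 1.\<close>
  define b where "b x = indicator {0<..1} x * (C * x powr (- 3 * e - \<nu>)) + norm (indicator {1<..} x *\<^sub>R f0 x)" for x
  have b_int: "integrable lborel b"
    unfolding b_def
  proof (rule Bochner_Integration.integrable_add)
    have "(\<lambda>x. x powr (- 3 * e - \<nu>)) absolutely_integrable_on {0<..1}"
      using e by (intro nonnegative_absolutely_integrable_1 integrable_on_powr_from_0') auto
    hence "integrable lborel (\<lambda>x. indicator {0<..1} x *\<^sub>R (x powr (- 3 * e - \<nu>)))"
      unfolding set_integrable_def by (subst (asm) integrable_completion) auto
    hence "integrable lborel (\<lambda>x. C * (indicator {0<..1} x *\<^sub>R (x powr (- 3 * e - \<nu>))))" by (rule integrable_mult_right)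
    thus "integrable lborel (\<lambda>x. indicator {0<..1} x * (C * x powr (- 3 * e - \<nu>)))" by (simp add: mult_ac)
    have "integrable lebesgue (\<lambda>x. indicator {1<..} x *\<^sub>R f x)" using assms(9) by (simp add: set_integrable_def)
    also have "(\<lambda>x. indicator {1<..} x *\<^sub>R f x) = (\<lambda>x. indicator {1<..} x *\<^sub>R f0 x)"
      by (auto simp: f0_def fun_eq_iff indicator_def)
    finally have "integrable lborel (\<lambda>x. indicator {1<..} x *\<^sub>R f0 x)" by (subst (asm) integrable_completion) auto
    thus "integrable lborel (\<lambda>x. norm (indicator {1<..} x *\<^sub>R f0 x))" by (rule integrable_norm)
  qed
  have bounds: "norm (f0 x) \<le> b x" "x powr (- 3 * e) * norm (f0 x) \<le> b x" for x
  proof -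
    consider "x \<le> 0" | "0 < x" "x \<le> 1" | "x > 1" by linarith
    hence "norm (f0 x) \<le> b x \<and> x powr (- 3 * e) * norm (f0 x) \<le> b x"
    proof cases
      case 1 thus ?thesis by (simp add: f0_def b_def)
    next
      case 2
      have "x powr (- 3 * e) * norm (f x) \<le> x powr (- 3 * e) * (C * x powr (- \<nu>))"
        using C[of x] 2 by (intro mult_left_mono) auto
      also have "\<dots> = C * x powr (- 3 * e - \<nu>)" by (simp add: powr_diff powr_minus field_simps)
      finally have *: "x powr (- 3 * e) * norm (f x) \<le> C * x powr (- 3 * e - \<nu>)" .
      have "x powr 0 \<le> x powr (- 3 * e)" using 2 e by (intro powr_mono') auto
      hence "1 \<le> x powr (- 3 * e)" using 2 by simp
      hence "1 * norm (f x) \<le> x powr (- 3 * e) * norm (f x)" by (intro mult_right_mono) auto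
      thus ?thesis using * 2 by (simp add: f0_def b_def)
    next
      case 3
      have "x powr (- 3 * e) \<le> x powr 0" using 3 e by (intro powr_mono) auto
      hence "x powr (- 3 * e) * norm (f x) \<le> 1 * norm (f x)" using 3 by (intro mult_right_mono) auto
      thus ?thesis using 3 by (simp add: f0_def b_def)
    qed
    thus "norm (f0 x) \<le> b x" "x powr (- 3 * e) * norm (f0 x) \<le> b x" by auto
  qed
  interpret half_line_function f0 e
  proof
    show "integrable lborel f0"
      by (rule Bochner_Integration.integrable_bound[OF b_int]) (use bounds(1) in \<open>auto intro!: AE_I2 order_trans[OF _ abs_ge_self]\<close>)
    show "integrable lborel (\<lambda>x. x powr (- 3 * e) * norm (f0 x))"
      by (rule Bochner_Integration.integrable_bound[OF b_int])
         (use bounds(2) in \<open>auto intro!: AE_I2 order_trans[OF _ abs_ge_self]\<close>)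
  qed (use e f0_cont f0_meas in \<open>auto simp: f0_def\<close>)
  have F: "index_transform f \<tau> = index_fourier \<tau>" if "\<tau> \<noteq> 0" for \<tau>
    by (rule index_transform_eq_fourier[OF that]) (simp add: f0_def)
  interpret index_transform_integrable f0 e
  proof
    have "(\<lambda>\<tau>. of_real (\<tau> * exp (pi * \<bar>\<tau>\<bar>)) * index_transform f \<tau>) = (\<lambda>\<tau>. of_real (\<tau> * exp (pi * \<bar>\<tau>\<bar>)) * index_fourier \<tau>)"
      using F by (auto simp: fun_eq_iff)
    with assms(10) have "integrable lebesgue (\<lambda>\<tau>. of_real (\<tau> * exp (pi * \<bar>\<tau>\<bar>)) * index_fourier \<tau>)"
      by (simp only:)
    thus "integrable lborel (\<lambda>\<tau>. of_real (\<tau> * exp (pi * \<bar>\<tau>\<bar>)) * index_fourier \<tau>)"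
      by (subst (asm) integrable_completion) auto
  qed
  show ?thesis
  proof (intro allI impI)
    fix x :: real assume x: "x > 0"
    define g where "g \<tau> = deriv_integrand x \<tau>" for \<tau>
    have g: "integrable lborel g"
      unfolding g_def by (rule has_vector_derivative_index_inverse(1)[OF x])
    have eq: "vector_derivative (\<lambda>y. bessel_I (\<i> * of_real \<tau> / 2) (of_real y) ^ 2) (at x) * index_transform f \<tau> * of_real \<tau> = g \<tau>" for \<tau>
    proof (cases "\<tau> = 0")
      case False
      have "vector_derivative (\<lambda>y. bessel_I (\<i> * of_real \<tau> / 2) (of_real y) ^ 2) (at x) = bessel_I_square_deriv (\<i> * of_real \<tau> / 2) x"
        by (intro vector_derivative_at has_vector_derivative_bessel_I_square x) simp
      thus ?thesis using F[OF False] by (simp add: g_def mult_ac)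
    qed (simp add: g_def)
    have gm: "g \<in> borel_measurable lborel" using g by auto
    have "f x = \<i> / (2 * of_real pi) * (LINT \<tau>|lebesgue. g \<tau>)"
    proof -
      have "f x = \<i> / (2 * of_real pi) * (LINT \<tau>|lborel. g \<tau>)"
        using index_inversion[OF x] x by (simp add: f0_def g_def)
      thus ?thesis by (simp only: integral_completion[OF gm])
    qed
    moreover have "integrable lebesgue g" using g integrable_completion[OF gm] by simp
    ultimately show "integrable lebesgue (\<lambda>\<tau>.
        vector_derivative (\<lambda>y. bessel_I (\<i> * of_real \<tau> / 2) (of_real y) ^ 2) (at x)
          * index_transform f \<tau> * of_real \<tau>) \<and>
      f x = \<i> / (2 * of_real pi) * (LINT \<tau>|lebesgue.
        vector_derivative (\<lambda>y. bessel_I (\<i> * of_real \<tau> / 2) (of_real y) ^ 2) (at x)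
          * index_transform f \<tau> * of_real \<tau>)"
      unfolding eq by blast
  qed
qed

end
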